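(* Let $\mu$ be a probability distribution on $\Omega=\Lambda^N$ and let $\mathbf{A}=(a_{ij})_{i,j\le N}$ be a Dobrushin interdependence matrix of $\mu$. Consider the Glauber dynamics Markov chain with random scan on $\Omega$: in each step, choose a coordinate $I$ uniformly from $\{1,\ldots,N\}$ and replace the $I$-th coordinate of the current state $x$ by an independent draw from $\mu_I(\cdot|x_{-I})$. Then for every integer $k\ge1$, $$\kappa_k\ge1-\left\|\left(\frac{N-1}{N}\mathbf{I}+\frac1N\mathbf{A}\right)^k\right\|_1 .$$ In particular, the absolute spectral gap $\gamma^*$ of this chain satisfies $$\gamma^*\ge1-\mathrm{sp}\left(\frac{N-1}{N}\mathbf{I}+\frac1N\mathbf{A}\right)\ge\frac{1-\mathrm{sp}(\mathbf{A})}{N},$$ where $\mathrm{sp}$ denotes the spectral radius.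
   Context: $(\Lambda,d_\Lambda)$ is a Polish metric space, $\Omega=\Lambda^N$ with metric $d(x,y)=\sum_{i=1}^N d_\Lambda(x_i,y_i)$, and $x_{-i}=(x_1,\ldots,x_{i-1},x_{i+1},\ldots,x_N)$. For $X\sim\mu$, $\mu_i(\cdot|x_{-i})$ denotes the conditional distribution of $X_i$ given $X_{-i}=x_{-i}$ (a version defined for all $x$). $\mathbf{A}=(a_{ij})$ is a Dobrushin interdependence matrix of $\mu$ if $a_{ii}=0$ for all $i$ and for all $x,y\in\Omega$ and all $i$, $W_1(\mu_i(\cdot|x_{-i}),\mu_i(\cdot|y_{-i}))\le\sum_{j=1}^N a_{ij}\,d_\Lambda(x_j,y_j)$, with $W_1$ the Wasserstein distance for $d_\Lambda$ (its entries are nonnegative). $\|\cdot\|_1$ is the matrix norm induced by the $\ell^1$ norm on column vectors (maximal column sum of absolute values). With $P$ the kernel of the chain (assumed to satisfy $W_1(\delta_x,P_x)<\infty$ for all $x$) and $P^k_x$ the law after $k$ steps from $x$, $W_1(\mu_1,\mu_2)=\inf\mathbb{E}(d(X,Y))$ over couplings of $\mu_1,\mu_2$ on $(\Omega,d)$; $\kappa_k(x,y)=1-W_1(P^k_x,P^k_y)/d(x,y)$ for $x\ne y$, $\kappa_k(x,x)=1$, $\kappa_k=\inf_{x,y}\kappa_k(x,y)$. The stationary distribution is $\mu$. With $\mathbf{P}$ acting on complex $L_2(\mu)$ and $S_2=\{\lambda\in\mathbb{C}\setminus\{0\}:(\lambda\mathbf{I}-\mathbf{P})^{-1}\text{ does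 not exist as a bounded operator on }L_2(\mu)\}$, $\gamma^*=1-\sup\{|\lambda|:\lambda\in S_2,\lambda\ne1\}$ if the eigenvalue $1$ has multiplicity $1$ (supremum of the empty set being $0$), and $\gamma^*=0$ otherwise. *)

theory Defs
  imports "HOL-Probability.Probability" "Jordan_Normal_Form.Spectral_Radius"
begin

definition couplings :: "'a measure \<Rightarrow> 'a measure \<Rightarrow> ('a \<times> 'a) measure set" where
  "couplings \<mu> \<nu> = {\<pi>. sets \<pi> = sets (\<mu> \<Otimes>\<^sub>M \<nu>) \<and> distr \<pi> \<mu> fst = \<mu> \<and> distr \<pi> \<nu> snd = \<nu>}"

text \<open>The distance is a parameter, since it is used both on \<open>\<Lambda>\<close> and on \<open>\<Omega>\<close>; the value may be infinite.\<close>

definition W1 :: "('a \<Rightarrow> 'a \<Rightarrow> real) \<Rightarrow> 'a measure \<Rightarrow> 'a measure \<Rightarrow> ennreal" where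
  "W1 d \<mu> \<nu> = (INF \<pi>\<in>couplings \<mu> \<nu>. \<integral>\<^sup>+ (x, y). ennreal (d x y) \<partial>\<pi>)"

primrec kernel_power :: "'a measure \<Rightarrow> ('a \<Rightarrow> 'a measure) \<Rightarrow> nat \<Rightarrow> 'a \<Rightarrow> 'a measure" where
  "kernel_power M P 0 x = return M x"
| "kernel_power M P (Suc k) x = kernel_power M P k x \<bind> P"

text \<open>The curvature is an extended real because \<open>W1\<close> can be infinite; it is then \<open>-\<infinity>\<close>.\<close>

definition kappa_at ::
  "'a measure \<Rightarrow> ('a \<Rightarrow> 'a \<Rightarrow> real) \<Rightarrow> ('a \<Rightarrow> 'a measure) \<Rightarrow> nat \<Rightarrow> 'a \<Rightarrow> 'a \<Rightarrow> ereal" where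
  "kappa_at M d P k x y =
     (if x = y then 1
      else 1 - enn2ereal (W1 d (kernel_power M P k x) (kernel_power M P k y)) / ereal (d x y))"

definition kappa ::
  "'a measure \<Rightarrow> ('a \<Rightarrow> 'a \<Rightarrow> real) \<Rightarrow> ('a \<Rightarrow> 'a measure) \<Rightarrow> nat \<Rightarrow> ereal" where
  "kappa M d P k = (INF x\<in>space M. INF y\<in>space M. kappa_at M d P k x y)"

text \<open>Elements of complex \<open>L\<^sub>2(\<mu>)\<close> are represented by functions, with equality almost everywhere
  in place of equality; operators therefore have to respect equality almost everywhere.\<close>

definition L2 :: "'a measure \<Rightarrow> ('a \<Rightarrow> complex) set" where
  "L2 \<mu> = {f \<in> borel_measurable \<mu>. integrable \<mu> (\<lambda>x. (cmod (f x))\<^sup>2)}"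

definition L2_norm :: "'a measure \<Rightarrow> ('a \<Rightarrow> complex) \<Rightarrow> real" where
  "L2_norm \<mu> f = sqrt (\<integral>x. (cmod (f x))\<^sup>2 \<partial>\<mu>)"

definition bounded_L2_operator ::
  "'a measure \<Rightarrow> (('a \<Rightarrow> complex) \<Rightarrow> ('a \<Rightarrow> complex)) \<Rightarrow> bool" where
  "bounded_L2_operator \<mu> T \<longleftrightarrow>
     (\<forall>f\<in>L2 \<mu>. T f \<in> L2 \<mu>) \<and>
     (\<forall>f\<in>L2 \<mu>. \<forall>g\<in>L2 \<mu>. (AE x in \<mu>. f x = g x) \<longrightarrow> (AE x in \<mu>. T f x = T g x)) \<and>
     (\<forall>f\<in>L2 \<mu>. \<forall>g\<in>L2 \<mu>. AE x in \<mu>. T (\<lambda>z. f z + g z) x = T f x + T g x) \<and>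
     (\<forall>f\<in>L2 \<mu>. \<forall>c. AE x in \<mu>. T (\<lambda>z. c * f z) x = c * T f x) \<and>
     (\<exists>C. \<forall>f\<in>L2 \<mu>. L2_norm \<mu> (T f) \<le> C * L2_norm \<mu> f)"

definition markov_operator :: "('a \<Rightarrow> 'a measure) \<Rightarrow> ('a \<Rightarrow> complex) \<Rightarrow> ('a \<Rightarrow> complex)" where
  "markov_operator P f = (\<lambda>x. \<integral>y. f y \<partial>P x)"

definition L2_resolvent_exists :: "'a measure \<Rightarrow> ('a \<Rightarrow> 'a measure) \<Rightarrow> complex \<Rightarrow> bool" where
  "L2_resolvent_exists \<mu> P l \<longleftrightarrow>
     (\<exists>R. bounded_L2_operator \<mu> R \<and>
       (\<forall>f\<in>L2 \<mu>. AE x in \<mu>. l * R f x - markov_operator P (R f) x = f x) \<and>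
       (\<forall>f\<in>L2 \<mu>. AE x in \<mu>. R (\<lambda>z. l * f z - markov_operator P f z) x = f x))"

definition S2 :: "'a measure \<Rightarrow> ('a \<Rightarrow> 'a measure) \<Rightarrow> complex set" where
  "S2 \<mu> P = {l. l \<noteq> 0 \<and> \<not> L2_resolvent_exists \<mu> P l}"

definition L2_eigenfunctions :: "'a measure \<Rightarrow> ('a \<Rightarrow> 'a measure) \<Rightarrow> complex \<Rightarrow> ('a \<Rightarrow> complex) set"
  where "L2_eigenfunctions \<mu> P l = {f \<in> L2 \<mu>. AE x in \<mu>. markov_operator P f x = l * f x}"

text \<open>Multiplicity is the dimension of the eigenspace in \<open>L\<^sub>2(\<mu>)\<close>, i.e. modulo null sets.\<close>

definition has_multiplicity_one :: "'a measure \<Rightarrow> ('a \<Rightarrow> 'a measure) \<Rightarrow> complex \<Rightarrow> bool" where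
  "has_multiplicity_one \<mu> P l \<longleftrightarrow>
     (\<exists>f\<in>L2_eigenfunctions \<mu> P l. \<not> (AE x in \<mu>. f x = 0) \<and>
       (\<forall>g\<in>L2_eigenfunctions \<mu> P l. \<exists>c. AE x in \<mu>. g x = c * f x))"

definition absolute_spectral_gap :: "'a measure \<Rightarrow> ('a \<Rightarrow> 'a measure) \<Rightarrow> real" where
  "absolute_spectral_gap \<mu> P =
     (if has_multiplicity_one \<mu> P 1
      then 1 - (if S2 \<mu> P - {1} = {} then 0 else SUP l\<in>S2 \<mu> P - {1}. cmod l)
      else 0)"

text \<open>Coordinates are indexed by \<open>{..<N}\<close>. Since \<open>\<Lambda>\<close> is second countable, the product
  \<open>\<sigma>\<close>-algebra below is the Borel \<open>\<sigma>\<close>-algebra of \<open>\<Omega> = \<Lambda>\<^sup>N\<close>.\<close>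

abbreviation Omega :: "nat \<Rightarrow> (nat \<Rightarrow> 'l::polish_space) measure" where
  "Omega N \<equiv> \<Pi>\<^sub>M i\<in>{..<N}. borel"

abbreviation Omega_minus :: "nat \<Rightarrow> nat \<Rightarrow> (nat \<Rightarrow> 'l::polish_space) measure" where
  "Omega_minus N i \<equiv> \<Pi>\<^sub>M j\<in>{..<N} - {i}. borel"

definition sum_dist :: "nat \<Rightarrow> (nat \<Rightarrow> 'l::polish_space) \<Rightarrow> (nat \<Rightarrow> 'l) \<Rightarrow> real" where
  "sum_dist N x y = (\<Sum>i<N. dist (x i) (y i))"

definition drop_coord :: "nat \<Rightarrow> nat \<Rightarrow> (nat \<Rightarrow> 'l) \<Rightarrow> (nat \<Rightarrow> 'l)" where
  "drop_coord N i x = restrict x ({..<N} - {i})"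

text \<open>\<open>K i\<close> is a regular conditional distribution, under \<open>\<mu>\<close>, of the \<open>i\<close>-th coordinate given all
  other coordinates; it is defined for every (not just almost every) value of the latter.\<close>

definition conditional_distributions ::
  "nat \<Rightarrow> (nat \<Rightarrow> 'l::polish_space) measure \<Rightarrow> (nat \<Rightarrow> (nat \<Rightarrow> 'l) \<Rightarrow> 'l measure) \<Rightarrow> bool" where
  "conditional_distributions N \<mu> K \<longleftrightarrow>
     (\<forall>i<N. K i \<in> Omega_minus N i \<rightarrow>\<^sub>M prob_algebra borel \<and>
       (\<forall>B\<in>sets borel. \<forall>C\<in>sets (Omega_minus N i).
          emeasure \<mu> {x \<in> space \<mu>. x i \<in> B \<and> drop_coord N i x \<in> C} =
          (\<integral>\<^sup>+ x. emeasure (K i (drop_coord N i x)) B * indicator C (drop_coord N i x) \<partial>\<mu>)))"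

definition dobrushin_matrix ::
  "nat \<Rightarrow> (nat \<Rightarrow> (nat \<Rightarrow> 'l::polish_space) \<Rightarrow> 'l measure) \<Rightarrow> real mat \<Rightarrow> bool" where
  "dobrushin_matrix N K A \<longleftrightarrow>
     A \<in> carrier_mat N N \<and>
     (\<forall>i<N. \<forall>j<N. 0 \<le> A $$ (i, j)) \<and>
     (\<forall>i<N. A $$ (i, i) = 0) \<and>
     (\<forall>x\<in>space (Omega N). \<forall>y\<in>space (Omega N). \<forall>i<N.
        W1 dist (K i (drop_coord N i x)) (K i (drop_coord N i y))
          \<le> ennreal (\<Sum>j<N. A $$ (i, j) * dist (x j) (y j)))"

definition glauber ::
  "nat \<Rightarrow> (nat \<Rightarrow> (nat \<Rightarrow> 'l::polish_space) \<Rightarrow> 'l measure) \<Rightarrow> (nat \<Rightarrow> 'l) \<Rightarrow> (nat \<Rightarrow> 'l) measure" where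
  "glauber N K x =
     uniform_count_measure {..<N} \<bind>
       (\<lambda>i. distr (K i (drop_coord N i x)) (Omega N) (\<lambda>z. x(i := z)))"

definition vec_l1_norm :: "real vec \<Rightarrow> real" where
  "vec_l1_norm v = (\<Sum>i<dim_vec v. \<bar>vec_index v i\<bar>)"

definition mat_l1_norm :: "real mat \<Rightarrow> real" where
  "mat_l1_norm A = (SUP v\<in>{v \<in> carrier_vec (dim_col A). vec_l1_norm v \<le> 1}. vec_l1_norm (A *\<^sub>v v))"

lemma mat_l1_norm_eq_max_column_sum:
  assumes A: "A \<in> carrier_mat m n" and n: "n > 0"
  shows "mat_l1_norm A = Max ((\<lambda>j. \<Sum>i<m. \<bar>A $$ (i, j)\<bar>) ` {..<n})"
proof -
  define c where "c j = (\<Sum>i<m. \<bar>A $$ (i, j)\<bar>)" for j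
  define S where "S = {v :: real vec. v \<in> carrier_vec n \<and> vec_l1_norm v \<le> 1}"
  have dims: "dim_row A = m" "dim_col A = n" using A by auto
  have idx: "vec_index (A *\<^sub>v v) i = (\<Sum>j<n. A $$ (i, j) * vec_index v j)"
    if "v \<in> carrier_vec n" "i < m" for v i
    using that dims by (auto simp: scalar_prod_def lessThan_atLeast0 intro!: sum.cong)
  have upper: "vec_l1_norm (A *\<^sub>v v) \<le> Max (c ` {..<n})" if v: "v \<in> S" for v
  proof -
    have vc: "v \<in> carrier_vec n" "(\<Sum>j<n. \<bar>vec_index v j\<bar>) \<le> 1"
      using v by (auto simp: S_def vec_l1_norm_def)
    have c0: "0 \<le> Max (c ` {..<n})"
      using n by (intro order_trans[OF _ Max_ge[of _ "c 0"]]) (auto simp: c_def sum_nonneg)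
    have "vec_l1_norm (A *\<^sub>v v) = (\<Sum>i<m. \<bar>\<Sum>j<n. A $$ (i, j) * vec_index v j\<bar>)"
      using dims vc idx by (auto simp: vec_l1_norm_def)
    also have "\<dots> \<le> (\<Sum>i<m. \<Sum>j<n. \<bar>A $$ (i, j)\<bar> * \<bar>vec_index v j\<bar>)"
      by (intro sum_mono order_trans[OF sum_abs]) (auto simp: abs_mult)
    also have "\<dots> = (\<Sum>j<n. c j * \<bar>vec_index v j\<bar>)"
      by (subst sum.swap) (simp add: c_def sum_distrib_right)
    also have "\<dots> \<le> (\<Sum>j<n. Max (c ` {..<n}) * \<bar>vec_index v j\<bar>)"
      by (intro sum_mono mult_right_mono Max_ge) auto
    also have "\<dots> \<le> Max (c ` {..<n})"
      using mult_left_mono[OF vc(2) c0] by (simp add: sum_distrib_left)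
    finally show ?thesis .
  qed
  have "Max (c ` {..<n}) \<in> c ` {..<n}" using n by (intro Max_in) auto
  then obtain j where j: "j < n" "c j = Max (c ` {..<n})" by auto
  have u: "unit_vec n j \<in> S"
    using j
    by (auto simp: S_def vec_l1_norm_def unit_vec_def if_distrib[of abs] cong: if_cong)
  have e: "vec_l1_norm (A *\<^sub>v unit_vec n j) = c j"
    using j(1) dims idx[OF unit_vec_carrier, of _ j]
    by (auto simp: vec_l1_norm_def c_def unit_vec_def if_distrib[of "\<lambda>t. _ * t"]
        simp del: index_mult_mat_vec cong: if_cong)
  have "(SUP v\<in>S. vec_l1_norm (A *\<^sub>v v)) = Max (c ` {..<n})"
  proof (rule antisym)
    show "(SUP v\<in>S. vec_l1_norm (A *\<^sub>v v)) \<le> Max (c ` {..<n})"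
      using u upper by (intro cSUP_least) auto
    show "Max (c ` {..<n}) \<le> (SUP v\<in>S. vec_l1_norm (A *\<^sub>v v))"
      using u upper e j(2) by (intro cSUP_upper2[of _ _ "unit_vec n j"]) (auto intro!: bdd_aboveI2)
  qed
  then show ?thesis
    unfolding mat_l1_norm_def S_def dims(2) c_def .
qed

abbreviation real_spectral_radius :: "real mat \<Rightarrow> real" where
  "real_spectral_radius A \<equiv> spectral_radius (map_mat complex_of_real A)"

definition glauber_matrix :: "nat \<Rightarrow> real mat \<Rightarrow> real mat" where
  "glauber_matrix N A = ((real N - 1) / real N) \<cdot>\<^sub>m 1\<^sub>m N + (1 / real N) \<cdot>\<^sub>m A"

end

theory Submission
  imports Defs
begin

text \<open>Both bounds come from the one-step contraction behind \<open>B = glauber_matrix N A\<close>: coupling the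
  resampled coordinates of two chains nearly optimally, the vector of expected coordinate distances
  after one step is dominated by \<open>B\<close> applied to the vector before it. Iterating a measurable kernel of
  such couplings \<open>k\<close> times gives the curvature bound. No measurable selection theorem is needed:
  \<open>\<Lambda>\<close> is cut into countably many small cells, couplings of the discretized laws are approximated by
  countably many dyadic matrices, and the first index that is good enough depends measurably on the
  pair of states.

  For the gap, the dual form of the contraction says that coordinatewise Lipschitz constants of a
  function are multiplied by the transpose of \<open>B\<close>. So for \<open>\<rho>\<close> above the spectral radius of \<open>B\<close> and a
  bounded Lipschitz function \<open>g\<close> of bounded support, the covariance of \<open>g\<close> and \<open>P\<^sup>n g\<close> is \<open>O(\<rho>\<^sup>n)\<close>. The
  chain is reversible, hence \<open>\<parallel>P\<^sup>k g\<parallel>\<^sup>2\<close> is log-convex in \<open>k\<close> for centered \<open>g\<close>, and the decay rate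
  already bounds the first ratio: \<open>\<parallel>P g\<parallel> \<le> \<rho> \<parallel>g\<parallel>\<close>. By density \<open>P\<close> contracts all of the
  centered part of \<open>L\<^sub>2\<close>, and a Neumann series inverts \<open>\<lambda> - P\<close> whenever \<open>\<bar>\<lambda>\<bar> > \<rho>\<close>, \<open>\<lambda> \<noteq> 1\<close>.\<close>

section \<open>Measurable families of near-optimal couplings\<close>

text \<open>The measure \<open>\<mu>\<close> is not assumed to have a finite first moment;
  \<open>W1_step\<close> only bounds the mean displacement of one step from each fixed state. This
  shapes both halves. For the couplings it gives every conditional law \<open>Kx i x\<close> a
  finite first moment, so that mass discarded by an approximation is cheap to move. For the gap it
  forbids integrating a distance against \<open>\<mu>\<close>: convergence of the iterates of a test
  function to its mean is measured at one base point \<open>x0\<close>, by adding up one-step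
  displacements, and bounded support keeps the distance to \<open>x0\<close> bounded inside the
  covariance. The curvature bound has the norm of a power, not the power of a norm, so the whole
  vector of coordinate distances must be carried through \<open>k\<close> steps. That requires one
  coupling kernel, measurable in the pair of states, rather than a good coupling for each pair. The
  constants in the decay of covariances depend on the test function and are not controlled by its
  norm. Log-convexity removes them, and only then can a density argument start.\<close>

text \<open>Marginals are tested on integrals of indicators, because the couplings below arise from
  \<open>density\<close> and \<open>bind\<close>, whose integrals unfold directly.\<close>

lemma couplingsI:
  assumes sets: "sets \<pi> = sets (p \<Otimes>\<^sub>M q)"
    and p: "\<And>S. S \<in> sets p \<Longrightarrow> (\<integral>\<^sup>+z. indicator S (fst z) \<partial>\<pi>) = emeasure p S"
    and q: "\<And>S. S \<in> sets q \<Longrightarrow> (\<integral>\<^sup>+z. indicator S (snd z) \<partial>\<pi>) = emeasure q S"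
  shows "\<pi> \<in> couplings p q"
proof -
  note [measurable_cong] = sets
  have "distr \<pi> p fst = p"
  proof (rule measure_eqI)
    fix S assume "S \<in> sets (distr \<pi> p fst)"
    then have [measurable]: "S \<in> sets p" by simp
    have "emeasure (distr \<pi> p fst) S = (\<integral>\<^sup>+x. indicator S x \<partial>distr \<pi> p fst)" by simp
    also have "\<dots> = (\<integral>\<^sup>+z. indicator S (fst z) \<partial>\<pi>)" by (intro nn_integral_distr) auto
    finally show "emeasure (distr \<pi> p fst) S = emeasure p S" by (simp add: p)
  qed simp
  moreover have "distr \<pi> q snd = q"
  proof (rule measure_eqI)
    fix S assume "S \<in> sets (distr \<pi> q snd)"
    then have [measurable]: "S \<in> sets q" by simp
    have "emeasure (distr \<pi> q snd) S = (\<integral>\<^sup>+x. indicator S x \<partial>distr \<pi> q snd)" by simp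
    also have "\<dots> = (\<integral>\<^sup>+z. indicator S (snd z) \<partial>\<pi>)" by (intro nn_integral_distr) auto
    finally show "emeasure (distr \<pi> q snd) S = emeasure q S" by (simp add: q)
  qed simp
  ultimately show ?thesis using sets by (simp add: couplings_def)
qed

lemma couplings_prob_space:
  assumes "\<pi> \<in> couplings p q" "prob_space p" shows "prob_space \<pi>"
proof -
  have "sets \<pi> = sets (p \<Otimes>\<^sub>M q)" and d: "distr \<pi> p fst = p"
    using assms(1) by (auto simp: couplings_def)
  then have "fst \<in> \<pi> \<rightarrow>\<^sub>M p" by (simp cong: measurable_cong_sets)
  then show ?thesis using d assms(2) by (metis prob_space_distrD)
qed

lemma nn_integral_coupling:
  assumes "\<pi> \<in> couplings p q"
  shows "f \<in> borel_measurable p \<Longrightarrow> (\<integral>\<^sup>+z. f (fst z) \<partial>\<pi>) = (\<integral>\<^sup>+x. f x \<partial>p)"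
    and "g \<in> borel_measurable q \<Longrightarrow> (\<integral>\<^sup>+z. g (snd z) \<partial>\<pi>) = (\<integral>\<^sup>+x. g x \<partial>q)"
proof -
  have s: "sets \<pi> = sets (p \<Otimes>\<^sub>M q)" and d: "distr \<pi> p fst = p" "distr \<pi> q snd = q"
    using assms(1) by (auto simp: couplings_def)
  have m: "fst \<in> \<pi> \<rightarrow>\<^sub>M p" "snd \<in> \<pi> \<rightarrow>\<^sub>M q" using s by (simp_all cong: measurable_cong_sets)
  show "f \<in> borel_measurable p \<Longrightarrow> (\<integral>\<^sup>+z. f (fst z) \<partial>\<pi>) = (\<integral>\<^sup>+x. f x \<partial>p)"
    using nn_integral_distr[OF m(1), of f] by (simp add: d)
  show "g \<in> borel_measurable q \<Longrightarrow> (\<integral>\<^sup>+z. g (snd z) \<partial>\<pi>) = (\<integral>\<^sup>+x. g x \<partial>q)"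
    using nn_integral_distr[OF m(2), of g] by (simp add: d)
qed

lemma integral_coupling:
  fixes f g :: "'a \<Rightarrow> real"
  assumes "\<pi> \<in> couplings p q"
  shows "f \<in> borel_measurable p \<Longrightarrow> (\<integral>z. f (fst z) \<partial>\<pi>) = (\<integral>x. f x \<partial>p)"
    and "g \<in> borel_measurable q \<Longrightarrow> (\<integral>z. g (snd z) \<partial>\<pi>) = (\<integral>x. g x \<partial>q)"
proof -
  have s: "sets \<pi> = sets (p \<Otimes>\<^sub>M q)" and d: "distr \<pi> p fst = p" "distr \<pi> q snd = q"
    using assms(1) by (auto simp: couplings_def)
  have m: "fst \<in> \<pi> \<rightarrow>\<^sub>M p" "snd \<in> \<pi> \<rightarrow>\<^sub>M q" using s by (simp_all cong: measurable_cong_sets)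
  show "f \<in> borel_measurable p \<Longrightarrow> (\<integral>z. f (fst z) \<partial>\<pi>) = (\<integral>x. f x \<partial>p)"
    using integral_distr[OF m(1), of f] by (simp add: d)
  show "g \<in> borel_measurable q \<Longrightarrow> (\<integral>z. g (snd z) \<partial>\<pi>) = (\<integral>x. g x \<partial>q)"
    using integral_distr[OF m(2), of g] by (simp add: d)
qed

text \<open>The level sets of \<open>c\<close> partition the space, so countable additivity turns an
  integral that sees only the cells into a sum over \<open>nat\<close>.\<close>

lemma nn_integral_discretized:
  fixes c :: "'a \<Rightarrow> nat" and g :: "nat \<Rightarrow> ennreal"
  assumes [measurable]: "c \<in> M \<rightarrow>\<^sub>M count_space UNIV"
  shows "(\<integral>\<^sup>+x. g (c x) \<partial>M) = (\<integral>\<^sup>+a. g a * emeasure M (c -` {a} \<inter> space M) \<partial>count_space UNIV)"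
proof -
  have [measurable]: "c -` {a} \<inter> space M \<in> sets M" for a
    using assms by (rule measurable_sets) simp
  have "(\<integral>\<^sup>+x. g (c x) \<partial>M) = (\<integral>\<^sup>+x. (\<Sum>a. g a * indicator (c -` {a} \<inter> space M) x) \<partial>M)"
    by (intro nn_integral_cong, subst suminf_cmult_indicator) (auto simp: disjoint_family_on_def)
  also have "\<dots> = (\<Sum>a. \<integral>\<^sup>+x. g a * indicator (c -` {a} \<inter> space M) x \<partial>M)"
    by (intro nn_integral_suminf) measurable
  also have "\<dots> = (\<Sum>a. g a * emeasure M (c -` {a} \<inter> space M))"
    by (intro arg_cong[where f=suminf] ext nn_integral_cmult_indicator) measurable
  finally show ?thesis
    by (simp add: nn_integral_count_space_nat)
qed

section \<open>Lifting a coupling of cell masses to a coupling of the measures\<close>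

definition cell_mass :: "('a \<Rightarrow> nat) \<Rightarrow> 'a measure \<Rightarrow> nat \<Rightarrow> ennreal" where
  "cell_mass c p a = emeasure p (c -` {a} \<inter> space p)"

text \<open>The pair of cells has law \<open>G\<close>; given the cells, the two points are drawn
  independently from \<open>p\<close> and \<open>q\<close> conditioned on them. Being a density with
  respect to the product, the plan is explicit in \<open>p\<close>, \<open>q\<close> and
  \<open>G\<close>, which is what makes it measurable in a parameter. For the matrices used below a
  cell of mass zero gives \<open>0 / 0 = 0\<close>.\<close>

definition lift_plan ::
    "('a \<Rightarrow> nat) \<Rightarrow> (nat \<Rightarrow> nat \<Rightarrow> ennreal) \<Rightarrow> 'a measure \<Rightarrow> 'a measure \<Rightarrow> ('a \<times> 'a) measure" where
  "lift_plan c G p q =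
     density (p \<Otimes>\<^sub>M q) (\<lambda>(x, y). G (c x) (c y) / (cell_mass c p (c x) * cell_mass c q (c y)))"

lemma cell_mass_finite:
  "prob_space p \<Longrightarrow> cell_mass c p a < \<top>"
  by (simp add: cell_mass_def prob_space.emeasure_le_1 le_less_trans less_top[symmetric]
      finite_measure.emeasure_finite prob_space.finite_measure)

text \<open>There are only countably many cells, so those of mass zero form a null set
  together.\<close>

lemma AE_cell_mass_pos:
  assumes [measurable]: "c \<in> p \<rightarrow>\<^sub>M count_space UNIV"
  shows "AE x in p. cell_mass c p (c x) \<noteq> 0"
proof -
  have "\<forall>a. AE x in p. cell_mass c p a = 0 \<longrightarrow> c x \<noteq> a"
  proof
    fix a
    show "AE x in p. cell_mass c p a = 0 \<longrightarrow> c x \<noteq> a"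
    proof (cases "cell_mass c p a = 0")
      case True
      then have "AE x in p. x \<notin> c -` {a} \<inter> space p"
        by (intro AE_not_in) (auto simp: cell_mass_def null_sets_def)
      then show ?thesis by (auto elim!: eventually_mono)
    qed auto
  qed
  then have "AE x in p. \<forall>a. cell_mass c p a = 0 \<longrightarrow> c x \<noteq> a"
    by (simp add: AE_all_countable)
  then show ?thesis by eventually_elim auto
qed

text \<open>Integrating over \<open>y\<close> produces the factor \<open>cell_mass c q b\<close> for
  each cell, which cancels the one in the density. A cell of mass zero cannot cancel it, but there
  \<open>col\<close> forces \<open>G a b = 0\<close>.\<close>

lemma lift_plan_inner:
  assumes p: "prob_space p" and q: "prob_space q"
    and [measurable]: "c \<in> q \<rightarrow>\<^sub>M count_space UNIV"
    and pa: "cell_mass c p a \<noteq> 0"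
    and col: "\<And>b. G a b \<le> cell_mass c q b"
  shows "(\<integral>\<^sup>+y. h (c y) * (G a (c y) / (cell_mass c p a * cell_mass c q (c y))) \<partial>q)
     = (\<integral>\<^sup>+b. h b * G a b \<partial>count_space UNIV) / cell_mass c p a"
proof -
  have *: "h b * (G a b / (cell_mass c p a * cell_mass c q b)) * cell_mass c q b = h b * G a b / cell_mass c p a" for b
  proof (cases "cell_mass c q b = 0")
    case True
    then show ?thesis using col[of b] pa cell_mass_finite[OF p, of c a] by simp
  next
    case False
    then have "G a b * cell_mass c q b / (cell_mass c p a * cell_mass c q b) = G a b / cell_mass c p a"
      using cell_mass_finite[OF q, of c b] by (intro divide_mult_eq) auto
    then show ?thesis
      by (metis ennreal_times_divide mult.assoc mult.commute)
  qed
  show ?thesis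
    by (subst nn_integral_discretized) (auto simp: cell_mass_def[symmetric] * nn_integral_divide)
qed

locale discrete_coupling =
  fixes c :: "'a \<Rightarrow> nat" and p q :: "'a measure" and G :: "nat \<Rightarrow> nat \<Rightarrow> ennreal"
  assumes p: "prob_space p" and q: "prob_space q"
    and c[measurable]: "c \<in> p \<rightarrow>\<^sub>M count_space UNIV" "c \<in> q \<rightarrow>\<^sub>M count_space UNIV"
    and row: "\<And>a. (\<integral>\<^sup>+b. G a b \<partial>count_space UNIV) = cell_mass c p a"
    and col: "\<And>b. (\<integral>\<^sup>+a. G a b \<partial>count_space UNIV) = cell_mass c q b"
begin

sublocale pair_prob_space p q
  using p q by (simp add: pair_prob_space_def pair_sigma_finite_def prob_space_imp_sigma_finite)

lemma le_row: "G a b \<le> cell_mass c p a"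
  unfolding row[symmetric] by (rule nn_integral_ge_point) simp

lemma le_col: "G a b \<le> cell_mass c q b"
  unfolding col[symmetric] by (rule nn_integral_ge_point) simp

lemma sets_lift_plan[measurable_cong]: "sets (lift_plan c G p q) = sets (p \<Otimes>\<^sub>M q)"
  by (simp add: lift_plan_def)

text \<open>The second form exchanges the order of integration and swaps the factors of the
  denominator, so that \<open>lift_plan_inner\<close> applies with \<open>p\<close> and
  \<open>q\<close> interchanged and the second marginal is treated like the first.\<close>

lemma nn_integral_lift_plan:
  assumes [measurable]: "f \<in> borel_measurable (p \<Otimes>\<^sub>M q)"
  shows "(\<integral>\<^sup>+z. f z \<partial>lift_plan c G p q) =
    (\<integral>\<^sup>+x. \<integral>\<^sup>+y. f (x, y) * (G (c x) (c y) / (cell_mass c p (c x) * cell_mass c q (c y))) \<partial>q \<partial>p)"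
    and "(\<integral>\<^sup>+z. f z \<partial>lift_plan c G p q) =
    (\<integral>\<^sup>+y. \<integral>\<^sup>+x. f (x, y) * (G (c x) (c y) / (cell_mass c q (c y) * cell_mass c p (c x))) \<partial>p \<partial>q)"
proof -
  have [measurable]: "(\<lambda>(x, y). G (c x) (c y) / (cell_mass c p (c x) * cell_mass c q (c y))) \<in> borel_measurable (p \<Otimes>\<^sub>M q)"
    by measurable
  have *: "(\<integral>\<^sup>+z. f z \<partial>lift_plan c G p q) =
    (\<integral>\<^sup>+z. f z * (case z of (x, y) \<Rightarrow> G (c x) (c y) / (cell_mass c p (c x) * cell_mass c q (c y))) \<partial>(p \<Otimes>\<^sub>M q))"
    by (simp add: lift_plan_def nn_integral_density split_beta' mult.commute)
  show "(\<integral>\<^sup>+z. f z \<partial>lift_plan c G p q) =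
    (\<integral>\<^sup>+x. \<integral>\<^sup>+y. f (x, y) * (G (c x) (c y) / (cell_mass c p (c x) * cell_mass c q (c y))) \<partial>q \<partial>p)"
    unfolding * by (subst M2.nn_integral_fst[symmetric]) auto
  show "(\<integral>\<^sup>+z. f z \<partial>lift_plan c G p q) =
    (\<integral>\<^sup>+y. \<integral>\<^sup>+x. f (x, y) * (G (c x) (c y) / (cell_mass c q (c y) * cell_mass c p (c x))) \<partial>p \<partial>q)"
    unfolding * by (subst nn_integral_snd[symmetric]) (auto simp: mult.commute)
qed

text \<open>A cost that sees only the cells has the same expectation under the lifted plan as under
  \<open>G\<close>, so near-optimality can be checked on matrices.\<close>

lemma nn_integral_lift_plan_discretized:
  "(\<integral>\<^sup>+(x, y). h (c x) (c y) \<partial>lift_plan c G p q)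
     = (\<integral>\<^sup>+a. \<integral>\<^sup>+b. h a b * G a b \<partial>count_space UNIV \<partial>count_space UNIV)"
proof -
  have "(\<integral>\<^sup>+(x, y). h (c x) (c y) \<partial>lift_plan c G p q)
     = (\<integral>\<^sup>+x. \<integral>\<^sup>+y. h (c x) (c y) * (G (c x) (c y) / (cell_mass c p (c x) * cell_mass c q (c y))) \<partial>q \<partial>p)"
    by (subst nn_integral_lift_plan(1)) (auto simp: split_beta')
  also have "\<dots> = (\<integral>\<^sup>+x. (\<integral>\<^sup>+b. h (c x) b * G (c x) b \<partial>count_space UNIV) / cell_mass c p (c x) \<partial>p)"
    using AE_cell_mass_pos[OF c(1)]
    by (intro nn_integral_cong_AE, eventually_elim) (intro lift_plan_inner p q c le_col; simp)
  also have "\<dots> = (\<integral>\<^sup>+a. (\<integral>\<^sup>+b. h a b * G a b \<partial>count_space UNIV) / cell_mass c p a * cell_mass c p a \<partial>count_space UNIV)"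
    by (subst nn_integral_discretized) (auto simp: cell_mass_def)
  also have "\<dots> = (\<integral>\<^sup>+a. (\<integral>\<^sup>+b. h a b * G a b \<partial>count_space UNIV) \<partial>count_space UNIV)"
  proof (intro nn_integral_cong)
    fix a
    show "(\<integral>\<^sup>+b. h a b * G a b \<partial>count_space UNIV) / cell_mass c p a * cell_mass c p a = (\<integral>\<^sup>+b. h a b * G a b \<partial>count_space UNIV)"
    proof (cases "cell_mass c p a = 0")
      case True
      then have "G a b = 0" for b using le_row[of a b] by simp
      then show ?thesis by simp
    next
      case False
      then show ?thesis using cell_mass_finite[OF p, of c a]
        by (metis divide_mult_eq ennreal_divide_times infinity_ennreal_def less_irrefl mult.right_neutral ennreal_divide_self)
    qed
  qed
  finally show ?thesis .
qed

lemma lift_plan_fst: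
  assumes [measurable]: "u \<in> borel_measurable p"
  shows "(\<integral>\<^sup>+z. u (fst z) \<partial>lift_plan c G p q) = (\<integral>\<^sup>+x. u x \<partial>p)"
proof -
  have "(\<integral>\<^sup>+z. u (fst z) \<partial>lift_plan c G p q) =
    (\<integral>\<^sup>+x. \<integral>\<^sup>+y. u x * (G (c x) (c y) / (cell_mass c p (c x) * cell_mass c q (c y))) \<partial>q \<partial>p)"
    by (subst nn_integral_lift_plan(1)) auto
  also have "\<dots> = (\<integral>\<^sup>+x. u x * \<integral>\<^sup>+y. 1 * (G (c x) (c y) / (cell_mass c p (c x) * cell_mass c q (c y))) \<partial>q \<partial>p)"
    by (intro nn_integral_cong) (simp add: nn_integral_cmult)
  also have "\<dots> = (\<integral>\<^sup>+x. u x \<partial>p)"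
    using AE_cell_mass_pos[OF c(1)]
  proof (intro nn_integral_cong_AE, eventually_elim)
    case (elim x)
    have "(\<integral>\<^sup>+y. 1 * (G (c x) (c y) / (cell_mass c p (c x) * cell_mass c q (c y))) \<partial>q)
      = (\<integral>\<^sup>+b. 1 * G (c x) b \<partial>count_space UNIV) / cell_mass c p (c x)"
      by (intro lift_plan_inner[where h="\<lambda>_. 1"] p q c le_col elim)
    also have "\<dots> = 1" using elim cell_mass_finite[OF p] by (simp add: row)
    finally show ?case by simp
  qed
  finally show ?thesis .
qed

lemma lift_plan_snd:
  assumes [measurable]: "u \<in> borel_measurable q"
  shows "(\<integral>\<^sup>+z. u (snd z) \<partial>lift_plan c G p q) = (\<integral>\<^sup>+x. u x \<partial>q)"
proof -
  have "(\<integral>\<^sup>+z. u (snd z) \<partial>lift_plan c G p q) =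
    (\<integral>\<^sup>+y. \<integral>\<^sup>+x. u y * (G (c x) (c y) / (cell_mass c q (c y) * cell_mass c p (c x))) \<partial>p \<partial>q)"
    by (subst nn_integral_lift_plan(2)) auto
  also have "\<dots> = (\<integral>\<^sup>+y. u y * \<integral>\<^sup>+x. 1 * (G (c x) (c y) / (cell_mass c q (c y) * cell_mass c p (c x))) \<partial>p \<partial>q)"
    by (intro nn_integral_cong) (simp add: nn_integral_cmult)
  also have "\<dots> = (\<integral>\<^sup>+x. u x \<partial>q)"
    using AE_cell_mass_pos[OF c(2)]
  proof (intro nn_integral_cong_AE, eventually_elim)
    case (elim y)
    have "(\<integral>\<^sup>+x. 1 * (G (c x) (c y) / (cell_mass c q (c y) * cell_mass c p (c x))) \<partial>p)
      = (\<integral>\<^sup>+b. 1 * G b (c y) \<partial>count_space UNIV) / cell_mass c q (c y)"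
      by (intro lift_plan_inner[where h="\<lambda>_. 1" and G="\<lambda>a b. G b a"] p q c le_row elim)
    also have "\<dots> = 1" using elim cell_mass_finite[OF q] by (simp add: col)
    finally show ?case by simp
  qed
  finally show ?thesis .
qed

lemma lift_plan_coupling: "lift_plan c G p q \<in> couplings p q"
  by (rule couplingsI[OF sets_lift_plan]) (simp_all add: lift_plan_fst lift_plan_snd)

end

section \<open>Completing a subcoupling of probability vectors\<close>

definition row_sum :: "(nat \<Rightarrow> nat \<Rightarrow> ennreal) \<Rightarrow> nat \<Rightarrow> ennreal" where
  "row_sum m a = (\<integral>\<^sup>+b. m a b \<partial>count_space UNIV)"

definition col_sum :: "(nat \<Rightarrow> nat \<Rightarrow> ennreal) \<Rightarrow> nat \<Rightarrow> ennreal" where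
  "col_sum m b = (\<integral>\<^sup>+a. m a b \<partial>count_space UNIV)"

definition total :: "(nat \<Rightarrow> ennreal) \<Rightarrow> ennreal" where
  "total P = (\<integral>\<^sup>+a. P a \<partial>count_space UNIV)"

definition subcoupling :: "(nat \<Rightarrow> nat \<Rightarrow> ennreal) \<Rightarrow> (nat \<Rightarrow> ennreal) \<Rightarrow> (nat \<Rightarrow> ennreal) \<Rightarrow> bool" where
  "subcoupling m P Q \<longleftrightarrow> (\<forall>a. row_sum m a \<le> P a) \<and> (\<forall>b. col_sum m b \<le> Q b)"

text \<open>The masses left over by the subcoupling \<open>m\<close> are joined independently; if \<open>m\<close> is already a
  coupling, the second summand is \<open>0 / 0 = 0\<close>.\<close>

definition complete_plan ::
    "(nat \<Rightarrow> nat \<Rightarrow> ennreal) \<Rightarrow> (nat \<Rightarrow> ennreal) \<Rightarrow> (nat \<Rightarrow> ennreal) \<Rightarrow> nat \<Rightarrow> nat \<Rightarrow> ennreal" where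
  "complete_plan m P Q a b =
     (if subcoupling m P Q
      then m a b + (P a - row_sum m a) * (Q b - col_sum m b) / (1 - total (row_sum m))
      else P a * Q b)"

lemma total_row_sum_eq_col_sum: "total (row_sum m) = total (col_sum m)"
  using nn_integral_fst_count_space[of "\<lambda>(a,b). m a b"] nn_integral_snd_count_space[of "\<lambda>(a,b). m a b"]
  by (simp add: total_def row_sum_def col_sum_def)

lemma total_mono: "(\<And>a. P a \<le> Q a) \<Longrightarrow> total P \<le> total Q"
  unfolding total_def by (intro nn_integral_mono) auto

lemma total_diff:
  assumes "total P = 1" "\<And>a. r a \<le> P a"
  shows "total (\<lambda>a. P a - r a) = 1 - total r"
proof -
  have "total r \<noteq> \<infinity>" using total_mono[of r P] assms by (auto simp: top_unique)
  then show ?thesis using assms unfolding total_def by (subst nn_integral_diff) auto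
qed

text \<open>Nothing is required of \<open>m\<close>: the selection below runs through all dyadic
  matrices, so each of them must give a coupling, and one that exceeds a marginal is replaced by the
  product. For a subcoupling both leftover vectors have total \<open>1 - total (row_sum m)\<close>,
  and the division normalizes by it.\<close>

lemma row_sum_complete_plan:
  assumes P: "total P = 1" and Q: "total Q = 1"
  shows "row_sum (complete_plan m P Q) a = P a"
proof (cases "subcoupling m P Q")
  case True
  then have r: "row_sum m a \<le> P a" and c: "col_sum m b \<le> Q b" for a b by (auto simp: subcoupling_def)
  let ?t = "1 - total (row_sum m)"
  have fin: "P a \<noteq> \<top>" using nn_integral_ge_point[of a UNIV P] P by (auto simp: total_def top_unique)
  have "row_sum (complete_plan m P Q) a =
      (\<integral>\<^sup>+b. m a b + (P a - row_sum m a) / ?t * (Q b - col_sum m b) \<partial>count_space UNIV)"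
    using True by (simp add: row_sum_def complete_plan_def ennreal_times_divide ennreal_divide_times mult.commute)
  also have "\<dots> = row_sum m a + (P a - row_sum m a) / ?t * total (\<lambda>b. Q b - col_sum m b)"
    by (subst nn_integral_add) (auto simp: nn_integral_cmult row_sum_def total_def)
  also have "total (\<lambda>b. Q b - col_sum m b) = ?t"
    using total_diff[OF Q c] by (simp add: total_row_sum_eq_col_sum)
  also have "(P a - row_sum m a) / ?t * ?t = P a - row_sum m a"
  \<comment> \<open>If no mass is left over, each entry of the leftover vector is zero, so the
    quotient does no harm; otherwise the normalizing factor cancels.\<close>
  proof (cases "?t = 0")
    case True
    with total_diff[OF P r] have "total (\<lambda>a. P a - row_sum m a) = 0" by simp
    then have "P a - row_sum m a = 0"
      using nn_integral_ge_point[of a UNIV "\<lambda>a. P a - row_sum m a"] by (simp add: total_def)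
    then show ?thesis by simp
  next
    case False
    moreover have "?t < \<top>" by (simp add: diff_less_top_ennreal)
    ultimately have "?t / ?t = 1" by (intro ennreal_divide_self)
    then show ?thesis
      by (simp add: ennreal_divide_times)
  qed
  also have "row_sum m a + (P a - row_sum m a) = P a"
    using r[of a] by (simp add: add_diff_self_ennreal)
  finally show ?thesis .
next
  case False
  then show ?thesis using Q by (simp add: complete_plan_def row_sum_def total_def nn_integral_cmult)
qed

text \<open>The normalizing total is the same for rows and columns, so the construction commutes
  with transposition and column sums follow from row sums.\<close>

lemma complete_plan_transpose: "complete_plan m P Q a b = complete_plan (\<lambda>a b. m b a) Q P b a"
proof -
  have "row_sum (\<lambda>a b. m b a) = col_sum m" "col_sum (\<lambda>a b. m b a) = row_sum m"
    by (auto simp: row_sum_def col_sum_def)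
  moreover from this have "subcoupling (\<lambda>a b. m b a) Q P \<longleftrightarrow> subcoupling m P Q"
    by (auto simp: subcoupling_def)
  ultimately show ?thesis
    by (simp add: complete_plan_def total_row_sum_eq_col_sum mult.commute)
qed

lemma col_sum_complete_plan:
  assumes P: "total P = 1" and Q: "total Q = 1"
  shows "col_sum (complete_plan m P Q) b = Q b"
proof -
  have "col_sum (complete_plan m P Q) b = row_sum (complete_plan (\<lambda>a b. m b a) Q P) b"
    unfolding col_sum_def row_sum_def by (intro nn_integral_cong complete_plan_transpose)
  then show ?thesis using row_sum_complete_plan[OF Q P] by simp
qed

lemma nn_integral_swap_count_space:
  "(\<integral>\<^sup>+a. \<integral>\<^sup>+b. f a b \<partial>count_space UNIV \<partial>count_space UNIV)
     = (\<integral>\<^sup>+b. \<integral>\<^sup>+a. f a b \<partial>count_space UNIV \<partial>count_space UNIV)"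
  using nn_integral_fst_count_space[of "\<lambda>(a,b). f a b"] nn_integral_snd_count_space[of "\<lambda>(a,b). f a b"]
  by simp

text \<open>Summing over \<open>b\<close> uses up the normalization, so a cost depending on
  \<open>a\<close> alone is charged to the first leftover vector. For \<open>t = 0\<close> the left
  side is zero, hence an inequality.\<close>

lemma residual_cost:
  assumes r: "\<And>a. r a \<le> P a" and tot: "total (\<lambda>b. Q b - s b) = t" "t < \<top>"
  shows "(\<integral>\<^sup>+a. \<integral>\<^sup>+b. E a * ((P a - r a) * (Q b - s b) / t) \<partial>count_space UNIV \<partial>count_space UNIV)
    \<le> (\<integral>\<^sup>+a. E a * (P a - r a) \<partial>count_space UNIV)"
proof (intro nn_integral_mono)
  fix a
  have "(\<integral>\<^sup>+b. E a * ((P a - r a) * (Q b - s b) / t) \<partial>count_space UNIV)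
     = (\<integral>\<^sup>+b. E a * (P a - r a) / t * (Q b - s b) \<partial>count_space UNIV)"
    by (intro nn_integral_cong) (simp add: ennreal_times_divide ennreal_divide_times mult_ac)
  also have "\<dots> = E a * (P a - r a) / t * t"
    using tot by (simp add: nn_integral_cmult total_def)
  also have "\<dots> \<le> E a * (P a - r a)"
    using tot(2) by (cases "t = 0") (simp_all add: ennreal_divide_times)
  finally show "(\<integral>\<^sup>+b. E a * ((P a - r a) * (Q b - s b) / t) \<partial>count_space UNIV) \<le> E a * (P a - r a)" .
qed

text \<open>Joining leftovers independently may move mass far. The bound by
  \<open>E a + E b\<close>, later distances to a fixed point, splits that cost between the two
  leftover vectors, which are the marginals of \<open>m0 - m\<close>. So the excess over the cost of
  \<open>m0\<close> is controlled by the mass that \<open>m\<close> omits, weighted with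
  \<open>E\<close>.\<close>

lemma complete_plan_cost:
  fixes m m0 :: "nat \<Rightarrow> nat \<Rightarrow> ennreal"
  assumes P: "total P = 1" and Q: "total Q = 1"
    and m0: "\<And>a. row_sum m0 a = P a" "\<And>b. col_sum m0 b = Q b"
    and m: "\<And>a b. m a b \<le> m0 a b"
    and e: "\<And>a b. e a b \<le> E a + E b"
  shows "(\<integral>\<^sup>+a. \<integral>\<^sup>+b. e a b * complete_plan m P Q a b \<partial>count_space UNIV \<partial>count_space UNIV)
    \<le> (\<integral>\<^sup>+a. \<integral>\<^sup>+b. e a b * m0 a b \<partial>count_space UNIV \<partial>count_space UNIV)
      + (\<integral>\<^sup>+a. \<integral>\<^sup>+b. (E a + E b) * (m0 a b - m a b) \<partial>count_space UNIV \<partial>count_space UNIV)"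
proof -
  let ?t = "1 - total (row_sum m)"
  have r: "row_sum m a \<le> P a" for a
    unfolding m0[symmetric] row_sum_def by (intro nn_integral_mono m)
  have c: "col_sum m b \<le> Q b" for b
    unfolding m0[symmetric] col_sum_def by (intro nn_integral_mono m)
  have sub: "subcoupling m P Q" using r c by (simp add: subcoupling_def)
  have t: "?t < \<top>" by (simp add: diff_less_top_ennreal)
  have tQ: "total (\<lambda>b. Q b - col_sum m b) = ?t"
    using total_diff[OF Q c] by (simp add: total_row_sum_eq_col_sum)
  have tP: "total (\<lambda>b. P b - row_sum m b) = ?t"
    using total_diff[OF P r] by simp
  have P_top: "P a \<noteq> \<top>" for a using nn_integral_ge_point[of a UNIV P] P by (auto simp: total_def top_unique)
  have Q_top: "Q a \<noteq> \<top>" for a using nn_integral_ge_point[of a UNIV Q] Q by (auto simp: total_def top_unique)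
  have P_diff: "P a - row_sum m a = (\<integral>\<^sup>+b. m0 a b - m a b \<partial>count_space UNIV)" for a
  proof -
    have "row_sum m a \<noteq> \<infinity>" using r[of a] P_top[of a] by (auto simp: top_unique)
    then show ?thesis unfolding m0(1)[symmetric] row_sum_def
      by (subst nn_integral_diff) (auto simp: m)
  qed
  have Q_diff: "Q b - col_sum m b = (\<integral>\<^sup>+a. m0 a b - m a b \<partial>count_space UNIV)" for b
  proof -
    have "col_sum m b \<noteq> \<infinity>" using c[of b] Q_top[of b] by (auto simp: top_unique)
    then show ?thesis unfolding m0(2)[symmetric] col_sum_def
      by (subst nn_integral_diff) (auto simp: m)
  qed
  have "(\<integral>\<^sup>+a. \<integral>\<^sup>+b. e a b * complete_plan m P Q a b \<partial>count_space UNIV \<partial>count_space UNIV)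
    \<le> (\<integral>\<^sup>+a. \<integral>\<^sup>+b. e a b * m0 a b + (E a * ((P a - row_sum m a) * (Q b - col_sum m b) / ?t)
        + E b * ((Q b - col_sum m b) * (P a - row_sum m a) / ?t)) \<partial>count_space UNIV \<partial>count_space UNIV)"
  proof (intro nn_integral_mono)
    fix a b
    let ?x = "(P a - row_sum m a) * (Q b - col_sum m b) / ?t"
    have "e a b * complete_plan m P Q a b = e a b * m a b + e a b * ?x"
      using sub by (simp add: complete_plan_def distrib_left)
    also have "\<dots> \<le> e a b * m0 a b + (E a + E b) * ?x"
      by (intro add_mono mult_left_mono mult_right_mono m e) auto
    finally show "e a b * complete_plan m P Q a b \<le> e a b * m0 a b + (E a * ?x
        + E b * ((Q b - col_sum m b) * (P a - row_sum m a) / ?t))"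
      by (simp add: distrib_right mult.commute)
  qed
  also have "\<dots> = (\<integral>\<^sup>+a. \<integral>\<^sup>+b. e a b * m0 a b \<partial>count_space UNIV \<partial>count_space UNIV)
      + ((\<integral>\<^sup>+a. \<integral>\<^sup>+b. E a * ((P a - row_sum m a) * (Q b - col_sum m b) / ?t) \<partial>count_space UNIV \<partial>count_space UNIV)
      + (\<integral>\<^sup>+a. \<integral>\<^sup>+b. E b * ((Q b - col_sum m b) * (P a - row_sum m a) / ?t) \<partial>count_space UNIV \<partial>count_space UNIV))"
    by (simp add: nn_integral_add)
  also have "\<dots> \<le> (\<integral>\<^sup>+a. \<integral>\<^sup>+b. e a b * m0 a b \<partial>count_space UNIV \<partial>count_space UNIV)
      + ((\<integral>\<^sup>+a. E a * (P a - row_sum m a) \<partial>count_space UNIV) + (\<integral>\<^sup>+b. E b * (Q b - col_sum m b) \<partial>count_space UNIV))"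
    by (subst (3) nn_integral_swap_count_space, intro add_mono order_refl residual_cost r c tP tQ t)
  also have "(\<integral>\<^sup>+a. E a * (P a - row_sum m a) \<partial>count_space UNIV)
      = (\<integral>\<^sup>+a. \<integral>\<^sup>+b. E a * (m0 a b - m a b) \<partial>count_space UNIV \<partial>count_space UNIV)"
    by (simp add: P_diff nn_integral_cmult)
  also have "(\<integral>\<^sup>+b. E b * (Q b - col_sum m b) \<partial>count_space UNIV)
      = (\<integral>\<^sup>+a. \<integral>\<^sup>+b. E b * (m0 a b - m a b) \<partial>count_space UNIV \<partial>count_space UNIV)"
    by (subst nn_integral_swap_count_space) (simp add: Q_diff nn_integral_cmult)
  also have "(\<integral>\<^sup>+a. \<integral>\<^sup>+b. E a * (m0 a b - m a b) \<partial>count_space UNIV \<partial>count_space UNIV)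
     + (\<integral>\<^sup>+a. \<integral>\<^sup>+b. E b * (m0 a b - m a b) \<partial>count_space UNIV \<partial>count_space UNIV)
     = (\<integral>\<^sup>+a. \<integral>\<^sup>+b. (E a + E b) * (m0 a b - m a b) \<partial>count_space UNIV \<partial>count_space UNIV)"
    by (simp add: nn_integral_add distrib_right)
  finally show ?thesis .
qed

section \<open>Countably many candidate plans\<close>

text \<open>A list of pairs, read with multiplicities, and an exponent form a countable type, so
  \<open>from_nat\<close> enumerates all finitely supported nonnegative matrices with dyadic
  entries.\<close>

definition dyadic_plan :: "(nat \<times> nat) list \<times> nat \<Rightarrow> nat \<Rightarrow> nat \<Rightarrow> ennreal" where
  "dyadic_plan t a b = ennreal (real (count (mset (fst t)) (a, b)) / 2 ^ snd t)"

text \<open>Cut \<open>m0\<close> to an \<open>n\<close> by \<open>n\<close> corner and round its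
  entries down to multiples of \<open>1 / 2 ^ n\<close>. Rounding down keeps the matrix below
  \<open>m0\<close>, hence a subcoupling of its marginals, and dominated convergence with majorant
  \<open>F * m0\<close> sends the weighted defect to zero.\<close>

lemma dyadic_plan_dense:
  fixes m0 F :: "nat \<Rightarrow> nat \<Rightarrow> ennreal"
  assumes fin: "(\<integral>\<^sup>+a. \<integral>\<^sup>+b. F a b * m0 a b \<partial>count_space UNIV \<partial>count_space UNIV) < \<top>"
    and m0: "\<And>a b. m0 a b < \<top>" and F: "\<And>a b. F a b < \<top>" and eps: "0 < \<epsilon>"
  shows "\<exists>t. (\<forall>a b. dyadic_plan t a b \<le> m0 a b) \<and>
    (\<integral>\<^sup>+a. \<integral>\<^sup>+b. F a b * (m0 a b - dyadic_plan t a b) \<partial>count_space UNIV \<partial>count_space UNIV) < \<epsilon>"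
proof -
  define M where "M a b = enn2real (m0 a b)" for a b
  have M: "m0 a b = ennreal (M a b)" "0 \<le> M a b" for a b
    using m0[of a b] by (auto simp: M_def)
  define k where "k n z = (if fst z < n \<and> snd z < n then nat \<lfloor>2 ^ n * M (fst z) (snd z)\<rfloor> else 0)" for n and z :: "nat \<times> nat"
  \<comment> \<open>The corner makes the support finite, so \<open>k n\<close> is the count function
    of a multiset and hence of a list.\<close>
  have "\<exists>l. mset l = Abs_multiset (k n)" for n by (rule ex_mset)
  then obtain l where l: "mset (l n) = Abs_multiset (k n)" for n by metis
  have "finite {z. 0 < k n z}" for n
    by (rule finite_subset[of _ "{..<n} \<times> {..<n}"]) (auto simp: k_def split: if_splits)
  then have cnt: "count (mset (l n)) = k n" for n
    by (simp add: l)
  define m where "m n = dyadic_plan (l n, n)" for n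
  have m_eq: "m n a b = ennreal (real (k n (a,b)) / 2 ^ n)" for n a b
    by (simp add: m_def dyadic_plan_def cnt)
  have k_le: "real (k n (a,b)) / 2 ^ n \<le> M a b" for n a b
  proof -
    have "real (k n (a,b)) \<le> 2 ^ n * M a b"
      using M(2)[of a b] by (auto simp: k_def)
    then show ?thesis by (simp add: field_simps)
  qed
  have lim: "(\<lambda>n. real (k n (a,b)) / 2 ^ n) \<longlonglongrightarrow> M a b" for a b
  proof (rule tendsto_sandwich)
    show "\<forall>\<^sub>F n in sequentially. M a b - 1 / 2 ^ n \<le> real (k n (a,b)) / 2 ^ n"
      using eventually_gt_at_top[of a] eventually_gt_at_top[of b]
    proof eventually_elim
      case (elim n)
      then have "2 ^ n * M a b - 1 \<le> real (k n (a,b))"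
        using M(2)[of a b] by (auto simp: k_def)
      then have "(2 ^ n * M a b - 1) / 2 ^ n \<le> real (k n (a,b)) / 2 ^ n"
        by (intro divide_right_mono) auto
      then show ?case by (simp add: diff_divide_distrib)
    qed
    show "(\<lambda>n. M a b - 1 / 2 ^ n) \<longlonglongrightarrow> M a b" by real_asymp
  qed (auto simp: k_le)
  have m_le: "m n a b \<le> m0 a b" for n a b
    unfolding m_eq M(1) by (intro ennreal_leI k_le)
  have "(\<lambda>n. \<integral>\<^sup>+z. F (fst z) (snd z) * (m0 (fst z) (snd z) - m n (fst z) (snd z)) \<partial>count_space UNIV)
      \<longlonglongrightarrow> (\<integral>\<^sup>+z. 0 \<partial>count_space (UNIV :: (nat \<times> nat) set))"
  proof (rule nn_integral_dominated_convergence)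
    show "integral\<^sup>N (count_space UNIV) (\<lambda>z. F (fst z) (snd z) * m0 (fst z) (snd z)) < \<infinity>"
      using fin nn_integral_fst_count_space[of "\<lambda>z. F (fst z) (snd z) * m0 (fst z) (snd z)"] by simp
    show "AE z in count_space UNIV. (\<lambda>n. F (fst z) (snd z) * (m0 (fst z) (snd z) - m n (fst z) (snd z))) \<longlonglongrightarrow> 0"
    proof (intro always_eventually allI)
      fix z :: "nat \<times> nat"
      obtain a b where z: "z = (a, b)" by (cases z)
      obtain f where f: "F a b = ennreal f" "0 \<le> f" using F[of a b] by (cases "F a b") auto
      have "(\<lambda>n. ennreal (f * (M a b - real (k n (a,b)) / 2 ^ n))) \<longlonglongrightarrow> ennreal (f * (M a b - M a b))"
        by (intro tendsto_ennrealI tendsto_intros lim)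
      moreover have "F a b * (m0 a b - m n a b) = ennreal (f * (M a b - real (k n (a,b)) / 2 ^ n))" for n
        using k_le[of n a b] f by (simp add: m_eq M ennreal_minus ennreal_mult)
      ultimately show "(\<lambda>n. F (fst z) (snd z) * (m0 (fst z) (snd z) - m n (fst z) (snd z))) \<longlonglongrightarrow> 0"
        by (simp add: z)
    qed
    show "AE x in count_space UNIV. F (fst x) (snd x) * (m0 (fst x) (snd x) - m j (fst x) (snd x)) \<le> F (fst x) (snd x) * m0 (fst x) (snd x)" for j
      by (intro AE_I2 mult_left_mono) auto
  qed auto
  then have "\<forall>\<^sub>F n in sequentially. (\<integral>\<^sup>+z. F (fst z) (snd z) * (m0 (fst z) (snd z) - m n (fst z) (snd z)) \<partial>count_space UNIV) < \<epsilon>"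
    using eps by (intro order_tendstoD) auto
  then obtain n where "(\<integral>\<^sup>+z. F (fst z) (snd z) * (m0 (fst z) (snd z) - m n (fst z) (snd z)) \<partial>count_space UNIV) < \<epsilon>"
    by (auto simp: eventually_sequentially)
  with m_le[of n] show ?thesis
    using nn_integral_fst_count_space[of "\<lambda>z. F (fst z) (snd z) * (m0 (fst z) (snd z) - m n (fst z) (snd z))"]
    by (intro exI[of _ "(l n, n)"]) (simp add: m_def)
qed

section \<open>Measurable choice of near-optimal couplings\<close>

text \<open>The cell of \<open>x\<close> is the index of the first point of a dense sequence that is
  closer than \<open>\<delta>\<close>; taking the least index makes the cells disjoint and
  Borel.\<close>

lemma measurable_discretization:
  assumes "0 < \<delta>"
  obtains c :: "'l::polish_space \<Rightarrow> nat" and s :: "nat \<Rightarrow> 'l"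
  where "c \<in> borel \<rightarrow>\<^sub>M count_space UNIV" "\<And>x. dist x (s (c x)) \<le> \<delta>"
proof -
  obtain D :: "'l set" where D: "countable D" "\<And>X. open X \<Longrightarrow> X \<noteq> {} \<Longrightarrow> \<exists>d\<in>D. d \<in> X"
    using countable_dense_setE by blast
  define s where "s = from_nat_into D"
  define c where "c x = (LEAST n. dist x (s n) < \<delta>)" for x
  have ex: "\<exists>n. dist x (s n) < \<delta>" for x
  proof -
    obtain d where "d \<in> D" "d \<in> ball x \<delta>"
      using D(2)[of "ball x \<delta>"] assms by auto
    then show ?thesis unfolding s_def using from_nat_into_surj[OF D(1)] by (metis mem_ball)
  qed
  have "c \<in> borel \<rightarrow>\<^sub>M count_space UNIV" unfolding c_def by measurable
  moreover have "dist x (s (c x)) \<le> \<delta>" for x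
    using LeastI_ex[OF ex[of x]] by (simp add: c_def)
  ultimately show ?thesis by (rule that)
qed

text \<open>The mass of a set is an iterated integral of the density against \<open>q w\<close> and
  \<open>p w\<close>, and each of the two integrations preserves measurability in
  \<open>w\<close>.\<close>

lemma measurable_lift_plan:
  fixes p q :: "'w \<Rightarrow> 'l measure" and B :: "'l measure"
  assumes p[measurable]: "p \<in> X \<rightarrow>\<^sub>M prob_algebra B" and q[measurable]: "q \<in> X \<rightarrow>\<^sub>M prob_algebra B"
    and c[measurable]: "c \<in> B \<rightarrow>\<^sub>M count_space UNIV"
    and G[measurable]: "\<And>a b. (\<lambda>w. G w a b) \<in> borel_measurable X"
    and dc: "\<And>w. w \<in> space X \<Longrightarrow> discrete_coupling c (p w) (q w) (G w)"
  shows "(\<lambda>w. lift_plan c (G w) (p w) (q w)) \<in> X \<rightarrow>\<^sub>M prob_algebra (B \<Otimes>\<^sub>M B)"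
proof (rule measurable_prob_algebraI)
  have sets_pq: "sets (p w) = sets B" "sets (q w) = sets B" if "w \<in> space X" for w
    using measurable_space[OF p that] measurable_space[OF q that] by (auto simp: space_prob_algebra)
  have space_pq: "space (p w) = space B" "space (q w) = space B" if "w \<in> space X" for w
    using sets_pq[OF that] by (auto dest: sets_eq_imp_space_eq)
  show prob: "prob_space (lift_plan c (G w) (p w) (q w))" if "w \<in> space X" for w
    using discrete_coupling.lift_plan_coupling[OF dc[OF that]] discrete_coupling.p[OF dc[OF that]]
    by (rule couplings_prob_space)
  have ps[measurable]: "p \<in> X \<rightarrow>\<^sub>M subprob_algebra B" "q \<in> X \<rightarrow>\<^sub>M subprob_algebra B"
    by (auto intro: measurable_prob_algebraD)
  have [measurable]: "c -` {a} \<inter> space B \<in> sets B" for a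
    using c by (rule measurable_sets) simp
  have mp[measurable]: "(\<lambda>w. cell_mass c (p w) a) \<in> borel_measurable X" for a
    by (subst measurable_cong[where g="\<lambda>w. emeasure (p w) (c -` {a} \<inter> space B)"])
      (auto simp: cell_mass_def space_pq)
  have mq[measurable]: "(\<lambda>w. cell_mass c (q w) a) \<in> borel_measurable X" for a
    by (subst measurable_cong[where g="\<lambda>w. emeasure (q w) (c -` {a} \<inter> space B)"])
      (auto simp: cell_mass_def space_pq)
  \<comment> \<open>For a fixed pair of cells the density depends on \<open>w\<close> alone. As
    there are countably many pairs, joint measurability in \<open>w\<close>, \<open>x\<close> and
    \<open>y\<close> reduces to this.\<close>
  define h where "h ab w = G w (fst ab) (snd ab) / (cell_mass c (p w) (fst ab) * cell_mass c (q w) (snd ab))" for ab w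
  have [measurable]: "h ab \<in> borel_measurable X" for ab
    unfolding h_def by measurable
  have hm[measurable]: "(\<lambda>z. h (c (snd (fst z)), c (snd z)) (fst (fst z))) \<in> borel_measurable ((X \<Otimes>\<^sub>M B) \<Otimes>\<^sub>M B)"
    by (rule measurable_compose_countable[where g="\<lambda>z. (c (snd (fst z)), c (snd z))" and f="\<lambda>ab z. h ab (fst (fst z))"])
      measurable
  show "(\<lambda>w. lift_plan c (G w) (p w) (q w)) \<in> X \<rightarrow>\<^sub>M subprob_algebra (B \<Otimes>\<^sub>M B)"
  proof (rule measurable_subprob_algebra)
    fix A assume A[measurable]: "A \<in> sets (B \<Otimes>\<^sub>M B)"
    have m: "(\<lambda>w. \<integral>\<^sup>+x. \<integral>\<^sup>+y. indicator A (x, y) * h (c x, c y) w \<partial>q w \<partial>p w) \<in> borel_measurable X"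
    proof (rule nn_integral_measurable_subprob_algebra2[OF _ ps(1)])
      have "(\<lambda>z. \<integral>\<^sup>+y. indicator A (snd z, y) * h (c (snd z), c y) (fst z) \<partial>q (fst z)) \<in> borel_measurable (X \<Otimes>\<^sub>M B)"
      proof (rule nn_integral_measurable_subprob_algebra2)
        show "(\<lambda>(z, y). indicator A (snd z, y) * h (c (snd z), c y) (fst z)) \<in> borel_measurable ((X \<Otimes>\<^sub>M B) \<Otimes>\<^sub>M B)"
          using hm unfolding split_beta' by measurable
        show "(\<lambda>z. q (fst z)) \<in> X \<Otimes>\<^sub>M B \<rightarrow>\<^sub>M subprob_algebra B" by measurable
      qed
      then show "(\<lambda>(w, x). \<integral>\<^sup>+y. indicator A (x, y) * h (c x, c y) w \<partial>q w) \<in> borel_measurable (X \<Otimes>\<^sub>M B)"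
        by (simp add: split_beta')
    qed
    show "(\<lambda>w. emeasure (lift_plan c (G w) (p w) (q w)) A) \<in> borel_measurable X"
    proof (rule measurable_cong[THEN iffD1, OF _ m])
      fix w assume w: "w \<in> space X"
      interpret discrete_coupling c "p w" "q w" "G w" by (rule dc[OF w])
      have A': "A \<in> sets (p w \<Otimes>\<^sub>M q w)"
        using A by (simp add: sets_pq[OF w] cong: sets_pair_measure_cong)
      have "emeasure (lift_plan c (G w) (p w) (q w)) A = (\<integral>\<^sup>+z. indicator A z \<partial>lift_plan c (G w) (p w) (q w))"
        using A' by (simp add: sets_lift_plan)
      also have "\<dots> = (\<integral>\<^sup>+x. \<integral>\<^sup>+y. indicator A (x, y) * h (c x, c y) w \<partial>q w \<partial>p w)"
        using A' by (subst nn_integral_lift_plan(1)) (auto simp: h_def)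
      finally show "(\<integral>\<^sup>+x. \<integral>\<^sup>+y. indicator A (x, y) * h (c x, c y) w \<partial>q w \<partial>p w)
        = emeasure (lift_plan c (G w) (p w) (q w)) A" by simp
    qed
  next
    fix w assume w: "w \<in> space X"
    show "subprob_space (lift_plan c (G w) (p w) (q w))"
      using prob[OF w] by (rule prob_space_imp_subprob_space)
    show "sets (lift_plan c (G w) (p w) (q w)) = sets (B \<Otimes>\<^sub>M B)"
      using discrete_coupling.sets_lift_plan[OF dc[OF w]]
      by (simp add: sets_pq[OF w] cong: sets_pair_measure_cong)
  qed
qed

lemma measurable_complete_plan:
  assumes [measurable]: "\<And>a. (\<lambda>w. P w a) \<in> borel_measurable X" "\<And>a. (\<lambda>w. Q w a) \<in> borel_measurable X"
  shows "(\<lambda>w. complete_plan m (P w) (Q w) a b) \<in> borel_measurable X"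
  unfolding complete_plan_def subcoupling_def by measurable

lemma emeasure_cells_sum:
  assumes [measurable]: "c \<in> M \<rightarrow>\<^sub>M count_space (UNIV :: nat set)" "S \<in> sets M"
  shows "(\<integral>\<^sup>+a. emeasure M {x\<in>S. c x = a} \<partial>count_space UNIV) = emeasure M S"
proof -
  have S: "{x\<in>S. c x = a} = (c -` {a} \<inter> space M) \<inter> S" for a
    using sets.sets_into_space[OF assms(2)] by auto
  have meas: "{x\<in>S. c x = a} \<in> sets M" for a
    unfolding S using measurable_sets[OF assms(1), of "{a}"] assms(2) by auto
  have "(\<Sum>a. emeasure M {x\<in>S. c x = a}) = emeasure M (\<Union>a. {x\<in>S. c x = a})"
    using meas by (intro suminf_emeasure) (auto simp: disjoint_family_on_def)
  also have "(\<Union>a. {x\<in>S. c x = a}) = S" by auto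
  finally show ?thesis by (simp add: nn_integral_count_space_nat)
qed

text \<open>The error \<open>5 * \<delta>\<close> consists of \<open>2 * \<delta>\<close> for moving
  the points of a good coupling to the cell centres, \<open>\<delta>\<close> for the mass lost in
  the dyadic approximation, and \<open>2 * \<delta>\<close> for returning from centres to points
  under the lifted plan. The finite first moments make the weight \<open>E\<close> integrable, so
  that the lost mass is cheap.\<close>

lemma near_optimal_dyadic_plan:
  fixes p q :: "'l::polish_space measure"
  assumes pp: "prob_space p" "sets p = sets borel" and qq: "prob_space q" "sets q = sets borel"
    and c[measurable]: "c \<in> borel \<rightarrow>\<^sub>M count_space UNIV" and s: "\<And>x. dist x (s (c x)) \<le> \<delta>"
    and fp: "(\<integral>\<^sup>+x. ennreal (dist o' x) \<partial>p) < \<top>" and fq: "(\<integral>\<^sup>+x. ennreal (dist o' x) \<partial>q) < \<top>"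
    and W: "W1 dist p q < B" and \<delta>: "0 < \<delta>"
  shows "\<exists>t. (\<integral>\<^sup>+(x, y). ennreal (dist x y)
      \<partial>lift_plan c (complete_plan (dyadic_plan t) (cell_mass c p) (cell_mass c q)) p q) < B + ennreal (5 * \<delta>)"
proof -
  let ?P = "cell_mass c p" and ?Q = "cell_mass c q"
  interpret p: prob_space p by fact
  interpret q: prob_space q by fact
  note [measurable_cong] = pp(2) qq(2)
  obtain \<pi> where \<pi>: "\<pi> \<in> couplings p q" and cost: "(\<integral>\<^sup>+(x, y). ennreal (dist x y) \<partial>\<pi>) < B"
    using W unfolding W1_def by (auto simp: INF_less_iff)
  interpret \<pi>: prob_space \<pi> using \<pi> pp(1) by (rule couplings_prob_space)
  have sets_\<pi>[measurable_cong]: "sets \<pi> = sets (borel \<Otimes>\<^sub>M borel)"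
    using \<pi> by (simp add: couplings_def pp(2) qq(2) cong: sets_pair_measure_cong)
  have space_\<pi>: "space \<pi> = UNIV" using sets_eq_imp_space_eq[OF sets_\<pi>] by (simp add: space_pair_measure)
  have space_pq: "space p = UNIV" "space q = UNIV"
    using sets_eq_imp_space_eq[OF pp(2)] sets_eq_imp_space_eq[OF qq(2)] by auto
  have tot: "total ?P = 1" "total ?Q = 1"
    unfolding total_def
    using nn_integral_discretized[of c p "\<lambda>_. 1"] nn_integral_discretized[of c q "\<lambda>_. 1"]
    by (simp_all add: cell_mass_def[abs_def] p.emeasure_space_1 q.emeasure_space_1)
  \<comment> \<open>The discretized law of a coupling whose cost is below \<open>B\<close>; it
    couples the cell masses of \<open>p\<close> and \<open>q\<close> exactly.\<close>
  define m0 where "m0 a b = emeasure \<pi> {z. c (fst z) = a \<and> c (snd z) = b}" for a b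
  have [measurable]: "c -` {a} \<in> sets borel" for a
    using measurable_sets[OF c, of "{a}"] by simp
  have fst_cell: "{z. c (fst z) = a} \<in> sets \<pi>" and snd_cell: "{z. c (snd z) = a} \<in> sets \<pi>" for a
  proof -
    have "{z \<in> space \<pi>. c (fst z) = a} \<in> sets \<pi>" "{z \<in> space \<pi>. c (snd z) = a} \<in> sets \<pi>" by measurable
    then show "{z. c (fst z) = a} \<in> sets \<pi>" "{z. c (snd z) = a} \<in> sets \<pi>" by (simp_all add: space_\<pi>)
  qed
  have "row_sum m0 a = emeasure \<pi> {z. c (fst z) = a}" for a
    unfolding row_sum_def m0_def
    using emeasure_cells_sum[of "\<lambda>z. c (snd z)" \<pi> "{z. c (fst z) = a}"] fst_cell by simp
  moreover have "emeasure \<pi> {z. c (fst z) = a} = ?P a" for a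
    using nn_integral_coupling(1)[OF \<pi>, of "indicator (c -` {a})"] fst_cell[of a]
    by (simp add: cell_mass_def space_pq nn_integral_indicator[symmetric] pp(2) indicator_def[abs_def] del: nn_integral_indicator)
  ultimately have m0_row: "row_sum m0 a = ?P a" for a by simp
  have "col_sum m0 a = emeasure \<pi> {z. c (snd z) = a}" for a
    unfolding col_sum_def m0_def
    using emeasure_cells_sum[of "\<lambda>z. c (fst z)" \<pi> "{z. c (snd z) = a}"] snd_cell by (simp add: conj_commute)
  moreover have "emeasure \<pi> {z. c (snd z) = a} = ?Q a" for a
    using nn_integral_coupling(2)[OF \<pi>, of "indicator (c -` {a})"] snd_cell[of a]
    by (simp add: cell_mass_def space_pq nn_integral_indicator[symmetric] qq(2) indicator_def[abs_def] del: nn_integral_indicator)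
  ultimately have m0_col: "col_sum m0 a = ?Q a" for a by simp
  define e where "e a b = ennreal (dist (s a) (s b))" for a b
  define E where "E a = ennreal (dist o' (s a))" for a
  have e_le: "e a b \<le> E a + E b" for a b
    using ennreal_leI[OF dist_triangle3[of "s a" "s b" o']] by (simp add: e_def E_def)
  \<comment> \<open>Pairs of cells are coded as single numbers, so that the one-variable
    \<open>nn_integral_discretized\<close> applies.\<close>
  have disc: "(\<integral>\<^sup>+z. h (c (fst z)) (c (snd z)) \<partial>\<pi>)
      = (\<integral>\<^sup>+a. \<integral>\<^sup>+b. h a b * m0 a b \<partial>count_space UNIV \<partial>count_space UNIV)" for h
  proof -
    have "(\<integral>\<^sup>+z. h (c (fst z)) (c (snd z)) \<partial>\<pi>) =
       (\<integral>\<^sup>+z. (case from_nat (to_nat (c (fst z), c (snd z))) of (a,b) \<Rightarrow> h a b) \<partial>\<pi>)" by simp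
    also have "\<dots> = (\<integral>\<^sup>+n. (case from_nat n of (a,b) \<Rightarrow> h a b) *
        emeasure \<pi> ((\<lambda>z. to_nat (c (fst z), c (snd z))) -` {n} \<inter> space \<pi>) \<partial>count_space UNIV)"
      by (intro nn_integral_discretized) measurable
    also have "\<dots> = (\<integral>\<^sup>+ab. (case ab of (a,b) \<Rightarrow> h a b * m0 a b) \<partial>count_space UNIV)"
    proof -
      have b: "bij_betw to_nat (UNIV :: (nat \<times> nat) set) (range (to_nat :: nat \<times> nat \<Rightarrow> nat))"
        by (simp add: bij_betw_def)
      let ?g = "\<lambda>n. (case from_nat n of (a,b) \<Rightarrow> h a b) *
        emeasure \<pi> ((\<lambda>z. to_nat (c (fst z), c (snd z))) -` {n} \<inter> space \<pi>)"
      have "(\<integral>\<^sup>+n. ?g n \<partial>count_space UNIV) = (\<integral>\<^sup>+n. ?g n \<partial>count_space (range (to_nat :: nat \<times> nat \<Rightarrow> nat)))"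
      proof (rule nn_integral_count_space_eq)
        fix n assume "n \<in> UNIV - range (to_nat :: nat \<times> nat \<Rightarrow> nat)"
        then have "(\<lambda>z. to_nat (c (fst z), c (snd z))) -` {n} = {}" by auto
        then show "?g n = 0" by simp
      qed simp
      also have "\<dots> = (\<integral>\<^sup>+ab. ?g (to_nat ab) \<partial>count_space (UNIV :: (nat \<times> nat) set))"
        by (rule nn_integral_bij_count_space[OF b, symmetric])
      also have "\<dots> = (\<integral>\<^sup>+ab. (case ab of (a,b) \<Rightarrow> h a b * m0 a b) \<partial>count_space UNIV)"
        by (intro nn_integral_cong) (auto simp: m0_def space_\<pi> vimage_def)
      finally show ?thesis .
    qed
    also have "\<dots> = (\<integral>\<^sup>+a. \<integral>\<^sup>+b. h a b * m0 a b \<partial>count_space UNIV \<partial>count_space UNIV)"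
      using nn_integral_fst_count_space[of "\<lambda>(a,b). h a b * m0 a b"] by simp
    finally show ?thesis .
  qed
  have e_cost: "(\<integral>\<^sup>+a. \<integral>\<^sup>+b. e a b * m0 a b \<partial>count_space UNIV \<partial>count_space UNIV)
      \<le> (\<integral>\<^sup>+(x, y). ennreal (dist x y) \<partial>\<pi>) + ennreal (2 * \<delta>)"
  proof -
    have "(\<integral>\<^sup>+a. \<integral>\<^sup>+b. e a b * m0 a b \<partial>count_space UNIV \<partial>count_space UNIV)
        \<le> (\<integral>\<^sup>+z. ennreal (dist (fst z) (snd z)) + ennreal (2 * \<delta>) \<partial>\<pi>)"
      unfolding disc[symmetric]
    proof (intro nn_integral_mono)
      fix z
      have "dist (s (c (fst z))) (s (c (snd z))) \<le> dist (fst z) (snd z) + 2 * \<delta>"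
        using s[of "fst z"] s[of "snd z"] by metric
      then show "e (c (fst z)) (c (snd z)) \<le> ennreal (dist (fst z) (snd z)) + ennreal (2 * \<delta>)"
        using \<delta> by (simp add: e_def ennreal_plus[symmetric] ennreal_leI del: ennreal_plus)
    qed
    also have "\<dots> = (\<integral>\<^sup>+(x, y). ennreal (dist x y) \<partial>\<pi>) + ennreal (2 * \<delta>)"
      by (subst nn_integral_add) (auto simp: \<pi>.emeasure_space_1 split_beta')
    finally show ?thesis .
  qed
  have E_int: "(\<integral>\<^sup>+x. E (c x) \<partial>r) < \<top>"
    if "prob_space r" "sets r = sets borel" "(\<integral>\<^sup>+x. ennreal (dist o' x) \<partial>r) < \<top>" for r
  proof -
    interpret r: prob_space r by fact
    note [measurable_cong] = that(2)
    have "(\<integral>\<^sup>+x. E (c x) \<partial>r) \<le> (\<integral>\<^sup>+x. ennreal (dist o' x) + ennreal \<delta> \<partial>r)"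
    proof (intro nn_integral_mono)
      fix x
      have "dist o' (s (c x)) \<le> dist o' x + \<delta>" using s[of x] by metric
      then show "E (c x) \<le> ennreal (dist o' x) + ennreal \<delta>"
        using \<delta> by (simp add: E_def ennreal_plus[symmetric] ennreal_leI del: ennreal_plus)
    qed
    also have "\<dots> = (\<integral>\<^sup>+x. ennreal (dist o' x) \<partial>r) + ennreal \<delta>"
      by (subst nn_integral_add) (auto simp: r.emeasure_space_1)
    also have "\<dots> < \<top>" using that(3) by simp
    finally show ?thesis .
  qed
  have E_fin: "(\<integral>\<^sup>+a. \<integral>\<^sup>+b. (E a + E b) * m0 a b \<partial>count_space UNIV \<partial>count_space UNIV) < \<top>"
  proof -
    have "(\<integral>\<^sup>+a. \<integral>\<^sup>+b. (E a + E b) * m0 a b \<partial>count_space UNIV \<partial>count_space UNIV)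
        = (\<integral>\<^sup>+z. E (c (fst z)) + E (c (snd z)) \<partial>\<pi>)" unfolding disc[symmetric] ..
    also have "\<dots> = (\<integral>\<^sup>+z. E (c (fst z)) \<partial>\<pi>) + (\<integral>\<^sup>+z. E (c (snd z)) \<partial>\<pi>)"
      by (intro nn_integral_add) measurable
    also have "\<dots> = (\<integral>\<^sup>+x. E (c x) \<partial>p) + (\<integral>\<^sup>+x. E (c x) \<partial>q)"
      using nn_integral_coupling(1)[OF \<pi>, of "\<lambda>x. E (c x)"] nn_integral_coupling(2)[OF \<pi>, of "\<lambda>x. E (c x)"] by simp
    also have "\<dots> < \<top>"
      using E_int[OF pp fp] E_int[OF qq fq] by simp
    finally show ?thesis .
  qed
  have "m0 a b < \<top>" for a b
    by (simp add: m0_def less_top[symmetric])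
  then obtain t where t: "\<And>a b. dyadic_plan t a b \<le> m0 a b"
    and t_cost: "(\<integral>\<^sup>+a. \<integral>\<^sup>+b. (E a + E b) * (m0 a b - dyadic_plan t a b) \<partial>count_space UNIV \<partial>count_space UNIV) < ennreal \<delta>"
    using dyadic_plan_dense[OF E_fin, of "ennreal \<delta>"] \<delta> by (auto simp: E_def)
  let ?G = "complete_plan (dyadic_plan t) ?P ?Q"
  let ?T = "lift_plan c ?G p q"
  interpret discrete_coupling c p q ?G
    using row_sum_complete_plan[OF tot] col_sum_complete_plan[OF tot] pp qq
    by unfold_locales (auto simp: row_sum_def col_sum_def)
  interpret T: prob_space ?T
    using lift_plan_coupling pp(1) by (rule couplings_prob_space)
  have sets_T[measurable_cong]: "sets ?T = sets (borel \<Otimes>\<^sub>M borel)"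
    by (simp add: sets_lift_plan pp(2) qq(2) cong: sets_pair_measure_cong)
  have "(\<integral>\<^sup>+(x, y). ennreal (dist x y) \<partial>?T) \<le> (\<integral>\<^sup>+z. (case z of (x, y) \<Rightarrow> e (c x) (c y)) + ennreal (2 * \<delta>) \<partial>?T)"
  proof (intro nn_integral_mono)
    fix z :: "'l \<times> 'l"
    obtain x y where z: "z = (x, y)" by (cases z)
    have "dist x y \<le> dist (s (c x)) (s (c y)) + 2 * \<delta>"
      using s[of x] s[of y] by metric
    then show "(case z of (x, y) \<Rightarrow> ennreal (dist x y)) \<le> (case z of (x, y) \<Rightarrow> e (c x) (c y)) + ennreal (2 * \<delta>)"
      using \<delta> by (simp add: z e_def ennreal_plus[symmetric] ennreal_leI del: ennreal_plus)
  qed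
  also have "\<dots> = (\<integral>\<^sup>+(x, y). e (c x) (c y) \<partial>?T) + ennreal (2 * \<delta>)"
    by (subst nn_integral_add) (auto simp: T.emeasure_space_1 split_beta')
  also have "\<dots> \<le> ((\<integral>\<^sup>+(x, y). ennreal (dist x y) \<partial>\<pi>) + ennreal (2 * \<delta>) + ennreal \<delta>) + ennreal (2 * \<delta>)"
    unfolding nn_integral_lift_plan_discretized
    by (intro add_right_mono order_trans[OF complete_plan_cost[OF tot m0_row m0_col t e_le]] add_mono e_cost less_imp_le[OF t_cost])
  also have "\<dots> = (\<integral>\<^sup>+(x, y). ennreal (dist x y) \<partial>\<pi>) + ennreal (5 * \<delta>)"
    using \<delta> by (simp add: add.assoc ennreal_plus[symmetric] del: ennreal_plus)
  also have "\<dots> < B + ennreal (5 * \<delta>)"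
    using cost by (subst (1 2) add.commute, subst ennreal_add_left_cancel_less) auto
  finally show ?thesis by blast
qed

text \<open>Every index gives a coupling at every \<open>w\<close>, so the only condition on the
  chosen index is the cost, an integral against a measurable kernel. Substituting a measurable index
  with countably many values keeps the family measurable.\<close>

theorem measurable_near_optimal_couplings:
  fixes p q :: "'w \<Rightarrow> 'l::polish_space measure" and B :: "'w \<Rightarrow> ennreal"
  assumes p[measurable]: "p \<in> X \<rightarrow>\<^sub>M prob_algebra borel" and q[measurable]: "q \<in> X \<rightarrow>\<^sub>M prob_algebra borel"
    and B[measurable]: "B \<in> borel_measurable X"
    and W: "\<And>w. w \<in> space X \<Longrightarrow> W1 dist (p w) (q w) \<le> B w" "\<And>w. w \<in> space X \<Longrightarrow> B w < \<top>"
    and fp: "\<And>w. w \<in> space X \<Longrightarrow> (\<integral>\<^sup>+x. ennreal (dist o' x) \<partial>p w) < \<top>"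
    and fq: "\<And>w. w \<in> space X \<Longrightarrow> (\<integral>\<^sup>+x. ennreal (dist o' x) \<partial>q w) < \<top>"
    and \<epsilon>: "0 < \<epsilon>"
  obtains T where "T \<in> X \<rightarrow>\<^sub>M prob_algebra (borel \<Otimes>\<^sub>M borel)"
    "\<And>w. w \<in> space X \<Longrightarrow> T w \<in> couplings (p w) (q w)"
    "\<And>w. w \<in> space X \<Longrightarrow> (\<integral>\<^sup>+(x, y). ennreal (dist x y) \<partial>T w) \<le> B w + ennreal \<epsilon>"
proof -
  \<comment> \<open>Five parts are consumed by \<open>near_optimal_dyadic_plan\<close>. The sixth
    makes \<open>W1 dist (p w) (q w)\<close> strictly smaller than the bound handed to it, which
    supplies a coupling even if the infimum is not attained.\<close>
  define \<delta> where "\<delta> = \<epsilon> / 6"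
  have \<delta>: "0 < \<delta>" using \<epsilon> by (simp add: \<delta>_def)
  obtain c :: "'l \<Rightarrow> nat" and s where c[measurable]: "c \<in> borel \<rightarrow>\<^sub>M count_space UNIV" and s: "\<And>x. dist x (s (c x)) \<le> \<delta>"
    using measurable_discretization[OF \<delta>] by blast
  have pw: "prob_space (p w)" "sets (p w) = sets borel" and qw: "prob_space (q w)" "sets (q w) = sets borel"
    if "w \<in> space X" for w
    using measurable_space[OF p that] measurable_space[OF q that] by (auto simp: space_prob_algebra)
  define G where "G n w = complete_plan (dyadic_plan (from_nat n)) (cell_mass c (p w)) (cell_mass c (q w))" for n w
  define T where "T n w = lift_plan c (G n w) (p w) (q w)" for n w
  have tot: "total (cell_mass c r) = 1" if r: "prob_space r" "sets r = sets borel" for r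
  proof -
    have [measurable]: "c \<in> r \<rightarrow>\<^sub>M count_space UNIV"
      using c unfolding measurable_cong_sets[OF r(2) refl] .
    show ?thesis
      unfolding total_def using nn_integral_discretized[of c r "\<lambda>_. 1"]
      by (simp add: cell_mass_def[abs_def] prob_space.emeasure_space_1[OF r(1)])
  qed
  have dc: "discrete_coupling c (p w) (q w) (G n w)" if w: "w \<in> space X" for n w
  proof (rule discrete_coupling.intro)
    show "prob_space (p w)" "prob_space (q w)"
      using pw(1)[OF w] qw(1)[OF w] .
    show "c \<in> p w \<rightarrow>\<^sub>M count_space UNIV" "c \<in> q w \<rightarrow>\<^sub>M count_space UNIV"
      using c by (simp_all only: measurable_cong_sets[OF pw(2)[OF w] refl] measurable_cong_sets[OF qw(2)[OF w] refl])
    show "(\<integral>\<^sup>+b. G n w a b \<partial>count_space UNIV) = cell_mass c (p w) a" for a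
      using row_sum_complete_plan[OF tot[OF pw[OF w]] tot[OF qw[OF w]]] by (simp add: G_def row_sum_def)
    show "(\<integral>\<^sup>+a. G n w a b \<partial>count_space UNIV) = cell_mass c (q w) b" for b
      using col_sum_complete_plan[OF tot[OF pw[OF w]] tot[OF qw[OF w]]] by (simp add: G_def col_sum_def)
  qed
  have cell: "(\<lambda>w. cell_mass c (r w) a) \<in> borel_measurable X" if r[measurable]: "r \<in> X \<rightarrow>\<^sub>M prob_algebra borel" for r a
  proof -
    have [measurable]: "c -` {a} \<in> sets borel" using measurable_sets[OF c, of "{a}"] by simp
    have [measurable]: "r \<in> X \<rightarrow>\<^sub>M subprob_algebra borel" by (rule measurable_prob_algebraD) measurable
    have "space (r w) = UNIV" if "w \<in> space X" for w
      using measurable_space[OF r that] by (auto simp: space_prob_algebra dest: sets_eq_imp_space_eq)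
    then show ?thesis
      by (subst measurable_cong[where g="\<lambda>w. emeasure (r w) (c -` {a})"]) (auto simp: cell_mass_def)
  qed
  have T_meas[measurable]: "T n \<in> X \<rightarrow>\<^sub>M prob_algebra (borel \<Otimes>\<^sub>M borel)" for n
    unfolding T_def
  proof (rule measurable_lift_plan[OF p q c])
    show "(\<lambda>w. G n w a b) \<in> borel_measurable X" for a b
      unfolding G_def by (intro measurable_complete_plan cell p q)
  qed (rule dc)
  define ok where "ok n w \<longleftrightarrow> (\<integral>\<^sup>+(x, y). ennreal (dist x y) \<partial>T n w) \<le> B w + ennreal \<epsilon>" for n w
  have T_sub[measurable]: "T n \<in> X \<rightarrow>\<^sub>M subprob_algebra (borel \<Otimes>\<^sub>M borel)" for n
    by (rule measurable_prob_algebraD) measurable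
  have [measurable]: "(\<lambda>(x, y). ennreal (dist x y)) \<in> borel_measurable (borel \<Otimes>\<^sub>M (borel :: 'l measure))"
    by measurable
  have [measurable]: "Measurable.pred X (ok n)" for n
    unfolding ok_def by measurable
  define N where "N w = (LEAST n. ok n w)" for w
  have [measurable]: "N \<in> X \<rightarrow>\<^sub>M count_space UNIV" unfolding N_def by measurable
  have ok_N: "ok (N w) w" if w: "w \<in> space X" for w
  proof -
    have "W1 dist (p w) (q w) < B w + ennreal \<delta>"
    proof -
      have "B w + 0 < B w + ennreal \<delta>"
        using W(2)[OF w] \<delta> by (subst ennreal_add_left_cancel_less) auto
      then have "B w < B w + ennreal \<delta>" by simp
      with W(1)[OF w] show ?thesis by (rule le_less_trans)
    qed
    from near_optimal_dyadic_plan[OF pw[OF w] qw[OF w] c s fp[OF w] fq[OF w] this \<delta>]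
    obtain t where t: "(\<integral>\<^sup>+(x, y). ennreal (dist x y)
      \<partial>lift_plan c (complete_plan (dyadic_plan t) (cell_mass c (p w)) (cell_mass c (q w))) (p w) (q w)) < B w + ennreal \<delta> + ennreal (5 * \<delta>)"
      by blast
    have "B w + ennreal \<delta> + ennreal (5 * \<delta>) = B w + ennreal \<epsilon>"
      using \<delta> by (simp add: add.assoc ennreal_plus[symmetric] \<delta>_def del: ennreal_plus)
    with t have "ok (to_nat t) w" by (simp add: ok_def T_def G_def less_imp_le)
    then show ?thesis unfolding N_def by (rule LeastI)
  qed
  show ?thesis
  proof (rule that[of "\<lambda>w. T (N w) w"])
    show "(\<lambda>w. T (N w) w) \<in> X \<rightarrow>\<^sub>M prob_algebra (borel \<Otimes>\<^sub>M borel)"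
      by (rule measurable_compose_countable[OF T_meas]) measurable
    show "T (N w) w \<in> couplings (p w) (q w)" if "w \<in> space X" for w
      unfolding T_def by (rule discrete_coupling.lift_plan_coupling[OF dc[OF that]])
    show "(\<integral>\<^sup>+(x, y). ennreal (dist x y) \<partial>T (N w) w) \<le> B w + ennreal \<epsilon>" if "w \<in> space X" for w
      using ok_N[OF that] by (simp add: ok_def)
  qed
qed

section \<open>Spectral gap of a stationary kernel\<close>

lemma L2_iff:
  "f \<in> L2 M \<longleftrightarrow> f \<in> borel_measurable M \<and> (\<integral>\<^sup>+x. ennreal ((cmod (f x))\<^sup>2) \<partial>M) < \<infinity>"
  by (auto simp: L2_def integrable_iff_bounded)

lemma L2_norm_nonneg[simp]: "0 \<le> L2_norm M f"
  by (simp add: L2_norm_def)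

lemma L2_norm_cong_AE:
  assumes "f \<in> borel_measurable M" "g \<in> borel_measurable M" "AE x in M. f x = g x"
  shows "L2_norm M f = L2_norm M g"
  unfolding L2_norm_def
  by (intro arg_cong[where f=sqrt] integral_cong_AE) (use assms in auto)

lemma nn_integral_L2_norm:
  assumes "f \<in> L2 M"
  shows "(\<integral>\<^sup>+x. ennreal ((cmod (f x))\<^sup>2) \<partial>M) = ennreal ((L2_norm M f)\<^sup>2)"
  using assms by (subst nn_integral_eq_integral) (auto simp: L2_def L2_norm_def)

text \<open>Membership and norm bound come from a single estimate in \<open>ennreal\<close>, where
  no integrability has to be known beforehand.\<close>

lemma L2_bounded_by:
  assumes "f \<in> borel_measurable M" "0 \<le> C" "(\<integral>\<^sup>+x. ennreal ((cmod (f x))\<^sup>2) \<partial>M) \<le> ennreal (C\<^sup>2)"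
  shows "f \<in> L2 M" "L2_norm M f \<le> C"
proof -
  show f: "f \<in> L2 M"
    unfolding L2_iff using assms le_less_trans[OF assms(3) ennreal_less_top] by simp
  have "(L2_norm M f)\<^sup>2 \<le> C\<^sup>2"
    using assms(3) nn_integral_L2_norm[OF f] by simp
  then show "L2_norm M f \<le> C" using assms(2) by (rule power2_le_imp_le)
qed

lemma L2_norm_eq_0:
  assumes "f \<in> L2 M" "L2_norm M f = 0"
  shows "AE x in M. f x = 0"
proof -
  have "f \<in> borel_measurable M" using assms(1) by (simp add: L2_iff)
  then have "AE x in M. ennreal ((cmod (f x))\<^sup>2) = 0"
    using nn_integral_L2_norm[OF assms(1)] assms(2)
    by (subst nn_integral_0_iff_AE[symmetric]) auto
  then show ?thesis by eventually_elim simp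
qed

lemma nn_integral_mult_le_L2_norm:
  assumes f: "f \<in> L2 M" and g: "g \<in> L2 M"
  shows "(\<integral>\<^sup>+x. ennreal (cmod (f x) * cmod (g x)) \<partial>M) \<le> ennreal (L2_norm M f * L2_norm M g)"
proof -
  have [measurable]: "f \<in> borel_measurable M" "g \<in> borel_measurable M"
    using f g by (auto simp: L2_iff)
  let ?X = "\<integral>\<^sup>+x. ennreal (cmod (f x) * cmod (g x)) \<partial>M"
  have "?X\<^sup>2 = (\<integral>\<^sup>+x. ennreal (cmod (f x)) * ennreal (cmod (g x)) \<partial>M)\<^sup>2"
    by (simp add: ennreal_mult)
  also have "\<dots> \<le> (\<integral>\<^sup>+x. (ennreal (cmod (f x)))\<^sup>2 \<partial>M) * (\<integral>\<^sup>+x. (ennreal (cmod (g x)))\<^sup>2 \<partial>M)"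
    by (rule Cauchy_Schwarz_nn_integral) auto
  also have "\<dots> = ennreal ((L2_norm M f * L2_norm M g)\<^sup>2)"
    by (simp add: ennreal_power nn_integral_L2_norm[OF f] nn_integral_L2_norm[OF g] ennreal_mult power_mult_distrib)
  finally have le: "?X\<^sup>2 \<le> ennreal ((L2_norm M f * L2_norm M g)\<^sup>2)" .
  show ?thesis
  proof (cases ?X)
    case (real r)
    then have "r\<^sup>2 \<le> (L2_norm M f * L2_norm M g)\<^sup>2" using le by (simp add: ennreal_power)
    then have "r \<le> L2_norm M f * L2_norm M g" by (rule power2_le_imp_le) simp
    then show ?thesis using real by (simp add: ennreal_leI)
  next
    case top
    then show ?thesis using le by (simp add: top_unique power2_eq_square)
  qed
qed

lemma L2_add:
  assumes f: "f \<in> L2 M" and g: "g \<in> L2 M"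
  shows "(\<lambda>x. f x + g x) \<in> L2 M" "L2_norm M (\<lambda>x. f x + g x) \<le> L2_norm M f + L2_norm M g"
proof -
  have [measurable]: "f \<in> borel_measurable M" "g \<in> borel_measurable M"
    using f g by (auto simp: L2_iff)
  have "(\<integral>\<^sup>+x. ennreal ((cmod (f x + g x))\<^sup>2) \<partial>M)
      \<le> (\<integral>\<^sup>+x. ennreal ((cmod (f x))\<^sup>2) + 2 * ennreal (cmod (f x) * cmod (g x)) + ennreal ((cmod (g x))\<^sup>2) \<partial>M)"
  proof (intro nn_integral_mono)
    fix x
    have "(cmod (f x + g x))\<^sup>2 \<le> (cmod (f x) + cmod (g x))\<^sup>2"
      by (intro power_mono norm_triangle_ineq) auto
    also have "\<dots> = (cmod (f x))\<^sup>2 + 2 * (cmod (f x) * cmod (g x)) + (cmod (g x))\<^sup>2"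
      by (simp add: power2_sum)
    finally have "ennreal ((cmod (f x + g x))\<^sup>2) \<le> ennreal ((cmod (f x))\<^sup>2 + 2 * (cmod (f x) * cmod (g x)) + (cmod (g x))\<^sup>2)"
      by (rule ennreal_leI)
    then show "ennreal ((cmod (f x + g x))\<^sup>2) \<le> ennreal ((cmod (f x))\<^sup>2) + 2 * ennreal (cmod (f x) * cmod (g x)) + ennreal ((cmod (g x))\<^sup>2)"
      by (simp add: ennreal_mult)
  qed
  also have "\<dots> = ennreal ((L2_norm M f)\<^sup>2) + 2 * (\<integral>\<^sup>+x. ennreal (cmod (f x) * cmod (g x)) \<partial>M) + ennreal ((L2_norm M g)\<^sup>2)"
    by (simp add: nn_integral_add nn_integral_cmult nn_integral_L2_norm[OF f] nn_integral_L2_norm[OF g])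
  also have "\<dots> \<le> ennreal ((L2_norm M f)\<^sup>2) + 2 * ennreal (L2_norm M f * L2_norm M g) + ennreal ((L2_norm M g)\<^sup>2)"
    by (intro add_mono mult_left_mono nn_integral_mult_le_L2_norm f g) auto
  also have "\<dots> = ennreal ((L2_norm M f + L2_norm M g)\<^sup>2)"
    by (simp add: power2_sum ennreal_mult mult.assoc)
  finally have *: "(\<integral>\<^sup>+x. ennreal ((cmod (f x + g x))\<^sup>2) \<partial>M) \<le> ennreal ((L2_norm M f + L2_norm M g)\<^sup>2)" .
  show "(\<lambda>x. f x + g x) \<in> L2 M" "L2_norm M (\<lambda>x. f x + g x) \<le> L2_norm M f + L2_norm M g"
    by (rule L2_bounded_by[OF _ _ *]; simp)+
qed

lemma L2_cmult:
  assumes "f \<in> L2 M"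
  shows "(\<lambda>x. c * f x) \<in> L2 M" "L2_norm M (\<lambda>x. c * f x) = cmod c * L2_norm M f"
proof -
  show "(\<lambda>x. c * f x) \<in> L2 M"
    using assms by (auto simp: L2_def norm_mult power_mult_distrib)
  show "L2_norm M (\<lambda>x. c * f x) = cmod c * L2_norm M f"
    by (simp add: L2_norm_def norm_mult power_mult_distrib real_sqrt_mult)
qed

lemma L2_diff:
  assumes f: "f \<in> L2 M" and g: "g \<in> L2 M"
  shows "(\<lambda>x. f x - g x) \<in> L2 M" "L2_norm M (\<lambda>x. f x - g x) \<le> L2_norm M f + L2_norm M g"
  using L2_add[OF f L2_cmult(1)[OF g, of "-1"]] L2_cmult(2)[OF g, of "-1"] by simp_all

lemma L2_sum:
  assumes "\<And>i. i < (n::nat) \<Longrightarrow> f i \<in> L2 M"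
  shows "(\<lambda>x. \<Sum>i<n. f i x) \<in> L2 M \<and> L2_norm M (\<lambda>x. \<Sum>i<n. f i x) \<le> (\<Sum>i<n. L2_norm M (f i))"
  using assms
proof (induction n)
  case 0
  show ?case by (simp add: L2_def L2_norm_def)
next
  case (Suc n)
  then have IH: "(\<lambda>x. \<Sum>i<n. f i x) \<in> L2 M" "L2_norm M (\<lambda>x. \<Sum>i<n. f i x) \<le> (\<Sum>i<n. L2_norm M (f i))"
    by auto
  from L2_add[OF IH(1) Suc.prems[of n]] IH(2) show ?case by simp
qed

context prob_space
begin

lemma L2_const[simp]: "(\<lambda>_. c) \<in> L2 M" "L2_norm M (\<lambda>_. c) = cmod c"
  by (auto simp: L2_def L2_norm_def prob_space)

lemma nn_integral_le_L2_norm: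
  "f \<in> L2 M \<Longrightarrow> (\<integral>\<^sup>+x. ennreal (cmod (f x)) \<partial>M) \<le> ennreal (L2_norm M f)"
  using nn_integral_mult_le_L2_norm[of f M "\<lambda>_. 1"] by simp

lemma L2_integrable: "f \<in> L2 M \<Longrightarrow> integrable M f"
  using le_less_trans[OF nn_integral_le_L2_norm ennreal_less_top]
  by (auto simp: integrable_iff_bounded L2_iff)

lemma norm_integral_le_L2_norm:
  assumes "f \<in> L2 M" shows "cmod (\<integral>x. f x \<partial>M) \<le> L2_norm M f"
proof -
  have "ennreal (cmod (\<integral>x. f x \<partial>M)) \<le> ennreal (L2_norm M f)"
    using integral_norm_bound_ennreal[OF L2_integrable[OF assms]] nn_integral_le_L2_norm[OF assms]
    by (rule order_trans)
  then show ?thesis by (subst (asm) ennreal_le_iff) auto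
qed

text \<open>The factor 2 is the plain triangle inequality; it enters the norm of the resolvent but
  not the radius of the disc outside which the resolvent exists.\<close>

lemma L2_norm_centered:
  assumes "f \<in> L2 M" shows "L2_norm M (\<lambda>x. f x - (\<integral>y. f y \<partial>M)) \<le> 2 * L2_norm M f"
  using L2_diff(2)[OF assms L2_const(1)[of "\<integral>y. f y \<partial>M"]] norm_integral_le_L2_norm[OF assms] by simp

end

section \<open>Stationary kernels acting on L2\<close>

locale stationary_kernel = prob_space M for M :: "'a measure" +
  fixes P :: "'a \<Rightarrow> 'a measure"
  assumes kernel: "P \<in> M \<rightarrow>\<^sub>M prob_algebra M"
    and stationary: "M \<bind> P = M"
begin

lemma subprob_kernel[measurable]: "P \<in> M \<rightarrow>\<^sub>M subprob_algebra M"
  using kernel by (rule measurable_prob_algebraD)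

lemma prob_space_kernel: "x \<in> space M \<Longrightarrow> prob_space (P x)"
  using measurable_space[OF kernel] by (auto simp: space_prob_algebra)

lemma sets_kernel: "x \<in> space M \<Longrightarrow> sets (P x) = sets M"
  using measurable_space[OF kernel] by (auto simp: space_prob_algebra)

lemma measurable_kernel_integral[measurable]:
  fixes f :: "'a \<Rightarrow> 'b::{banach, second_countable_topology}"
  assumes [measurable]: "f \<in> borel_measurable M"
  shows "(\<lambda>x. \<integral>y. f y \<partial>P x) \<in> borel_measurable M"
  by measurable

lemma measurable_on_kernel:
  "f \<in> borel_measurable M \<Longrightarrow> x \<in> space M \<Longrightarrow> f \<in> borel_measurable (P x)"
  by (simp add: measurable_cong_sets[OF sets_kernel refl])

lemma nn_integral_stationary:
  assumes [measurable]: "f \<in> borel_measurable M"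
  shows "(\<integral>\<^sup>+x. \<integral>\<^sup>+y. f y \<partial>P x \<partial>M) = (\<integral>\<^sup>+x. f x \<partial>M)"
  using nn_integral_bind[of f M P M] by (simp add: stationary)

text \<open>By stationarity the masses that the measures \<open>P x\<close> give to a null set
  integrate to its mass under \<open>M\<close>, which is zero, so almost all of them vanish. This
  allows almost sure statements under the inner integral.\<close>

lemma AE_kernel:
  assumes "AE x in M. Q x"
  shows "AE x in M. AE y in P x. Q y"
proof -
  obtain N where N: "{x \<in> space M. \<not> Q x} \<subseteq> N" "N \<in> null_sets M"
    using assms by (auto elim!: AE_E simp: null_sets_def)
  then have [measurable]: "N \<in> sets M" by auto
  have "(\<integral>\<^sup>+x. \<integral>\<^sup>+y. indicator N y \<partial>P x \<partial>M) = 0"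
    using N by (subst nn_integral_stationary) auto
  then have "AE x in M. (\<integral>\<^sup>+y. indicator N y \<partial>P x) = 0"
    by (subst (asm) nn_integral_0_iff_AE) auto
  moreover have "AE x in M. x \<in> space M" by (rule AE_space)
  ultimately show ?thesis
  proof eventually_elim
    case (elim x)
    have sp: "space (P x) = space M" using sets_kernel[OF elim(2)] by (rule sets_eq_imp_space_eq)
    have "N \<in> null_sets (P x)" using elim sets_kernel[OF elim(2)] by (auto simp: null_sets_def)
    then show ?case using N(1) by (intro AE_I'[of N]) (auto simp: sp)
  qed
qed

lemma AE_kernel_finite:
  assumes [measurable]: "f \<in> borel_measurable M" and "(\<integral>\<^sup>+x. f x \<partial>M) < \<infinity>"
  shows "AE x in M. (\<integral>\<^sup>+y. f y \<partial>P x) < \<infinity>"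
proof -
  have "AE x in M. (\<integral>\<^sup>+y. f y \<partial>P x) \<noteq> \<infinity>"
    using assms by (intro nn_integral_noteq_infinite) (auto simp: nn_integral_stationary)
  then show ?thesis by eventually_elim (simp add: less_top)
qed

lemma AE_kernel_integrable:
  fixes f :: "'a \<Rightarrow> 'b::{banach, second_countable_topology}"
  assumes f: "integrable M f"
  shows "AE x in M. integrable (P x) f"
proof -
  have "AE x in M. (\<integral>\<^sup>+y. ennreal (norm (f y)) \<partial>P x) < \<infinity>"
    using f by (intro AE_kernel_finite) (auto simp: integrable_iff_bounded)
  with AE_space show ?thesis
    by eventually_elim (use f in \<open>auto simp: integrable_iff_bounded intro: measurable_on_kernel\<close>)
qed

text \<open>The function \<open>f\<close> is integrable under \<open>P x\<close> only for almost
  every \<open>x\<close>, so the identity is proved for nonnegative functions through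
  \<open>ennreal\<close> and extended by positive and negative parts.\<close>

lemma integral_stationary_real:
  fixes f :: "'a \<Rightarrow> real"
  assumes f: "integrable M f"
  shows "(\<integral>x. \<integral>y. f y \<partial>P x \<partial>M) = (\<integral>x. f x \<partial>M)" "integrable M (\<lambda>x. \<integral>y. f y \<partial>P x)"
proof -
  have [measurable]: "f \<in> borel_measurable M" using f by auto
  have pos: "integrable M (\<lambda>x. \<integral>y. g y \<partial>P x) \<and> (\<integral>x. \<integral>y. g y \<partial>P x \<partial>M) = (\<integral>x. g x \<partial>M)"
    if g: "integrable M g" "\<And>x. 0 \<le> g x" for g :: "'a \<Rightarrow> real"
  proof -
    have [measurable]: "g \<in> borel_measurable M" using g by auto
    have "(\<integral>\<^sup>+x. ennreal (\<integral>y. g y \<partial>P x) \<partial>M) = (\<integral>\<^sup>+x. \<integral>\<^sup>+y. ennreal (g y) \<partial>P x \<partial>M)"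
      using AE_kernel_integrable[OF g(1)]
      by (intro nn_integral_cong_AE, eventually_elim) (subst nn_integral_eq_integral, auto simp: g(2))
    also have "\<dots> = ennreal (\<integral>x. g x \<partial>M)"
      using g by (subst nn_integral_stationary) (auto intro!: nn_integral_eq_integral)
    finally have *: "(\<integral>\<^sup>+x. ennreal (\<integral>y. g y \<partial>P x) \<partial>M) = ennreal (\<integral>x. g x \<partial>M)" .
    have nn: "0 \<le> (\<integral>y. g y \<partial>P x)" for x using g(2) by (intro integral_nonneg_AE) auto
    have i: "integrable M (\<lambda>x. \<integral>y. g y \<partial>P x)"
      using * nn by (intro integrableI_bounded) auto
    moreover have "(\<integral>x. \<integral>y. g y \<partial>P x \<partial>M) = (\<integral>x. g x \<partial>M)"
      using * nn g(2) by (subst (asm) nn_integral_eq_integral[OF i]) (auto intro!: integral_nonneg_AE)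
    ultimately show ?thesis by simp
  qed
  let ?p = "\<lambda>x. max 0 (f x)" and ?n = "\<lambda>x. max 0 (- f x)"
  have p: "integrable M ?p" and n: "integrable M ?n" using f by auto
  have split: "AE x in M. (\<integral>y. f y \<partial>P x) = (\<integral>y. ?p y \<partial>P x) - (\<integral>y. ?n y \<partial>P x)"
    using AE_kernel_integrable[OF p] AE_kernel_integrable[OF n]
  proof eventually_elim
    case (elim x)
    have "(\<integral>y. f y \<partial>P x) = (\<integral>y. ?p y - ?n y \<partial>P x)" by (intro Bochner_Integration.integral_cong) auto
    then show ?case using elim by simp
  qed
  have i: "integrable M (\<lambda>x. (\<integral>y. ?p y \<partial>P x) - (\<integral>y. ?n y \<partial>P x))"
    using pos[OF p] pos[OF n] by auto
  show "integrable M (\<lambda>x. \<integral>y. f y \<partial>P x)"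
    using split by (intro Bochner_Integration.integrable_cong_AE[THEN iffD1, OF _ _ _ i]) auto
  have "(\<integral>x. \<integral>y. f y \<partial>P x \<partial>M) = (\<integral>x. (\<integral>y. ?p y \<partial>P x) - (\<integral>y. ?n y \<partial>P x) \<partial>M)"
    using split by (intro integral_cong_AE) auto
  also have "\<dots> = (\<integral>x. ?p x \<partial>M) - (\<integral>x. ?n x \<partial>M)"
    using pos[OF p] pos[OF n] by simp
  also have "\<dots> = (\<integral>x. ?p x - ?n x \<partial>M)" using p n by simp
  also have "\<dots> = (\<integral>x. f x \<partial>M)" by (intro Bochner_Integration.integral_cong) auto
  finally show "(\<integral>x. \<integral>y. f y \<partial>P x \<partial>M) = (\<integral>x. f x \<partial>M)" .
qed

abbreviation T where "T \<equiv> markov_operator P"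

lemma measurable_T[measurable]: "f \<in> borel_measurable M \<Longrightarrow> T f \<in> borel_measurable M"
  unfolding markov_operator_def by measurable

text \<open>Real parts pass through the kernel integral only where \<open>f\<close> is integrable
  under \<open>P x\<close>; elsewhere the Bochner integral is zero by convention, whatever
  \<open>Re\<close> of \<open>f\<close> does. So the componentwise identities are almost sure
  ones.\<close>

lemma integral_T:
  assumes f: "integrable M f"
  shows "(\<integral>x. T f x \<partial>M) = (\<integral>x. f x \<partial>M)"
proof -
  have re: "AE x in M. Re (T f x) = (\<integral>y. Re (f y) \<partial>P x)" and im: "AE x in M. Im (T f x) = (\<integral>y. Im (f y) \<partial>P x)"
    using AE_kernel_integrable[OF f] by (eventually_elim, simp add: markov_operator_def)+
  have [measurable]: "f \<in> borel_measurable M" using f by auto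
  have Re_i: "integrable M (\<lambda>x. Re (T f x))" and Im_i: "integrable M (\<lambda>x. Im (T f x))"
    using integral_stationary_real(2)[of "\<lambda>x. Re (f x)"] integral_stationary_real(2)[of "\<lambda>x. Im (f x)"] f
      integrable_cong_AE[OF _ _ re] integrable_cong_AE[OF _ _ im] by auto
  have "integrable M (\<lambda>x. complex_of_real (Re (T f x)) + \<i> * complex_of_real (Im (T f x)))"
    using Re_i Im_i
    by (intro Bochner_Integration.integrable_add integrable_mult_right integrable_of_real)
  then have Ti: "integrable M (T f)"
    by (simp add: complex_eq[symmetric])
  show ?thesis
  proof (rule complex_eqI)
    have "(\<integral>x. Re (T f x) \<partial>M) = (\<integral>x. \<integral>y. Re (f y) \<partial>P x \<partial>M)"
      using re by (intro integral_cong_AE) auto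
    then have "Re (\<integral>x. T f x \<partial>M) = (\<integral>x. \<integral>y. Re (f y) \<partial>P x \<partial>M)"
      using Ti by simp
    then show "Re (\<integral>x. T f x \<partial>M) = Re (\<integral>x. f x \<partial>M)"
      using f integral_stationary_real(1)[of "\<lambda>x. Re (f x)"] by simp
    have "(\<integral>x. Im (T f x) \<partial>M) = (\<integral>x. \<integral>y. Im (f y) \<partial>P x \<partial>M)"
      using im by (intro integral_cong_AE) auto
    then have "Im (\<integral>x. T f x \<partial>M) = (\<integral>x. \<integral>y. Im (f y) \<partial>P x \<partial>M)"
      using Ti by simp
    then show "Im (\<integral>x. T f x \<partial>M) = Im (\<integral>x. f x \<partial>M)"
      using f integral_stationary_real(1)[of "\<lambda>x. Im (f x)"] by simp
  qed
qed

text \<open>Cauchy-Schwarz against the constant 1 under \<open>P x\<close> bounds the square of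
  \<open>cmod (T f x)\<close> by the kernel average of the square of \<open>cmod f\<close>;
  stationarity integrates that average back to the norm of \<open>f\<close>.\<close>

lemma T_L2:
  assumes f: "f \<in> L2 M"
  shows "T f \<in> L2 M" "L2_norm M (T f) \<le> L2_norm M f"
proof -
  have [measurable]: "f \<in> borel_measurable M" using f by (simp add: L2_iff)
  have "AE x in M. ennreal ((cmod (T f x))\<^sup>2) \<le> (\<integral>\<^sup>+y. ennreal ((cmod (f y))\<^sup>2) \<partial>P x)"
    using AE_kernel_integrable[OF L2_integrable[OF f]] AE_space[of M]
  proof eventually_elim
    case (elim x)
    interpret Px: prob_space "P x" using elim(2) by (rule prob_space_kernel)
    note [measurable] = measurable_on_kernel[OF _ elim(2), of f]
    have "ennreal ((cmod (T f x))\<^sup>2) = (ennreal (cmod (T f x)))\<^sup>2" by (simp add: ennreal_power)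
    also have "\<dots> \<le> (\<integral>\<^sup>+y. ennreal (cmod (f y)) * 1 \<partial>P x)\<^sup>2"
      using integral_norm_bound_ennreal[OF elim(1)] by (intro power_mono) (auto simp: markov_operator_def)
    also have "\<dots> \<le> (\<integral>\<^sup>+y. (ennreal (cmod (f y)))\<^sup>2 \<partial>P x) * (\<integral>\<^sup>+y. 1\<^sup>2 \<partial>P x)"
      by (rule Cauchy_Schwarz_nn_integral) auto
    finally show ?case by (simp add: Px.emeasure_space_1 ennreal_power)
  qed
  then have "(\<integral>\<^sup>+x. ennreal ((cmod (T f x))\<^sup>2) \<partial>M) \<le> (\<integral>\<^sup>+x. \<integral>\<^sup>+y. ennreal ((cmod (f y))\<^sup>2) \<partial>P x \<partial>M)"
    by (rule nn_integral_mono_AE)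
  also have "\<dots> = ennreal ((L2_norm M f)\<^sup>2)"
    by (simp add: nn_integral_stationary nn_integral_L2_norm[OF f])
  finally have *: "(\<integral>\<^sup>+x. ennreal ((cmod (T f x))\<^sup>2) \<partial>M) \<le> ennreal ((L2_norm M f)\<^sup>2)" .
  show "T f \<in> L2 M" "L2_norm M (T f) \<le> L2_norm M f"
    by (rule L2_bounded_by[OF _ _ *]; simp)+
qed

lemma T_add:
  assumes "f \<in> L2 M" "g \<in> L2 M"
  shows "AE x in M. T (\<lambda>x. f x + g x) x = T f x + T g x"
  using AE_kernel_integrable[OF L2_integrable[OF assms(1)]] AE_kernel_integrable[OF L2_integrable[OF assms(2)]]
  by eventually_elim (simp add: markov_operator_def)

lemma T_diff:
  assumes "f \<in> L2 M" "g \<in> L2 M"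
  shows "AE x in M. T (\<lambda>x. f x - g x) x = T f x - T g x"
  using AE_kernel_integrable[OF L2_integrable[OF assms(1)]] AE_kernel_integrable[OF L2_integrable[OF assms(2)]]
  by eventually_elim (simp add: markov_operator_def)

lemma T_cmult: "T (\<lambda>x. c * f x) x = c * T f x"
  by (simp add: markov_operator_def)

lemma T_const: "x \<in> space M \<Longrightarrow> T (\<lambda>_. c) x = c"
  by (simp add: markov_operator_def prob_space.prob_space[OF prob_space_kernel])

lemma T_centered:
  assumes "f \<in> L2 M"
  shows "AE x in M. T (\<lambda>x. f x - c) x = T f x - c"
  using T_diff[OF assms L2_const(1)[of c]] AE_space by eventually_elim (simp add: T_const)

end

section \<open>Resolvent of a kernel that contracts the centred functions\<close>

context stationary_kernel
begin

text \<open>\<open>T\<close> fixes the constants, so only its norm on their orthogonal complement,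
  the functions of mean zero, can be below 1.\<close>

definition contracts :: "real \<Rightarrow> bool" where
  "contracts s \<longleftrightarrow> (\<forall>f\<in>L2 M. (\<integral>x. f x \<partial>M) = 0 \<longrightarrow> L2_norm M (T f) \<le> s * L2_norm M f)"

lemma contractsD:
  "contracts s \<Longrightarrow> f \<in> L2 M \<Longrightarrow> (\<integral>x. f x \<partial>M) = 0 \<Longrightarrow> L2_norm M (T f) \<le> s * L2_norm M f"
  by (simp add: contracts_def)

lemma contracts_1: "contracts 1"
  by (simp add: contracts_def T_L2)

lemma L2_measurable: "f \<in> L2 M \<Longrightarrow> f \<in> borel_measurable M"
  by (simp add: L2_iff)

lemma integral_centered:
  assumes "f \<in> L2 M" shows "(\<integral>x. f x - (\<integral>y. f y \<partial>M) \<partial>M) = 0"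
  using L2_integrable[OF assms] by (simp add: prob_space)

text \<open>The operator \<open>l - T\<close> respects the splitting into constants and centred
  functions. On constants it multiplies by \<open>l - 1\<close>, which gives the second term; on
  centred functions it is bounded below by \<open>cmod l - s\<close>, which gives the first, with a
  2 from centring \<open>f\<close>. Uniqueness and boundedness of the resolvent both follow from
  this estimate.\<close>

lemma resolvent_bound:
  assumes s: "0 \<le> s" "contracts s" and l: "s < cmod l" "l \<noteq> 1"
    and f: "f \<in> L2 M" and g: "g \<in> L2 M"
    and eq: "AE x in M. l * g x - T g x = f x"
  shows "L2_norm M g \<le> (2 / (cmod l - s) + 1 / cmod (l - 1)) * L2_norm M f"
proof -
  note [measurable] = L2_measurable[OF f] L2_measurable[OF g]
  define mf where "mf = (\<integral>x. f x \<partial>M)"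
  define mg where "mg = (\<integral>x. g x \<partial>M)"
  \<comment> \<open>Integrating the equation isolates the mean of \<open>g\<close>, because
    \<open>T\<close> preserves integrals.\<close>
  have "mf = (\<integral>x. l * g x - T g x \<partial>M)"
    unfolding mf_def using eq by (intro integral_cong_AE) auto
  also have "\<dots> = l * mg - mg"
    using L2_integrable[OF g] L2_integrable[OF T_L2(1)[OF g]]
    by (simp add: mg_def integral_T)
  finally have m: "mf = (l - 1) * mg" by (simp add: algebra_simps)
  have "cmod (l - 1) * cmod mg \<le> L2_norm M f"
    using norm_integral_le_L2_norm[OF f] unfolding mf_def[symmetric] m norm_mult .
  then have mg_le: "cmod mg \<le> L2_norm M f / cmod (l - 1)"
    using l(2) by (simp add: pos_le_divide_eq mult.commute)
  define g0 where "g0 x = g x - mg" for x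
  have g0: "g0 \<in> L2 M" "(\<integral>x. g0 x \<partial>M) = 0"
    unfolding g0_def using L2_diff(1)[OF g L2_const(1)] integral_centered[OF g] by (auto simp: mg_def)
  have f0: "(\<lambda>x. f x - mf) \<in> L2 M" "L2_norm M (\<lambda>x. f x - mf) \<le> 2 * L2_norm M f"
    using L2_diff(1)[OF f L2_const(1)] L2_norm_centered[OF f] by (auto simp: mf_def)
  have "AE x in M. l * g0 x = (f x - mf) + T g0 x"
    using eq T_centered[OF g, of mg]
  proof eventually_elim
    case (elim x)
    have "T g0 x = T g x - mg" using elim(2) by (simp add: g0_def[abs_def])
    then show ?case unfolding g0_def m elim(1)[symmetric] by (simp add: algebra_simps)
  qed
  then have "cmod l * L2_norm M g0 = L2_norm M (\<lambda>x. (f x - mf) + T g0 x)"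
    unfolding L2_cmult(2)[OF g0(1), symmetric]
    using L2_measurable[OF g0(1)] by (intro L2_norm_cong_AE) auto
  also have "\<dots> \<le> L2_norm M (\<lambda>x. f x - mf) + L2_norm M (T g0)"
    by (intro L2_add(2) f0 T_L2 g0)
  also have "\<dots> \<le> 2 * L2_norm M f + s * L2_norm M g0"
    by (intro add_mono f0 contractsD s g0)
  finally have "(cmod l - s) * L2_norm M g0 \<le> 2 * L2_norm M f" by (simp add: algebra_simps)
  then have "L2_norm M g0 \<le> 2 * L2_norm M f / (cmod l - s)"
    using l by (simp add: field_simps)
  moreover have "L2_norm M g \<le> L2_norm M g0 + cmod mg"
    using L2_add(2)[OF g0(1) L2_const(1)[of mg]] by (simp add: g0_def)
  ultimately show ?thesis using mg_le by (simp add: algebra_simps)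
qed

lemma resolvent_unique:
  assumes s: "0 \<le> s" "contracts s" and l: "s < cmod l" "l \<noteq> 1"
    and u: "u \<in> L2 M" and v: "v \<in> L2 M"
    and eq: "AE x in M. l * u x - T u x = l * v x - T v x"
  shows "AE x in M. u x = v x"
proof -
  have d: "(\<lambda>x. u x - v x) \<in> L2 M" using L2_diff[OF u v] by simp
  have z: "(\<lambda>_. 0) \<in> L2 M" by simp
  have "AE x in M. l * (u x - v x) - T (\<lambda>x. u x - v x) x = 0"
    using eq T_diff[OF u v]
  proof eventually_elim
    case (elim x)
    have "l * (u x - v x) - (T u x - T v x) = (l * u x - T u x) - (l * v x - T v x)"
      by (simp add: algebra_simps)
    then show ?case by (simp only: elim) simp
  qed
  from resolvent_bound[OF s l z d this] have "L2_norm M (\<lambda>x. u x - v x) = 0"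
    by (simp add: order_antisym)
  from L2_norm_eq_0[OF d this] show ?thesis by simp
qed

lemma T_iterate:
  assumes s: "0 \<le> s" "contracts s" and f: "f \<in> L2 M" "(\<integral>x. f x \<partial>M) = 0"
  shows "(T ^^ n) f \<in> L2 M \<and> (\<integral>x. (T ^^ n) f x \<partial>M) = 0 \<and> L2_norm M ((T ^^ n) f) \<le> s ^ n * L2_norm M f"
proof (induction n)
  case (Suc n)
  then have IH: "(T ^^ n) f \<in> L2 M" "(\<integral>x. (T ^^ n) f x \<partial>M) = 0"
    "L2_norm M ((T ^^ n) f) \<le> s ^ n * L2_norm M f" by auto
  have "L2_norm M (T ((T ^^ n) f)) \<le> s * (s ^ n * L2_norm M f)"
    using contractsD[OF s(2) IH(1,2)] mult_left_mono[OF IH(3) s(1)] by simp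
  then show ?case
    using T_L2(1)[OF IH(1)] IH(2) integral_T[OF L2_integrable[OF IH(1)]] by (simp add: mult.assoc)
qed (use f in auto)

text \<open>The Neumann series of \<open>l - T\<close> converges geometrically with ratio
  \<open>s / cmod l\<close>. As elements are functions and not classes, it is summed pointwise:
  finite total first norm gives absolute convergence almost everywhere, Fatou's lemma puts the sum
  into L2, and absolute summability under almost every \<open>P x\<close> lets \<open>T\<close> act
  term by term.\<close>

lemma resolvent_exists_centered:
  assumes s: "0 \<le> s" "contracts s" and l: "s < cmod l"
    and f: "f \<in> L2 M" "(\<integral>x. f x \<partial>M) = 0"
  obtains g where "g \<in> L2 M" "AE x in M. l * g x - T g x = f x"
proof -
  define h where "h n = (T ^^ n) f" for n
  have h: "h n \<in> L2 M" "L2_norm M (h n) \<le> s ^ n * L2_norm M f" for n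
    using T_iterate[OF s f] by (auto simp: h_def)
  have h0: "h 0 = f" and hS: "h (Suc n) = T (h n)" for n by (auto simp: h_def)
  define G where "G n x = inverse l ^ Suc n * h n x" for n x
  have l0: "l \<noteq> 0" using l s(1) by auto
  define w where "w = s / cmod l"
  have w: "0 \<le> w" "w < 1" using s(1) l le_less_trans[OF s(1) l] by (auto simp: w_def divide_less_eq)
  define C where "C = L2_norm M f / cmod l"
  have C: "0 \<le> C" by (simp add: C_def)
  have G: "G n \<in> L2 M" "L2_norm M (G n) \<le> C * w ^ n" for n
  proof -
    show "G n \<in> L2 M" unfolding G_def by (intro L2_cmult h)
    have "L2_norm M (G n) = inverse (cmod l) ^ Suc n * L2_norm M (h n)"
      unfolding G_def by (simp add: L2_cmult(2)[OF h(1)] norm_mult norm_power norm_inverse)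
    also have "\<dots> \<le> inverse (cmod l) ^ Suc n * (s ^ n * L2_norm M f)"
      by (intro mult_left_mono h) auto
    also have "\<dots> = C * w ^ n" by (simp add: C_def w_def field_simps)
    finally show "L2_norm M (G n) \<le> C * w ^ n" .
  qed
  note [measurable] = L2_measurable[OF G(1)] L2_measurable[OF h(1)]
  have wsum: "(\<Sum>i<n. C * w ^ i) \<le> C / (1 - w)" for n
  proof -
    have "(\<Sum>i<n. C * w ^ i) = C * (\<Sum>i<n. w ^ i)" by (simp add: sum_distrib_left)
    also have "\<dots> \<le> C * (\<Sum>i. w ^ i)"
      using w C by (intro mult_left_mono sum_le_suminf summable_geometric) auto
    also have "\<dots> = C / (1 - w)" using w by (simp add: suminf_geometric)
    finally show ?thesis .
  qed
  have "(\<integral>\<^sup>+x. (\<Sum>n. ennreal (cmod (G n x))) \<partial>M) = (\<Sum>n. \<integral>\<^sup>+x. ennreal (cmod (G n x)) \<partial>M)"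
    by (intro nn_integral_suminf) auto
  also have "\<dots> \<le> (\<Sum>n. ennreal (C * w ^ n))"
    by (intro suminf_le order_trans[OF nn_integral_le_L2_norm[OF G(1)] ennreal_leI[OF G(2)]]) auto
  also have "\<dots> < \<infinity>"
    using w C by (subst suminf_ennreal2) (auto intro!: summable_mult summable_geometric)
  finally have fin: "(\<integral>\<^sup>+x. (\<Sum>n. ennreal (cmod (G n x))) \<partial>M) < \<infinity>" .
  have AE_sum: "AE x in M. summable (\<lambda>n. cmod (G n x))"
  proof -
    have "AE x in M. (\<Sum>n. ennreal (cmod (G n x))) \<noteq> \<infinity>"
      using fin by (intro nn_integral_noteq_infinite) auto
    then show ?thesis by eventually_elim (intro summable_suminf_not_top; auto)
  qed
  define g where "g x = (\<Sum>n. G n x)" for x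
  have [measurable]: "g \<in> borel_measurable M" unfolding g_def by measurable
  have "(\<integral>\<^sup>+x. ennreal ((cmod (g x))\<^sup>2) \<partial>M) \<le> (\<integral>\<^sup>+x. liminf (\<lambda>n. ennreal ((cmod (\<Sum>i<n. G i x))\<^sup>2)) \<partial>M)"
  proof (rule nn_integral_mono_AE)
    show "AE x in M. ennreal ((cmod (g x))\<^sup>2) \<le> liminf (\<lambda>n. ennreal ((cmod (\<Sum>i<n. G i x))\<^sup>2))"
      using AE_sum
    proof eventually_elim
      case (elim x)
      then have "(\<lambda>n. \<Sum>i<n. G i x) \<longlonglongrightarrow> g x"
        unfolding g_def by (intro summable_LIMSEQ) (rule summable_norm_cancel)
      then have "(\<lambda>n. ennreal ((cmod (\<Sum>i<n. G i x))\<^sup>2)) \<longlonglongrightarrow> ennreal ((cmod (g x))\<^sup>2)"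
        by (intro tendsto_ennrealI tendsto_intros)
      from lim_imp_Liminf[OF sequentially_bot this] show ?case by simp
    qed
  qed
  also have "\<dots> \<le> liminf (\<lambda>n. \<integral>\<^sup>+x. ennreal ((cmod (\<Sum>i<n. G i x))\<^sup>2) \<partial>M)"
    by (rule nn_integral_liminf) measurable
  also have "\<dots> \<le> liminf (\<lambda>n::nat. ennreal ((C / (1 - w))\<^sup>2))"
  proof (intro Liminf_mono always_eventually allI)
    fix n
    have S: "(\<lambda>x. \<Sum>i<n. G i x) \<in> L2 M" "L2_norm M (\<lambda>x. \<Sum>i<n. G i x) \<le> (\<Sum>i<n. L2_norm M (G i))"
      using L2_sum[of n G M] G(1) by auto
    have "L2_norm M (\<lambda>x. \<Sum>i<n. G i x) \<le> C / (1 - w)"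
      by (rule order_trans[OF S(2) order_trans[OF sum_mono[OF G(2)] wsum]])
    then show "(\<integral>\<^sup>+x. ennreal ((cmod (\<Sum>i<n. G i x))\<^sup>2) \<partial>M) \<le> ennreal ((C / (1 - w))\<^sup>2)"
      by (subst nn_integral_L2_norm[OF S(1)]) (intro ennreal_leI power_mono; simp)
  qed
  also have "\<dots> = ennreal ((C / (1 - w))\<^sup>2)" by (simp add: Liminf_const)
  finally have "g \<in> L2 M"
    using C w by (intro L2_bounded_by(1)[of g M "C / (1 - w)"]) auto
  moreover
  have fin_x: "AE x in M. (\<integral>\<^sup>+y. (\<Sum>n. ennreal (cmod (G n y))) \<partial>P x) < \<infinity>"
    by (rule AE_kernel_finite[OF _ fin]) measurable
  have int_x: "AE x in M. \<forall>n. integrable (P x) (G n)"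
    unfolding AE_all_countable using AE_kernel_integrable[OF L2_integrable[OF G(1)]] by blast
  have "AE x in M. l * g x - T g x = f x"
    using AE_sum AE_kernel[OF AE_sum] fin_x AE_space[of M] int_x
  proof eventually_elim
    case (elim x)
    have sp: "AE y in P x. summable (\<lambda>n. cmod (G n y))" using elim(2) .
    have G_int: "integrable (P x) (G n)" for n using elim(5) by auto
    have "(\<Sum>n. ennreal (\<integral>y. cmod (G n y) \<partial>P x)) = (\<Sum>n. \<integral>\<^sup>+y. ennreal (cmod (G n y)) \<partial>P x)"
      using G_int by (subst nn_integral_eq_integral) auto
    also have "\<dots> = (\<integral>\<^sup>+y. (\<Sum>n. ennreal (cmod (G n y))) \<partial>P x)"
      using elim(4) by (intro nn_integral_suminf[symmetric]) (auto intro!: measurable_on_kernel)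
    also have "\<dots> < \<infinity>" using elim(3) by auto
    finally have "summable (\<lambda>n. \<integral>y. cmod (G n y) \<partial>P x)"
      by (intro summable_suminf_not_top) auto
    then have "(\<lambda>n. \<integral>y. G n y \<partial>P x) sums (\<integral>y. g y \<partial>P x)"
      unfolding g_def using G_int sp by (intro sums_integral) auto
    moreover have "(\<integral>y. G n y \<partial>P x) = inverse l ^ Suc n * h (Suc n) x" for n
      unfolding G_def by (simp add: hS markov_operator_def)
    ultimately have Tg: "(\<lambda>n. inverse l ^ Suc n * h (Suc n) x) sums T g x"
      by (simp add: markov_operator_def)
    have "(\<lambda>n. G n x) sums g x"
      unfolding g_def by (rule summable_sums[OF summable_norm_cancel[OF elim(1)]])
    then have "(\<lambda>n. l * G n x) sums (l * g x)" by (rule sums_mult)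
    moreover have "l * G n x = inverse l ^ n * h n x" for n
      using l0 by (simp add: G_def)
    ultimately have "(\<lambda>n. inverse l ^ n * h n x) sums (l * g x)" by simp
    \<comment> \<open>Multiplication by \<open>l\<close> shifts the series by one index: after
      removal of its first term \<open>f\<close> it is exactly the series found for
      \<open>T g\<close>.\<close>
    then have "(\<lambda>n. inverse l ^ Suc n * h (Suc n) x) sums (l * g x - h 0 x)"
      using sums_Suc_iff[of "\<lambda>n. inverse l ^ n * h n x" "l * g x - h 0 x"] by simp
    with Tg have "T g x = l * g x - h 0 x" by (rule sums_unique2)
    then show ?case by (simp add: h0)
  qed
  ultimately show ?thesis by (rule that)
qed

lemma resolvent_exists:
  assumes s: "0 \<le> s" "contracts s" and l: "s < cmod l" "l \<noteq> 1" and f: "f \<in> L2 M"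
  obtains g where "g \<in> L2 M" "AE x in M. l * g x - T g x = f x"
proof -
  define m where "m = (\<integral>x. f x \<partial>M)"
  have f0: "(\<lambda>x. f x - m) \<in> L2 M" "(\<integral>x. f x - m \<partial>M) = 0"
    using L2_diff(1)[OF f L2_const(1)] integral_centered[OF f] by (auto simp: m_def)
  obtain g where g: "g \<in> L2 M" "AE x in M. l * g x - T g x = f x - m"
    using resolvent_exists_centered[OF s l(1) f0] by blast
  \<comment> \<open>Chosen so that \<open>(l - 1) * c = m\<close>, because \<open>l - T\<close>
    multiplies constants by \<open>l - 1\<close>.\<close>
  define c where "c = m / (l - 1)"
  have "(\<lambda>x. g x + c) \<in> L2 M" using L2_add(1)[OF g(1) L2_const(1)] .
  moreover have "AE x in M. l * (g x + c) - T (\<lambda>x. g x + c) x = f x"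
    using g(2) T_add[OF g(1) L2_const(1)[of c]] AE_space
  proof eventually_elim
    case (elim x)
    have "(l - 1) * c = m" using l(2) by (simp add: c_def)
    then show ?case using elim by (simp add: T_const algebra_simps)
  qed
  ultimately show ?thesis by (rule that)
qed

text \<open>A solution is chosen for each function with no regard to structure. Uniqueness up to
  null sets then yields additivity, homogeneity, compatibility with equality almost everywhere, and
  that \<open>R\<close> is also a left inverse.\<close>

theorem L2_resolvent_exists_outside_disc:
  assumes s: "0 \<le> s" "contracts s" and l: "s < cmod l" "l \<noteq> 1"
  shows "L2_resolvent_exists M P l"
proof -
  have "\<exists>g. g \<in> L2 M \<and> (AE x in M. l * g x - T g x = f x)" if "f \<in> L2 M" for f
    using resolvent_exists[OF s l that] by blast
  then have "\<forall>f\<in>L2 M. \<exists>g. g \<in> L2 M \<and> (AE x in M. l * g x - T g x = f x)" by blast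
  from bchoice[OF this] obtain R
    where "\<forall>f\<in>L2 M. R f \<in> L2 M \<and> (AE x in M. l * R f x - T (R f) x = f x)" ..
  then have R: "\<And>f. f \<in> L2 M \<Longrightarrow> R f \<in> L2 M"
    and eq: "\<And>f. f \<in> L2 M \<Longrightarrow> AE x in M. l * R f x - T (R f) x = f x"
    by blast+
  note unique = resolvent_unique[OF s l]
  show ?thesis
    unfolding L2_resolvent_exists_def
  proof (intro exI[of _ R] conjI ballI)
    show "bounded_L2_operator M R"
      unfolding bounded_L2_operator_def
    proof (intro conjI ballI allI impI)
      fix f g assume f: "f \<in> L2 M" and g: "g \<in> L2 M"
      show "AE x in M. R f x = R g x" if "AE x in M. f x = g x"
      proof (rule unique[OF R[OF f] R[OF g]])
        show "AE x in M. l * R f x - T (R f) x = l * R g x - T (R g) x"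
          using eq[OF f] eq[OF g] that by eventually_elim simp
      qed
      show "AE x in M. R (\<lambda>z. f z + g z) x = R f x + R g x"
      proof (rule unique[OF R[OF L2_add(1)[OF f g]] L2_add(1)[OF R[OF f] R[OF g]]])
        show "AE x in M. l * R (\<lambda>x. f x + g x) x - T (R (\<lambda>x. f x + g x)) x =
            l * (R f x + R g x) - T (\<lambda>x. R f x + R g x) x"
          using eq[OF L2_add(1)[OF f g]] eq[OF f] eq[OF g] T_add[OF R[OF f] R[OF g]]
          by eventually_elim (simp add: algebra_simps)
      qed
    next
      fix f c assume f: "f \<in> L2 M"
      show "AE x in M. R (\<lambda>z. c * f z) x = c * R f x"
      proof (rule unique[OF R[OF L2_cmult(1)[OF f]] L2_cmult(1)[OF R[OF f]]])
        show "AE x in M. l * R (\<lambda>x. c * f x) x - T (R (\<lambda>x. c * f x)) x =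
            l * (c * R f x) - T (\<lambda>x. c * R f x) x"
          using eq[OF L2_cmult(1)[OF f]] eq[OF f]
          by eventually_elim (simp add: T_cmult algebra_simps)
      qed
    next
      show "\<exists>C. \<forall>f\<in>L2 M. L2_norm M (R f) \<le> C * L2_norm M f"
        using resolvent_bound[OF s l _ R eq] by blast
    qed (rule R)
  next
    fix f assume f: "f \<in> L2 M"
    show "AE x in M. l * R f x - T (R f) x = f x" by (rule eq[OF f])
    have d: "(\<lambda>z. l * f z - T f z) \<in> L2 M"
      by (intro L2_diff L2_cmult T_L2 f)
    show "AE x in M. R (\<lambda>z. l * f z - T f z) x = f x"
      by (rule unique[OF R[OF d] f eq[OF d]])
  qed
qed

text \<open>The centred part of a fixed function has norm at most \<open>s\<close> times itself,
  hence vanishes almost everywhere; only the constants remain.\<close>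

lemma has_multiplicity_one_of_contracts:
  assumes s: "0 \<le> s" "s < 1" "contracts s"
  shows "has_multiplicity_one M P 1"
proof -
  have "(\<lambda>_. 1) \<in> L2_eigenfunctions M P 1"
    using AE_space by (auto simp: L2_eigenfunctions_def T_const elim!: eventually_mono)
  moreover have "\<not> (AE x in M. (1::complex) = 0)"
    by (simp add: AE_False)
  moreover have "\<exists>c. AE x in M. g x = c * 1" if g: "g \<in> L2_eigenfunctions M P 1" for g
  proof -
    have gL: "g \<in> L2 M" and ev: "AE x in M. T g x = g x" using g by (auto simp: L2_eigenfunctions_def)
    define m where "m = (\<integral>x. g x \<partial>M)"
    have g0: "(\<lambda>x. g x - m) \<in> L2 M" "(\<integral>x. g x - m \<partial>M) = 0"
      using L2_diff(1)[OF gL L2_const(1)] integral_centered[OF gL] by (auto simp: m_def)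
    have "AE x in M. T (\<lambda>x. g x - m) x = g x - m"
      using ev T_centered[OF gL, of m] by eventually_elim simp
    then have "L2_norm M (T (\<lambda>x. g x - m)) = L2_norm M (\<lambda>x. g x - m)"
      using L2_measurable[OF g0(1)] by (intro L2_norm_cong_AE) auto
    with contractsD[OF s(3) g0] have "(1 - s) * L2_norm M (\<lambda>x. g x - m) \<le> 0"
      by (simp add: algebra_simps)
    then have "L2_norm M (\<lambda>x. g x - m) = 0"
      using s(2) by (simp add: mult_le_0_iff order_antisym)
    from L2_norm_eq_0[OF g0(1) this] show ?thesis by (intro exI[of _ m]) simp
  qed
  ultimately show ?thesis
    unfolding has_multiplicity_one_def by (intro bexI[of _ "\<lambda>_. 1"] conjI ballI) auto
qed

text \<open>If the eigenvalue 1 is not simple, no \<open>s < 1\<close> contracts, so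
  \<open>s \<le> 1\<close> leaves \<open>s = 1\<close> and the bound agrees with the value 0
  prescribed for that case. The value 0 of an empty supremum is covered by
  \<open>0 \<le> s\<close>.\<close>

theorem absolute_spectral_gap_ge:
  assumes s: "0 \<le> s" "s \<le> 1" "contracts s"
  shows "1 - s \<le> absolute_spectral_gap M P"
proof (cases "has_multiplicity_one M P 1")
  case True
  have le: "cmod l \<le> s" if "l \<in> S2 M P - {1}" for l
    using that L2_resolvent_exists_outside_disc[OF s(1,3), of l] by (force simp: S2_def)
  have "(if S2 M P - {1} = {} then 0 else SUP l\<in>S2 M P - {1}. cmod l) \<le> s"
    using s(1) le by (auto intro!: cSUP_least)
  then show ?thesis using True by (simp add: absolute_spectral_gap_def)
next
  case False
  then have "s = 1" using has_multiplicity_one_of_contracts[of s] s by force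
  then show ?thesis using False by (simp add: absolute_spectral_gap_def)
qed

end

section \<open>From decay of covariances to a norm bound\<close>

text \<open>Log-convexity makes the ratios \<open>b (Suc k) / b k\<close> nondecreasing. A first
  ratio \<open>r > q\<close> would force \<open>b k \<ge> r ^ k * b 0\<close>, which outgrows
  \<open>C * q ^ k\<close> however large \<open>C\<close> is.\<close>

lemma log_convex_ratio:
  fixes b :: "nat \<Rightarrow> real"
  assumes nonneg: "\<And>k. 0 \<le> b k"
    and convex: "\<And>k. (b (Suc k))\<^sup>2 \<le> b k * b (Suc (Suc k))"
    and decay: "\<And>k. b k \<le> C * q ^ k" and q: "0 < q"
  shows "b 1 \<le> q * b 0"
proof (rule ccontr)
  assume "\<not> b 1 \<le> q * b 0"
  then have b1: "q * b 0 < b 1" by simp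
  then have b1_pos: "0 < b 1" using nonneg[of 0] q by (smt (verit) mult_nonneg_nonneg)
  have b0: "0 < b 0"
  proof (rule ccontr)
    assume "\<not> 0 < b 0"
    then have "b 0 = 0" using nonneg[of 0] by simp
    with convex[of 0] b1_pos show False by simp
  qed
  define r where "r = b 1 / b 0"
  have r: "q < r" using b1 b0 by (simp add: r_def field_simps)
  have r0: "0 < r" using r q by simp
  have step: "0 < b k \<and> r * b k \<le> b (Suc k)" for k
  proof (induction k)
    case 0
    then show ?case using b0 by (simp add: r_def)
  next
    case (Suc k)
    then have k: "0 < b k" "r * b k \<le> b (Suc k)" by auto
    have S: "0 < b (Suc k)" using k r0 by (smt (verit) mult_pos_pos)
    have "b k * (r * b (Suc k)) = (r * b k) * b (Suc k)" by simp
    also have "\<dots> \<le> b (Suc k) * b (Suc k)" using k(2) S by (intro mult_right_mono) auto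
    also have "\<dots> \<le> b k * b (Suc (Suc k))" using convex[of k] by (simp add: power2_eq_square)
    finally show ?case using k(1) S by simp
  qed
  have grow: "r ^ k * b 0 \<le> b k" for k
  proof (induction k)
    case (Suc k)
    have "r ^ Suc k * b 0 = r * (r ^ k * b 0)" by simp
    also have "\<dots> \<le> r * b k" using Suc r0 by (intro mult_left_mono) auto
    also have "\<dots> \<le> b (Suc k)" using step by simp
    finally show ?case .
  qed simp
  have "(r / q) ^ k \<le> C / b 0" for k
  proof -
    have "r ^ k * b 0 \<le> C * q ^ k" using grow[of k] decay[of k] by simp
    then show ?thesis using b0 q by (simp add: power_divide field_simps)
  qed
  moreover have "1 < r / q" using r q by simp
  then obtain k where "C / b 0 < (r / q) ^ k" using real_arch_pow by blast
  ultimately show False by (simp add: leD)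
qed

lemma L2_of_real:
  fixes u :: "'a \<Rightarrow> real"
  assumes "u \<in> borel_measurable M" "integrable M (\<lambda>x. (u x)\<^sup>2)"
  shows "(\<lambda>x. complex_of_real (u x)) \<in> L2 M" "(L2_norm M (\<lambda>x. complex_of_real (u x)))\<^sup>2 = (\<integral>x. (u x)\<^sup>2 \<partial>M)"
  using assms by (auto simp: L2_def L2_norm_def)

lemma L2_Re_Im:
  assumes "f \<in> L2 M"
  shows "integrable M (\<lambda>x. (Re (f x))\<^sup>2)" "integrable M (\<lambda>x. (Im (f x))\<^sup>2)"
    "(L2_norm M f)\<^sup>2 = (\<integral>x. (Re (f x))\<^sup>2 \<partial>M) + (\<integral>x. (Im (f x))\<^sup>2 \<partial>M)"
proof -
  have i: "integrable M (\<lambda>x. (cmod (f x))\<^sup>2)" and [measurable]: "f \<in> borel_measurable M"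
    using assms by (auto simp: L2_def)
  show r: "integrable M (\<lambda>x. (Re (f x))\<^sup>2)" and im: "integrable M (\<lambda>x. (Im (f x))\<^sup>2)"
    by (rule Bochner_Integration.integrable_bound[OF i]; simp add: cmod_power2)+
  show "(L2_norm M f)\<^sup>2 = (\<integral>x. (Re (f x))\<^sup>2 \<partial>M) + (\<integral>x. (Im (f x))\<^sup>2 \<partial>M)"
    unfolding L2_norm_def using r im by (simp add: cmod_power2)
qed

context stationary_kernel
begin

abbreviation TR where "TR (f :: 'a \<Rightarrow> real) \<equiv> (\<lambda>x. \<integral>y. f y \<partial>P x)"

text \<open>Such functions are integrable under every \<open>P x\<close> with \<open>x\<close> in
  the space, so identities for \<open>TR\<close> hold at every point and can be iterated without
  exceptional sets.\<close>

definition bounded_functions :: "('a \<Rightarrow> real) set" where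
  "bounded_functions = {f \<in> borel_measurable M. \<exists>B. \<forall>x\<in>space M. \<bar>f x\<bar> \<le> B}"

lemma bounded_functions_integrable:
  "f \<in> bounded_functions \<Longrightarrow> integrable M f"
  by (auto simp: bounded_functions_def intro!: integrable_const_bound AE_I2)

lemma bounded_functions_mult:
  assumes "f \<in> bounded_functions" "g \<in> bounded_functions"
  shows "(\<lambda>x. f x * g x) \<in> bounded_functions"
proof -
  from assms obtain B C where B: "\<And>x. x \<in> space M \<Longrightarrow> \<bar>f x\<bar> \<le> B" and C: "\<And>x. x \<in> space M \<Longrightarrow> \<bar>g x\<bar> \<le> C"
    and [measurable]: "f \<in> borel_measurable M" "g \<in> borel_measurable M"
    by (auto simp: bounded_functions_def)
  have "\<bar>f x * g x\<bar> \<le> B * C" if "x \<in> space M" for x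
    unfolding abs_mult using B[OF that] C[OF that] by (intro mult_mono) auto
  then show ?thesis by (auto simp: bounded_functions_def)
qed

lemma bounded_functions_intros:
  assumes "f \<in> bounded_functions"
  shows "(\<lambda>x. f x - c) \<in> bounded_functions" "(\<lambda>x. (f x)\<^sup>2) \<in> bounded_functions"
    "TR f \<in> bounded_functions"
proof -
  from assms obtain B where B: "\<And>x. x \<in> space M \<Longrightarrow> \<bar>f x\<bar> \<le> B"
    and [measurable]: "f \<in> borel_measurable M"
    by (auto simp: bounded_functions_def)
  have "\<bar>f x - c\<bar> \<le> B + \<bar>c\<bar>" if "x \<in> space M" for x using B[OF that] by linarith
  then show "(\<lambda>x. f x - c) \<in> bounded_functions" by (auto simp: bounded_functions_def)
  have "\<bar>(f x)\<^sup>2\<bar> \<le> B\<^sup>2" if "x \<in> space M" for x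
    using power_mono[OF B[OF that], of 2] by simp
  then show "(\<lambda>x. (f x)\<^sup>2) \<in> bounded_functions" by (auto simp: bounded_functions_def)
  have "\<bar>TR f x\<bar> \<le> B" if x: "x \<in> space M" for x
  proof -
    interpret Px: prob_space "P x" by (rule prob_space_kernel[OF x])
    have sp: "space (P x) = space M" by (rule sets_eq_imp_space_eq[OF sets_kernel[OF x]])
    have [measurable]: "f \<in> borel_measurable (P x)" by (rule measurable_on_kernel) (use x in auto)
    have i: "integrable (P x) f"
      using B sp by (intro Px.integrable_const_bound[of _ B] AE_I2) auto
    have "\<bar>TR f x\<bar> \<le> (\<integral>y. \<bar>f y\<bar> \<partial>P x)" by (rule integral_abs_bound)
    also have "\<dots> \<le> (\<integral>y. B \<partial>P x)"
      using B i sp by (intro integral_mono) auto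
    finally show ?thesis by (simp add: Px.prob_space)
  qed
  then show "TR f \<in> bounded_functions" by (auto simp: bounded_functions_def)
qed

lemma bounded_functions_iterate:
  "f \<in> bounded_functions \<Longrightarrow> (TR ^^ n) f \<in> bounded_functions"
  by (induction n) (auto intro: bounded_functions_intros)

lemma TR_diff_const:
  assumes f: "f \<in> bounded_functions" and x: "x \<in> space M"
  shows "TR (\<lambda>x. f x - c) x = TR f x - c"
proof -
  interpret Px: prob_space "P x" by (rule prob_space_kernel[OF x])
  have sp: "space (P x) = space M" by (rule sets_eq_imp_space_eq[OF sets_kernel[OF x]])
  have "integrable (P x) f"
    using f x sp by (auto simp: bounded_functions_def intro!: Px.integrable_const_bound AE_I2 measurable_on_kernel)
  then show ?thesis by (simp add: Px.prob_space)
qed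

lemma TR_cong: "x \<in> space M \<Longrightarrow> (\<And>y. y \<in> space M \<Longrightarrow> f y = g y) \<Longrightarrow> TR f x = TR g x"
  by (intro Bochner_Integration.integral_cong) (auto simp: sets_eq_imp_space_eq[OF sets_kernel])

lemma TR_iterate_diff_const:
  assumes f: "f \<in> bounded_functions"
  shows "x \<in> space M \<Longrightarrow> (TR ^^ n) (\<lambda>x. f x - c) x = (TR ^^ n) f x - c"
proof (induction n arbitrary: x)
  case (Suc n)
  have "(TR ^^ Suc n) (\<lambda>x. f x - c) x = TR (\<lambda>x. (TR ^^ n) f x - c) x"
    using Suc by (simp, intro TR_cong) auto
  also have "\<dots> = (TR ^^ Suc n) f x - c"
    using TR_diff_const[OF bounded_functions_iterate[OF f] Suc.prems] by simp
  finally show ?case .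
qed simp

lemma integral_TR_iterate:
  assumes "f \<in> bounded_functions" shows "(\<integral>x. (TR ^^ n) f x \<partial>M) = (\<integral>x. f x \<partial>M)"
  by (induction n) (use integral_stationary_real(1)[OF bounded_functions_integrable[OF bounded_functions_iterate[OF assms]]] in auto)

text \<open>Self-adjointness, tested on bounded functions only: they are stable under products and
  under \<open>TR\<close>, and every integral involved exists.\<close>

definition reversible :: bool where
  "reversible \<longleftrightarrow> (\<forall>f\<in>bounded_functions. \<forall>g\<in>bounded_functions. (\<integral>x. TR f x * g x \<partial>M) = (\<integral>x. f x * TR g x \<partial>M))"

lemma reversible_iterate:
  assumes "reversible" "f \<in> bounded_functions" "g \<in> bounded_functions"
  shows "(\<integral>x. (TR ^^ j) f x * (TR ^^ k) g x \<partial>M) = (\<integral>x. f x * (TR ^^ (j + k)) g x \<partial>M)"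
proof (induction j arbitrary: k)
  case (Suc j)
  have "(\<integral>x. (TR ^^ Suc j) f x * (TR ^^ k) g x \<partial>M) = (\<integral>x. (TR ^^ j) f x * (TR ^^ Suc k) g x \<partial>M)"
    using assms bounded_functions_iterate by (simp add: reversible_def)
  then show ?case using Suc[of "Suc k"] by simp
qed simp

lemma Cauchy_Schwarz_bounded:
  assumes f: "f \<in> bounded_functions" and g: "g \<in> bounded_functions"
  shows "(\<integral>x. f x * g x \<partial>M)\<^sup>2 \<le> (\<integral>x. (f x)\<^sup>2 \<partial>M) * (\<integral>x. (g x)\<^sup>2 \<partial>M)"
proof -
  have meas: "f \<in> borel_measurable M" "g \<in> borel_measurable M" using f g by (auto simp: bounded_functions_def)
  note f2 = L2_of_real[OF meas(1) bounded_functions_integrable[OF bounded_functions_intros(2)[OF f]]]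
  note g2 = L2_of_real[OF meas(2) bounded_functions_integrable[OF bounded_functions_intros(2)[OF g]]]
  let ?F = "L2_norm M (\<lambda>x. complex_of_real (f x))" and ?G = "L2_norm M (\<lambda>x. complex_of_real (g x))"
  have i: "integrable M (\<lambda>x. f x * g x)" by (intro bounded_functions_integrable bounded_functions_mult f g)
  have "ennreal \<bar>\<integral>x. f x * g x \<partial>M\<bar> \<le> (\<integral>\<^sup>+x. ennreal \<bar>f x * g x\<bar> \<partial>M)"
    using integral_norm_bound_ennreal[OF i] by simp
  also have "\<dots> \<le> ennreal (?F * ?G)"
    using nn_integral_mult_le_L2_norm[OF f2(1) g2(1)] by (simp add: abs_mult)
  finally have "\<bar>\<integral>x. f x * g x \<partial>M\<bar> \<le> ?F * ?G" by (subst (asm) ennreal_le_iff) auto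
  then have "\<bar>\<integral>x. f x * g x \<partial>M\<bar>\<^sup>2 \<le> (?F * ?G)\<^sup>2" by (intro power_mono) auto
  then show ?thesis by (simp add: power_mult_distrib f2 g2)
qed

text \<open>Reversibility turns \<open>b k\<close>, the squared norm of the \<open>k\<close>-th
  iterate of the centred function, into the correlation of that function with its iterate
  \<open>2 * k\<close>. So decay at rate \<open>\<rho>\<close> becomes decay of \<open>b\<close> at
  rate \<open>\<rho>\<^sup>2\<close>, and Cauchy-Schwarz between the iterates \<open>k\<close> and
  \<open>k + 2\<close> is the log-convexity. The constant \<open>C\<close>, which depends on
  \<open>g\<close>, disappears.\<close>

lemma contraction_of_decay:
  assumes rev: "reversible" and g: "g \<in> bounded_functions" and \<rho>: "0 < \<rho>"
    and decay: "\<And>n. (\<integral>x. g x * (TR ^^ n) g x \<partial>M) - (\<integral>x. g x \<partial>M)\<^sup>2 \<le> C * \<rho> ^ n"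
  shows "(\<integral>x. (TR (\<lambda>x. g x - (\<integral>y. g y \<partial>M)) x)\<^sup>2 \<partial>M) \<le> \<rho>\<^sup>2 * (\<integral>x. (g x - (\<integral>y. g y \<partial>M))\<^sup>2 \<partial>M)"
proof -
  define m where "m = (\<integral>y. g y \<partial>M)"
  define g0 where "g0 = (\<lambda>x. g x - m)"
  have g0: "g0 \<in> bounded_functions" unfolding g0_def by (intro bounded_functions_intros g)
  note it = bounded_functions_iterate[OF g0]
  define b where "b k = (\<integral>x. ((TR ^^ k) g0 x)\<^sup>2 \<partial>M)" for k
  have prod: "(\<integral>x. (TR ^^ j) g0 x * (TR ^^ k) g0 x \<partial>M) = (\<integral>x. g0 x * (TR ^^ (j + k)) g0 x \<partial>M)" for j k
    by (rule reversible_iterate[OF rev g0 g0])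
  have b_eq: "b k = (\<integral>x. g0 x * (TR ^^ (2 * k)) g0 x \<partial>M)" for k
    using prod[of k k] by (simp add: b_def power2_eq_square mult_2)
  have "b 1 \<le> \<rho>\<^sup>2 * b 0"
  proof (rule log_convex_ratio)
    show "0 \<le> b k" for k by (simp add: b_def)
    show "(b (Suc k))\<^sup>2 \<le> b k * b (Suc (Suc k))" for k
    proof -
      have "b (Suc k) = (\<integral>x. (TR ^^ k) g0 x * (TR ^^ Suc (Suc k)) g0 x \<partial>M)"
        using prod[of k "Suc (Suc k)"] b_eq[of "Suc k"] by (simp add: mult_2)
      then show ?thesis unfolding b_def
        by (simp only:) (rule Cauchy_Schwarz_bounded[OF it it])
    qed
    show "b k \<le> C * (\<rho>\<^sup>2) ^ k" for k
    proof -
      let ?n = "2 * k"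
      have gi: "integrable M (\<lambda>x. g x * (TR ^^ ?n) g x)" "integrable M (\<lambda>x. (TR ^^ ?n) g x)" "integrable M g"
        by (intro bounded_functions_integrable bounded_functions_mult bounded_functions_iterate g)+
      have "b k = (\<integral>x. (g x - m) * ((TR ^^ ?n) g x - m) \<partial>M)"
        unfolding b_eq g0_def by (intro Bochner_Integration.integral_cong refl) (simp add: TR_iterate_diff_const[OF g])
      \<comment> \<open>Expanding the centred product leaves the covariance, since every iterate has
        mean \<open>m\<close>.\<close>
      also have "\<dots> = (\<integral>x. g x * (TR ^^ ?n) g x - m * g x - m * (TR ^^ ?n) g x + m\<^sup>2 \<partial>M)"
        by (intro Bochner_Integration.integral_cong refl) (simp add: algebra_simps power2_eq_square)
      also have "\<dots> = (\<integral>x. g x * (TR ^^ ?n) g x \<partial>M) - m * m - m * m + m\<^sup>2"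
        using gi integral_TR_iterate[OF g, of ?n] by (simp add: prob_space m_def)
      also have "\<dots> \<le> C * \<rho> ^ ?n"
        using decay[of ?n] by (simp add: m_def power2_eq_square)
      finally show ?thesis by (simp add: power_mult)
    qed
    show "0 < \<rho>\<^sup>2" using \<rho> by simp
  qed
  then show ?thesis by (simp add: b_def g0_def m_def)
qed

text \<open>The estimate is available for real functions from \<open>D\<close> only, so real and
  imaginary parts are approximated separately; the two contraction bounds add up in the squared norm
  because \<open>T\<close> acts on each part.\<close>

theorem contracts_of_dense:
  assumes \<rho>: "0 \<le> \<rho>"
    and D: "D \<subseteq> bounded_functions"
    and contr: "\<And>g. g \<in> D \<Longrightarrow> (\<integral>x. (TR (\<lambda>x. g x - (\<integral>y. g y \<partial>M)) x)\<^sup>2 \<partial>M) \<le> \<rho>\<^sup>2 * (\<integral>x. (g x - (\<integral>y. g y \<partial>M))\<^sup>2 \<partial>M)"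
    and dense: "\<And>u \<epsilon>. u \<in> borel_measurable M \<Longrightarrow> integrable M (\<lambda>x. (u x)\<^sup>2) \<Longrightarrow> 0 < \<epsilon> \<Longrightarrow>
      \<exists>g\<in>D. (\<integral>\<^sup>+x. ennreal ((u x - g x)\<^sup>2) \<partial>M) < ennreal \<epsilon>"
  shows "contracts \<rho>"
  unfolding contracts_def
proof (intro ballI impI)
  fix f assume f: "f \<in> L2 M" and f0: "(\<integral>x. f x \<partial>M) = 0"
  note [measurable] = L2_measurable[OF f]
  \<comment> \<open>The approximant need not be centred, but its mean is within \<open>e\<close> of
    that of \<open>f\<close>, which is zero. Centring it costs another \<open>e\<close>, whence
    \<open>2 * e\<close>; the factor \<open>1 + \<rho>\<close> collects the error under
    \<open>T\<close> and the error in the norm of the approximant.\<close>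
  have approx: "L2_norm M (T f) \<le> \<rho> * L2_norm M f + (1 + \<rho>) * (2 * e)" if e: "0 < e" for e
  proof -
    \<comment> \<open>Half of \<open>e\<^sup>2\<close> for each component adds up to a complex error
      of norm at most \<open>e\<close>.\<close>
    have e2: "0 < e\<^sup>2 / 2" using e by simp
    obtain g1 where g1: "g1 \<in> D" "(\<integral>\<^sup>+x. ennreal ((Re (f x) - g1 x)\<^sup>2) \<partial>M) < ennreal (e\<^sup>2 / 2)"
      using dense[OF _ L2_Re_Im(1)[OF f] e2] by auto
    obtain g2 where g2: "g2 \<in> D" "(\<integral>\<^sup>+x. ennreal ((Im (f x) - g2 x)\<^sup>2) \<partial>M) < ennreal (e\<^sup>2 / 2)"
      using dense[OF _ L2_Re_Im(2)[OF f] e2] by auto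
    have gb: "g1 \<in> bounded_functions" "g2 \<in> bounded_functions" using g1 g2 D by auto
    have [measurable]: "g1 \<in> borel_measurable M" "g2 \<in> borel_measurable M"
      using gb by (auto simp: bounded_functions_def)
    define g where "g x = Complex (g1 x) (g2 x)" for x
    have g_eq: "g = (\<lambda>x. complex_of_real (g1 x) + \<i> * complex_of_real (g2 x))"
      by (simp add: g_def fun_eq_iff complex_eq_iff)
    have [measurable]: "g \<in> borel_measurable M" unfolding g_eq by measurable
    have "(\<integral>\<^sup>+x. ennreal ((cmod (f x - g x))\<^sup>2) \<partial>M) =
       (\<integral>\<^sup>+x. ennreal ((Re (f x) - g1 x)\<^sup>2) \<partial>M) + (\<integral>\<^sup>+x. ennreal ((Im (f x) - g2 x)\<^sup>2) \<partial>M)"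
      by (subst nn_integral_add[symmetric]) (auto simp: cmod_power2 g_def intro!: nn_integral_cong)
    also have "\<dots> \<le> ennreal (e\<^sup>2 / 2) + ennreal (e\<^sup>2 / 2)"
      using g1(2) g2(2) by (intro add_mono) auto
    also have "\<dots> = ennreal (e\<^sup>2)" by (simp add: ennreal_plus[symmetric] del: ennreal_plus)
    finally have le: "(\<integral>\<^sup>+x. ennreal ((cmod (f x - g x))\<^sup>2) \<partial>M) \<le> ennreal (e\<^sup>2)" .
    have fg: "(\<lambda>x. f x - g x) \<in> L2 M" "L2_norm M (\<lambda>x. f x - g x) \<le> e"
      using L2_bounded_by[OF _ _ le] e by simp_all
    have g: "g \<in> L2 M" using L2_diff(1)[OF f fg(1)] by simp
    define m where "m = (\<integral>x. g x \<partial>M)"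
    define g0 where "g0 x = g x - m" for x
    have g0: "g0 \<in> L2 M" unfolding g0_def using L2_diff(1)[OF g L2_const(1)] .
    have i12: "integrable M g1" "integrable M g2" using gb by (auto intro: bounded_functions_integrable)
    have g_Re: "Re (g x) = g1 x" and g_Im: "Im (g x) = g2 x" for x by (simp_all add: g_def)
    have m_eq: "m = Complex (\<integral>x. g1 x \<partial>M) (\<integral>x. g2 x \<partial>M)"
    proof (rule complex_eqI)
      show "Re m = Re (Complex (\<integral>x. g1 x \<partial>M) (\<integral>x. g2 x \<partial>M))"
        using integral_Re[OF L2_integrable[OF g]] by (simp add: m_def g_Re)
      show "Im m = Im (Complex (\<integral>x. g1 x \<partial>M) (\<integral>x. g2 x \<partial>M))"
        using integral_Im[OF L2_integrable[OF g]] by (simp add: m_def g_Im)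
    qed
    have g0_Re: "Re (g0 x) = g1 x - (\<integral>y. g1 y \<partial>M)" and g0_Im: "Im (g0 x) = g2 x - (\<integral>y. g2 y \<partial>M)" for x
      by (simp_all add: g0_def g_Re g_Im m_eq)
    have reT: "AE x in M. Re (T g0 x) = TR (\<lambda>x. g1 x - (\<integral>y. g1 y \<partial>M)) x"
      and imT: "AE x in M. Im (T g0 x) = TR (\<lambda>x. g2 x - (\<integral>y. g2 y \<partial>M)) x"
      using AE_kernel_integrable[OF L2_integrable[OF g0]]
      by (eventually_elim, simp add: markov_operator_def g0_Re[symmetric] g0_Im[symmetric])+
    note [measurable] = L2_measurable[OF g0]
    have "(L2_norm M (T g0))\<^sup>2 = (\<integral>x. (Re (T g0 x))\<^sup>2 \<partial>M) + (\<integral>x. (Im (T g0 x))\<^sup>2 \<partial>M)"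
      by (rule L2_Re_Im(3)[OF T_L2(1)[OF g0]])
    also have "(\<integral>x. (Re (T g0 x))\<^sup>2 \<partial>M) = (\<integral>x. (TR (\<lambda>x. g1 x - (\<integral>y. g1 y \<partial>M)) x)\<^sup>2 \<partial>M)"
      using reT by (intro integral_cong_AE) auto
    also have "(\<integral>x. (Im (T g0 x))\<^sup>2 \<partial>M) = (\<integral>x. (TR (\<lambda>x. g2 x - (\<integral>y. g2 y \<partial>M)) x)\<^sup>2 \<partial>M)"
      using imT by (intro integral_cong_AE) auto
    also have "(\<integral>x. (TR (\<lambda>x. g1 x - (\<integral>y. g1 y \<partial>M)) x)\<^sup>2 \<partial>M) + (\<integral>x. (TR (\<lambda>x. g2 x - (\<integral>y. g2 y \<partial>M)) x)\<^sup>2 \<partial>M)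
       \<le> \<rho>\<^sup>2 * (\<integral>x. (g1 x - (\<integral>y. g1 y \<partial>M))\<^sup>2 \<partial>M) + \<rho>\<^sup>2 * (\<integral>x. (g2 x - (\<integral>y. g2 y \<partial>M))\<^sup>2 \<partial>M)"
      by (intro add_mono contr g1 g2)
    also have "\<dots> = (\<rho> * L2_norm M g0)\<^sup>2"
      by (simp add: L2_Re_Im(3)[OF g0] g0_Re g0_Im power_mult_distrib distrib_left)
    finally have Tg0: "L2_norm M (T g0) \<le> \<rho> * L2_norm M g0"
      by (rule power2_le_imp_le) (use \<rho> in simp)
    have "cmod m = cmod (\<integral>x. f x - g x \<partial>M)"
      using L2_integrable[OF f] L2_integrable[OF g] by (simp add: f0 m_def)
    also have "\<dots> \<le> e" using norm_integral_le_L2_norm[OF fg(1)] fg(2) by simp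
    finally have m_le: "cmod m \<le> e" .
    have fg0: "(\<lambda>x. f x - g0 x) \<in> L2 M" "L2_norm M (\<lambda>x. f x - g0 x) \<le> 2 * e"
      using L2_add[OF fg(1) L2_const(1)[of m]] fg(2) m_le by (auto simp: g0_def algebra_simps)
    have "AE x in M. T f x = T (\<lambda>x. f x - g0 x) x + T g0 x"
      using T_diff[OF f g0] by eventually_elim simp
    then have "L2_norm M (T f) = L2_norm M (\<lambda>x. T (\<lambda>x. f x - g0 x) x + T g0 x)"
      by (intro L2_norm_cong_AE) auto
    also have "\<dots> \<le> L2_norm M (T (\<lambda>x. f x - g0 x)) + L2_norm M (T g0)"
      by (intro L2_add T_L2 fg0 g0)
    also have "\<dots> \<le> 2 * e + \<rho> * L2_norm M g0"
      using T_L2(2)[OF fg0(1)] fg0(2) Tg0 by linarith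
    also have "\<rho> * L2_norm M g0 \<le> \<rho> * (L2_norm M f + 2 * e)"
      using L2_diff(2)[OF f fg0(1)] fg0(2) \<rho> by (intro mult_left_mono) auto
    finally show ?thesis by (simp add: algebra_simps)
  qed
  show "L2_norm M (T f) \<le> \<rho> * L2_norm M f"
  proof (rule field_le_epsilon)
    fix d :: real assume "0 < d"
    define e where "e = d / (2 * (1 + \<rho>))"
    have "0 < e" "(1 + \<rho>) * (2 * e) = d" using \<open>0 < d\<close> \<rho> by (simp_all add: e_def field_simps)
    then show "L2_norm M (T f) \<le> \<rho> * L2_norm M f + d"
      using approx[of e] by simp
  qed
qed

end

section \<open>Powers of the interdependence matrix\<close>

lemma glauber_matrix_carrier[simp]: "A \<in> carrier_mat N N \<Longrightarrow> glauber_matrix N A \<in> carrier_mat N N"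
  by (simp add: glauber_matrix_def)

lemma glauber_matrix_index:
  assumes "A \<in> carrier_mat N N" "i < N" "j < N"
  shows "glauber_matrix N A $$ (i, j) = ((real N - 1) / real N) * (if i = j then 1 else 0) + A $$ (i, j) / real N"
  using assms by (auto simp: glauber_matrix_def)

lemma mat_mult_index_sum:
  assumes "A \<in> carrier_mat n n" "B \<in> carrier_mat n n" "i < n" "j < n"
  shows "(A * B) $$ (i, j) = (\<Sum>k<n. A $$ (i, k) * B $$ (k, j))"
  using assms by (auto simp: scalar_prod_def lessThan_atLeast0 intro!: sum.cong)

text \<open>Powers are defined by multiplication on the right, whereas the bound on expected
  distances advances by multiplication on the left.\<close>

lemma pow_mat_Suc_left:
  fixes A :: "'a::semiring_1 mat"
  assumes A: "A \<in> carrier_mat n n"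
  shows "A ^\<^sub>m Suc k = A * A ^\<^sub>m k"
proof (induction k)
  case 0
  show ?case using A by simp
next
  case (Suc k)
  have "A ^\<^sub>m Suc (Suc k) = (A * A ^\<^sub>m k) * A" using Suc by simp
  also have "\<dots> = A * (A ^\<^sub>m k * A)"
    using A pow_carrier_mat[OF A, of k] by (intro assoc_mult_mat[of _ n n _ n _ n])
  finally show ?case by simp
qed

lemma col_sum_le_mat_l1_norm:
  assumes A: "A \<in> carrier_mat n n" and j: "j < n"
  shows "(\<Sum>i<n. \<bar>A $$ (i, j)\<bar>) \<le> mat_l1_norm A"
  using mat_l1_norm_eq_max_column_sum[OF A] j by (simp add: Max_ge)

section \<open>Spectral radius and growth of powers\<close>

lemma pow_smult_mat:
  fixes A :: "complex mat"
  assumes A: "A \<in> carrier_mat n n"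
  shows "(c \<cdot>\<^sub>m A) ^\<^sub>m k = c ^ k \<cdot>\<^sub>m (A ^\<^sub>m k)"
proof (induction k)
  case 0
  show ?case using A by (intro eq_matI) auto
next
  case (Suc k)
  have "(c \<cdot>\<^sub>m A) ^\<^sub>m Suc k = (c ^ k \<cdot>\<^sub>m (A ^\<^sub>m k)) * (c \<cdot>\<^sub>m A)" using Suc by simp
  also have "\<dots> = c ^ k \<cdot>\<^sub>m (c \<cdot>\<^sub>m (A ^\<^sub>m k * A))"
    using A pow_carrier_mat[OF A, of k]
    by (simp add: mult_smult_assoc_mat[of _ n n] mult_smult_distrib[of _ n n])
      (rule eq_matI; auto simp: mult.left_commute)
  also have "\<dots> = c ^ Suc k \<cdot>\<^sub>m (A ^\<^sub>m Suc k)"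
    using A by (intro eq_matI) (auto simp: mult.assoc mult.left_commute)
  finally show ?case .
qed

lemma eigenvalue_norm_le_spectral_radius:
  assumes A: "A \<in> carrier_mat n n" and ev: "eigenvalue A a"
  shows "cmod a \<le> spectral_radius A"
proof -
  have "n \<noteq> 0"
    using ev A by (auto simp: eigenvalue_def eigenvector_def)
  then show ?thesis using spectral_radius_mem_max(2)[OF A, of "cmod a"] ev by (auto simp: spectrum_def)
qed

lemma spectral_radius_eigenvector:
  assumes A: "A \<in> carrier_mat n n" and n: "n > 0"
  obtains v a where "v \<in> carrier_vec n" "v \<noteq> 0\<^sub>v n" "A *\<^sub>v v = a \<cdot>\<^sub>v v" "cmod a = spectral_radius A"
  using spectral_radius_mem_max(1)[OF A n] A by (force simp: spectrum_def eigenvalue_def eigenvector_def)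

lemma eigenvalueI:
  assumes "A \<in> carrier_mat n n" "v \<in> carrier_vec n" "v \<noteq> 0\<^sub>v n" "A *\<^sub>v v = a \<cdot>\<^sub>v v"
  shows "eigenvalue A a"
  using assms by (auto simp: eigenvalue_def eigenvector_def)

text \<open>Division by \<open>\<rho>\<close> brings the spectral radius below 1, and powers of such
  a matrix have bounded entries by its Jordan normal form; scaling back gives
  \<open>\<rho> ^ k\<close>. The strict inequality absorbs the polynomial factors of nontrivial
  Jordan blocks.\<close>

lemma pow_mat_entries_bound:
  fixes B :: "real mat"
  assumes B: "B \<in> carrier_mat n n" and n: "n > 0" and \<rho>: "real_spectral_radius B < \<rho>"
  shows "\<exists>c\<ge>0. \<forall>k i j. i < n \<longrightarrow> j < n \<longrightarrow> \<bar>(B ^\<^sub>m k) $$ (i, j)\<bar> \<le> c * \<rho> ^ k"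
proof -
  let ?B = "map_mat complex_of_real B"
  have Bc: "?B \<in> carrier_mat n n" using B by simp
  have \<rho>0: "0 < \<rho>"
    using \<rho> spectral_radius_eigenvector[OF Bc n] norm_ge_zero by (metis le_less_trans)
  define r where "r = complex_of_real (1 / \<rho>)"
  have r: "r \<noteq> 0" "cmod r = 1 / \<rho>" using \<rho>0 by (auto simp: r_def norm_divide)
  have C: "r \<cdot>\<^sub>m ?B \<in> carrier_mat n n" using Bc by simp
  obtain v a where v: "v \<in> carrier_vec n" "v \<noteq> 0\<^sub>v n" "(r \<cdot>\<^sub>m ?B) *\<^sub>v v = a \<cdot>\<^sub>v v"
    and a: "cmod a = spectral_radius (r \<cdot>\<^sub>m ?B)"
    using spectral_radius_eigenvector[OF C n] .
  have "?B *\<^sub>v v = (a / r) \<cdot>\<^sub>v v"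
  proof (rule eq_vecI)
    fix i assume "i < dim_vec ((a / r) \<cdot>\<^sub>v v)"
    then have i: "i < n" using v by simp
    have "((r \<cdot>\<^sub>m ?B) *\<^sub>v v) $ i = a * v $ i" using v i by simp
    moreover have "((r \<cdot>\<^sub>m ?B) *\<^sub>v v) $ i = r * (?B *\<^sub>v v) $ i"
      using Bc v(1) i by (simp add: scalar_prod_def sum_distrib_left mult.assoc)
    ultimately show "(?B *\<^sub>v v) $ i = ((a / r) \<cdot>\<^sub>v v) $ i" using r v(1) i by (simp add: field_simps)
  qed (use Bc v in auto)
  from eigenvalue_norm_le_spectral_radius[OF Bc eigenvalueI[OF Bc v(1,2) this]]
  have "cmod a * \<rho> \<le> spectral_radius ?B" using r by (simp add: norm_divide)
  then have "cmod a * \<rho> < \<rho>" using \<rho> by simp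
  then have "spectral_radius (r \<cdot>\<^sub>m ?B) < 1" using \<rho>0 by (simp add: a[symmetric])
  from spectral_radius_jnf_norm_bound_less_1_upper_triangular[OF C this]
  obtain c where c: "\<And>k. norm_bound ((r \<cdot>\<^sub>m ?B) ^\<^sub>m k) c" by blast
  have bound: "\<bar>(B ^\<^sub>m k) $$ (i, j)\<bar> \<le> c * \<rho> ^ k" if ij: "i < n" "j < n" for k i j
  proof -
    have "(r \<cdot>\<^sub>m ?B) ^\<^sub>m k = r ^ k \<cdot>\<^sub>m map_mat complex_of_real (B ^\<^sub>m k)"
    proof -
      have "map_mat complex_of_real (B ^\<^sub>m k) = ?B ^\<^sub>m k" by (rule of_real_hom.mat_hom_pow[OF B])
      then show ?thesis using pow_smult_mat[OF Bc, of r k] by simp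
    qed
    moreover have "B ^\<^sub>m k \<in> carrier_mat n n" using B by (rule pow_carrier_mat)
    ultimately have "cmod (r ^ k * complex_of_real ((B ^\<^sub>m k) $$ (i, j))) \<le> c"
      using c[of k] ij carrier_matD[OF B] by (auto simp: norm_bound_def)
    then have "\<bar>(B ^\<^sub>m k) $$ (i, j)\<bar> / \<rho> ^ k \<le> c"
      by (simp add: norm_mult norm_power r power_divide)
    then show ?thesis using \<rho>0 by (simp add: field_simps)
  qed
  have "0 \<le> c" using order_trans[OF abs_ge_zero bound[OF n n, of 0]] by simp
  with bound show ?thesis by blast
qed

lemma real_spectral_radius_nonneg:
  assumes "B \<in> carrier_mat n n" "n > 0" shows "0 \<le> real_spectral_radius B"
proof -
  have "map_mat complex_of_real B \<in> carrier_mat n n" using assms by simp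
  from spectral_radius_eigenvector[OF this assms(2)] show ?thesis by (metis norm_ge_zero)
qed

text \<open>The two matrices share eigenvectors: an eigenvalue \<open>b\<close> of
  \<open>glauber_matrix N A\<close> belongs to the eigenvalue \<open>N * b - (N - 1)\<close> of
  \<open>A\<close>. For \<open>b\<close> of maximal modulus the triangle inequality gives the
  claim.\<close>

lemma glauber_matrix_spectral_radius:
  assumes A: "A \<in> carrier_mat N N" and N: "N \<ge> 1"
  shows "(1 - real_spectral_radius A) / real N \<le> 1 - real_spectral_radius (glauber_matrix N A)"
proof -
  let ?A = "map_mat complex_of_real A" and ?B = "map_mat complex_of_real (glauber_matrix N A)"
  have Ac: "?A \<in> carrier_mat N N" and Bc: "?B \<in> carrier_mat N N" using A by simp_all
  have N0: "N > 0" using N by simp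
  obtain v b where v: "v \<in> carrier_vec N" "v \<noteq> 0\<^sub>v N" "?B *\<^sub>v v = b \<cdot>\<^sub>v v"
    and b: "cmod b = spectral_radius ?B"
    using spectral_radius_eigenvector[OF Bc N0] .
  let ?a = "of_nat N * b - (of_nat N - 1)"
  have "?A *\<^sub>v v = ?a \<cdot>\<^sub>v v"
  proof (rule eq_vecI)
    fix i assume "i < dim_vec (?a \<cdot>\<^sub>v v)"
    then have i: "i < N" using v by simp
    have "b * v $ i = (?B *\<^sub>v v) $ i" using v i by simp
    also have "\<dots> = (\<Sum>j<N. complex_of_real (glauber_matrix N A $$ (i, j)) * v $ j)"
      using carrier_matD[OF glauber_matrix_carrier[OF A]] v(1) i
      by (auto simp: scalar_prod_def lessThan_atLeast0 intro!: sum.cong)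
    also have "\<dots> = (\<Sum>j<N. (of_nat N - 1) / of_nat N * (if i = j then v $ j else 0)
        + complex_of_real (A $$ (i, j)) * v $ j / of_nat N)"
      using i by (intro sum.cong refl) (auto simp: glauber_matrix_index[OF A] algebra_simps)
    also have "\<dots> = (of_nat N - 1) / of_nat N * v $ i + (\<Sum>j<N. complex_of_real (A $$ (i, j)) * v $ j) / of_nat N"
      using i by (simp add: sum.distrib sum_distrib_left[symmetric] sum_divide_distrib[symmetric])
    also have "(\<Sum>j<N. complex_of_real (A $$ (i, j)) * v $ j) = (?A *\<^sub>v v) $ i"
      using Ac v(1) i A by (auto simp: scalar_prod_def lessThan_atLeast0 intro!: sum.cong)
    finally have "of_nat N * (b * v $ i) = (of_nat N - 1) * v $ i + (?A *\<^sub>v v) $ i"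
      using N0 by (simp add: field_simps)
    then show "(?A *\<^sub>v v) $ i = (?a \<cdot>\<^sub>v v) $ i" using v(1) i by (simp add: algebra_simps)
  qed (use Ac v in auto)
  from eigenvalue_norm_le_spectral_radius[OF Ac eigenvalueI[OF Ac v(1,2) this]]
  have "cmod ?a \<le> real_spectral_radius A" .
  moreover have "cmod (of_nat N * b) \<le> cmod ?a + cmod (of_nat N - 1)"
    using norm_triangle_ineq[of ?a "of_nat N - 1"] by simp
  moreover have "cmod (of_nat N - 1) = real N - 1"
  proof -
    have "(of_nat N - 1 :: complex) = of_real (real N - 1)" by simp
    then show ?thesis using N by (simp only: norm_of_real)
  qed
  ultimately have "real N * real_spectral_radius (glauber_matrix N A) \<le> real_spectral_radius A + (real N - 1)"
    by (simp add: norm_mult b)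
  then show ?thesis using N by (simp add: field_simps)
qed

section \<open>Lipschitz functions of bounded support\<close>

lemma sum_dist_nonneg: "0 \<le> sum_dist N x y"
  by (auto simp: sum_dist_def intro!: sum_nonneg)

lemma sum_dist_commute: "sum_dist N x y = sum_dist N y x"
  by (simp add: sum_dist_def dist_commute)

lemma sum_dist_triangle: "sum_dist N x z \<le> sum_dist N x y + sum_dist N y z"
  unfolding sum_dist_def sum.distrib[symmetric] by (intro sum_mono dist_triangle)

lemma sum_dist_self[simp]: "sum_dist N x x = 0"
  by (simp add: sum_dist_def)

text \<open>Lipschitz continuity feeds the contraction of Lipschitz constants, boundedness gives
  integrability and dominated convergence, and bounded support compensates for moments of the
  stationary measure that may be infinite.\<close>

definition test_functions :: "nat \<Rightarrow> (nat \<Rightarrow> 'l::polish_space) \<Rightarrow> ((nat \<Rightarrow> 'l) \<Rightarrow> real) set" where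
  "test_functions N x0 = {g \<in> borel_measurable (Omega N).
     (\<exists>B. \<forall>x\<in>space (Omega N). \<bar>g x\<bar> \<le> B) \<and>
     (\<exists>L\<ge>0. \<forall>x\<in>space (Omega N). \<forall>y\<in>space (Omega N). \<bar>g x - g y\<bar> \<le> L * sum_dist N x y) \<and>
     (\<exists>R. \<forall>x\<in>space (Omega N). R < sum_dist N x0 x \<longrightarrow> g x = 0)}"

lemma test_functions_scale:
  assumes "g \<in> test_functions N x0" shows "(\<lambda>x. c * g x) \<in> test_functions N x0"
proof -
  from assms obtain B L R where [measurable]: "g \<in> borel_measurable (Omega N)"
    and B: "\<And>x. x \<in> space (Omega N) \<Longrightarrow> \<bar>g x\<bar> \<le> B"
    and L: "0 \<le> L" "\<And>x y. x \<in> space (Omega N) \<Longrightarrow> y \<in> space (Omega N) \<Longrightarrow> \<bar>g x - g y\<bar> \<le> L * sum_dist N x y"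
    and R: "\<And>x. x \<in> space (Omega N) \<Longrightarrow> R < sum_dist N x0 x \<Longrightarrow> g x = 0"
    unfolding test_functions_def by blast
  have "\<bar>c * g x\<bar> \<le> \<bar>c\<bar> * B" if "x \<in> space (Omega N)" for x
    using B[OF that] by (simp add: abs_mult mult_left_mono)
  moreover have "\<bar>c * g x - c * g y\<bar> \<le> \<bar>c\<bar> * L * sum_dist N x y" if "x \<in> space (Omega N)" "y \<in> space (Omega N)" for x y
    using mult_left_mono[OF L(2)[OF that], of "\<bar>c\<bar>"] by (simp add: abs_mult right_diff_distrib[symmetric] mult.assoc)
  moreover have "0 \<le> \<bar>c\<bar> * L" using L(1) by simp
  moreover have "c * g x = 0" if "x \<in> space (Omega N)" "R < sum_dist N x0 x" for x using R[OF that] by simp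
  ultimately show ?thesis unfolding test_functions_def by (simp, blast)
qed

lemma test_functions_add:
  assumes "g \<in> test_functions N x0" "h \<in> test_functions N x0"
  shows "(\<lambda>x. g x + h x) \<in> test_functions N x0"
proof -
  from assms(1) obtain B L R where [measurable]: "g \<in> borel_measurable (Omega N)"
    and B: "\<And>x. x \<in> space (Omega N) \<Longrightarrow> \<bar>g x\<bar> \<le> B"
    and L: "0 \<le> L" "\<And>x y. x \<in> space (Omega N) \<Longrightarrow> y \<in> space (Omega N) \<Longrightarrow> \<bar>g x - g y\<bar> \<le> L * sum_dist N x y"
    and R: "\<And>x. x \<in> space (Omega N) \<Longrightarrow> R < sum_dist N x0 x \<Longrightarrow> g x = 0"
    unfolding test_functions_def by blast
  from assms(2) obtain B' L' R' where [measurable]: "h \<in> borel_measurable (Omega N)"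
    and B': "\<And>x. x \<in> space (Omega N) \<Longrightarrow> \<bar>h x\<bar> \<le> B'"
    and L': "0 \<le> L'" "\<And>x y. x \<in> space (Omega N) \<Longrightarrow> y \<in> space (Omega N) \<Longrightarrow> \<bar>h x - h y\<bar> \<le> L' * sum_dist N x y"
    and R': "\<And>x. x \<in> space (Omega N) \<Longrightarrow> R' < sum_dist N x0 x \<Longrightarrow> h x = 0"
    unfolding test_functions_def by blast
  have "\<bar>g x + h x\<bar> \<le> B + B'" if "x \<in> space (Omega N)" for x
    using B[OF that] B'[OF that] by linarith
  moreover have "\<bar>(g x + h x) - (g y + h y)\<bar> \<le> (L + L') * sum_dist N x y" if "x \<in> space (Omega N)" "y \<in> space (Omega N)" for x y
    using L(2)[OF that] L'(2)[OF that] unfolding distrib_right by linarith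
  moreover have "0 \<le> L + L'" using L(1) L'(1) by simp
  moreover have "g x + h x = 0" if "x \<in> space (Omega N)" "max R R' < sum_dist N x0 x" for x
    using R[OF that(1)] R'[OF that(1)] that(2) by simp
  ultimately show ?thesis unfolding test_functions_def by (simp, blast)
qed

lemma test_functions_0: "(\<lambda>_. 0) \<in> test_functions N x0"
  unfolding test_functions_def by (auto intro!: exI[of _ 0])

text \<open>The term \<open>real n * infdist t (C i)\<close> sharpens towards the indicator of
  \<open>C i\<close>; the term \<open>dist (x0 i) t / (real n + 1)\<close> truncates at radius
  \<open>real n + 1\<close> and dies out in the limit. A product of functions with values in the
  unit interval inherits their common Lipschitz constant for the sum metric.\<close>

lemma clipped_product_test_function:
  fixes C :: "nat \<Rightarrow> 'l::polish_space set" and x0 :: "nat \<Rightarrow> 'l"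
  defines "\<psi> \<equiv> \<lambda>n i t. max 0 (1 - (real n * infdist t (C i) + dist (x0 i) t / (real n + 1)))"
  shows "(\<lambda>x. \<Prod>i<N. \<psi> n i (x i)) \<in> test_functions N x0"
proof -
  have [measurable]: "(\<lambda>t. infdist t (C i)) \<in> borel_measurable borel" for i
    by (intro borel_measurable_continuous_onI continuous_intros)
  have \<psi>_bound: "0 \<le> \<psi> n i t" "\<psi> n i t \<le> 1" for i t
  proof -
    have "0 \<le> real n * infdist t (C i) + dist (x0 i) t / (real n + 1)"
      by (intro add_nonneg_nonneg mult_nonneg_nonneg infdist_nonneg divide_nonneg_nonneg) auto
    then show "0 \<le> \<psi> n i t" "\<psi> n i t \<le> 1" unfolding \<psi>_def by linarith+
  qed
  have \<psi>_lip: "\<bar>\<psi> n i s - \<psi> n i t\<bar> \<le> (real n + 1) * dist s t" for i s t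
  proof -
    let ?u = "\<lambda>t. real n * infdist t (C i) + dist (x0 i) t / (real n + 1)"
    have 1: "\<bar>real n * (infdist s (C i) - infdist t (C i))\<bar> \<le> real n * dist s t"
      unfolding abs_mult using infdist_triangle_abs[of s "C i" t] by (simp add: mult_left_mono)
    have "\<bar>dist (x0 i) s - dist (x0 i) t\<bar> \<le> dist s t" by metric
    moreover have "\<bar>dist (x0 i) s - dist (x0 i) t\<bar> / (real n + 1) \<le> \<bar>dist (x0 i) s - dist (x0 i) t\<bar> / 1"
      by (intro divide_left_mono) auto
    ultimately have 2: "\<bar>(dist (x0 i) s - dist (x0 i) t) / (real n + 1)\<bar> \<le> dist s t" by simp
    have "\<bar>\<psi> n i s - \<psi> n i t\<bar> \<le> \<bar>?u s - ?u t\<bar>" unfolding \<psi>_def by linarith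
    also have "\<dots> = \<bar>real n * (infdist s (C i) - infdist t (C i)) + (dist (x0 i) s - dist (x0 i) t) / (real n + 1)\<bar>"
      by (simp add: right_diff_distrib diff_divide_distrib)
    also have "\<dots> \<le> real n * dist s t + dist s t" using 1 2 by linarith
    finally show ?thesis by (simp add: algebra_simps)
  qed
  let ?g = "\<lambda>x. \<Prod>i<N. \<psi> n i (x i)"
  have "?g \<in> borel_measurable (Omega N)" unfolding \<psi>_def by measurable
  moreover have "\<bar>?g x\<bar> \<le> 1" for x
    using \<psi>_bound by (simp add: abs_prod prod_le_1)
  moreover have "\<bar>?g x - ?g y\<bar> \<le> (real n + 1) * sum_dist N x y" for x y
  proof -
    have "\<bar>?g x - ?g y\<bar> \<le> (\<Sum>i<N. \<bar>\<psi> n i (x i) - \<psi> n i (y i)\<bar>)"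
      using norm_prod_diff[of "{..<N}" "\<lambda>i. \<psi> n i (x i)" "\<lambda>i. \<psi> n i (y i)"] \<psi>_bound by simp
    also have "\<dots> \<le> (\<Sum>i<N. (real n + 1) * dist (x i) (y i))" by (intro sum_mono \<psi>_lip)
    finally show ?thesis by (simp add: sum_dist_def sum_distrib_left)
  qed
  \<comment> \<open>Beyond total distance \<open>N * (n + 1)\<close> some coordinate is farther than
    \<open>n + 1\<close> from that of \<open>x0\<close>, and its factor vanishes.\<close>
  moreover have "?g x = 0" if x: "real N * (real n + 1) < sum_dist N x0 x" for x
  proof -
    have "\<exists>i<N. real n + 1 < dist (x0 i) (x i)"
    proof (rule ccontr)
      assume "\<not> ?thesis"
      then have "dist (x0 i) (x i) \<le> real n + 1" if "i < N" for i
        using that by (auto simp: not_less dest: spec[of _ i])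
      then have "sum_dist N x0 x \<le> (\<Sum>i<N. real n + 1)"
        unfolding sum_dist_def by (intro sum_mono) auto
      with x show False by simp
    qed
    then obtain i where i: "i < N" "real n + 1 < dist (x0 i) (x i)" by blast
    have "1 < dist (x0 i) (x i) / (real n + 1)" using i(2) by simp
    moreover have "0 \<le> real n * infdist (x i) (C i)" by (simp add: infdist_nonneg)
    ultimately have "\<psi> n i (x i) = 0" unfolding \<psi>_def by linarith
    with i(1) show ?thesis by auto
  qed
  moreover have "0 \<le> real n + 1" by simp
  ultimately show ?thesis unfolding test_functions_def by (simp, blast)
qed

text \<open>Closedness makes \<open>infdist\<close> positive off \<open>C i\<close>, so the factor
  is eventually zero there. Nonemptiness matters: the distance to the empty set is 0 by convention,
  and the factor would tend to 1.\<close>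

lemma closed_rectangle_limit:
  fixes C :: "nat \<Rightarrow> 'l::polish_space set" and x0 :: "nat \<Rightarrow> 'l"
  defines "\<psi> \<equiv> \<lambda>n i t. max 0 (1 - (real n * infdist t (C i) + dist (x0 i) t / (real n + 1)))"
  assumes C: "\<And>i. i < N \<Longrightarrow> closed (C i)" "\<And>i. i < N \<Longrightarrow> C i \<noteq> {}" and x: "x \<in> space (Omega N)"
  shows "(\<lambda>n. \<Prod>i<N. \<psi> n i (x i)) \<longlonglongrightarrow> indicator (Pi\<^sub>E {..<N} C) x"
proof -
  have "(\<lambda>n. \<psi> n i (x i)) \<longlonglongrightarrow> indicator (C i) (x i)" if i: "i < N" for i
  proof (cases "x i \<in> C i")
    case True
    have "(\<lambda>n. max 0 (1 - (real n * 0 + dist (x0 i) (x i) / (real n + 1)))) \<longlonglongrightarrow> max 0 (1 - (0 + 0))"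
      by (intro tendsto_intros) (simp, real_asymp)
    then show ?thesis using True by (simp add: \<psi>_def)
  next
    case False
    then have pos: "0 < infdist (x i) (C i)"
      using C i by (metis in_closed_iff_infdist_zero infdist_nonneg less_eq_real_def)
    obtain m where m: "1 / infdist (x i) (C i) < real m" using reals_Archimedean2 by blast
    have "\<psi> n i (x i) = 0" if "n \<ge> m" for n
    proof -
      have "1 < real n * infdist (x i) (C i)"
        using m that pos by (simp add: divide_less_eq) (smt (verit) mult_right_mono of_nat_mono)
      moreover have "0 \<le> dist (x0 i) (x i) / (real n + 1)" by simp
      ultimately show ?thesis unfolding \<psi>_def by linarith
    qed
    then have "(\<lambda>n. \<psi> n i (x i)) \<longlonglongrightarrow> 0"
      by (intro tendsto_eventually) (auto simp: eventually_sequentially)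
    with False show ?thesis by simp
  qed
  then have "(\<lambda>n. \<Prod>i<N. \<psi> n i (x i)) \<longlonglongrightarrow> (\<Prod>i<N. indicator (C i) (x i))"
    by (intro tendsto_prod) auto
  also have "(\<Prod>i<N. indicator (C i) (x i)) = (indicator (Pi\<^sub>E {..<N} C) x :: real)"
    using x by (auto simp: indicator_def PiE_iff space_PiM)
  finally show ?thesis .
qed

text \<open>With finitely many coordinates all sides can be prescribed at once. The resulting
  generator is stable under intersection, and its members can be approximated by test
  functions.\<close>

lemma sets_Omega_closed_rectangles:
  "sets (Omega N :: (nat \<Rightarrow> 'l::polish_space) measure) =
     sigma_sets (space (Omega N :: (nat \<Rightarrow> 'l) measure)) {Pi\<^sub>E {..<N} C | C. \<forall>i<N. closed (C i)}"
proof -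
  let ?E = "\<lambda>_::nat. Collect closed :: 'l set set"
  have "sets (Omega N :: (nat \<Rightarrow> 'l) measure) = sets (\<Pi>\<^sub>M i\<in>{..<N}. sigma (UNIV :: 'l set) (Collect closed))"
    by (simp add: borel_eq_closed)
  also have "\<dots> = sets (sigma (\<Pi>\<^sub>E i\<in>{..<N}. UNIV)
     {{f \<in> (\<Pi>\<^sub>E i\<in>{..<N}. UNIV). \<forall>i\<in>j. f i \<in> A i} | A j. j \<in> {{..<N}} \<and> A \<in> Pi j ?E})"
    by (rule sets_PiM_sigma) (auto intro!: exI[of _ "{UNIV}"])
  also have "{{f \<in> (\<Pi>\<^sub>E i\<in>{..<N}. UNIV). \<forall>i\<in>j. f i \<in> A i} | A j. j \<in> {{..<N}} \<and> A \<in> Pi j ?E}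
      = {Pi\<^sub>E {..<N} C | C. \<forall>i<N. closed (C i)}"
  proof -
    have "{f \<in> (\<Pi>\<^sub>E i\<in>{..<N}. UNIV). \<forall>i\<in>{..<N}. f i \<in> A i} = Pi\<^sub>E {..<N} A" for A :: "nat \<Rightarrow> 'l set"
      unfolding PiE_def Pi_def by blast
    moreover have "A \<in> Pi {..<N} ?E \<longleftrightarrow> (\<forall>i<N. closed (A i))" for A :: "nat \<Rightarrow> 'l set"
      unfolding Pi_def by simp
    ultimately show ?thesis by simp
  qed
  also have "sets (sigma (\<Pi>\<^sub>E i\<in>{..<N}. UNIV) {Pi\<^sub>E {..<N} C | C. \<forall>i<N. closed (C i :: 'l set)})
     = sigma_sets (\<Pi>\<^sub>E i\<in>{..<N}. UNIV) {Pi\<^sub>E {..<N} C | C. \<forall>i<N. closed (C i)}"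
    by (rule sets_measure_of) auto
  finally show ?thesis by (simp add: space_PiM)
qed

section \<open>Density of the test functions in L2\<close>

locale dense_test_functions = prob_space \<mu> for \<mu> :: "(nat \<Rightarrow> 'l::polish_space) measure" +
  fixes N :: nat and x0 :: "nat \<Rightarrow> 'l"
  assumes sets_\<mu>: "sets \<mu> = sets (Omega N)"
begin

text \<open>The L2 closure of the test functions, expressed with the nonnegative integral so that no
  integrability has to be carried along.\<close>

definition approximable :: "((nat \<Rightarrow> 'l) \<Rightarrow> real) \<Rightarrow> bool" where
  "approximable u \<longleftrightarrow> (\<forall>\<epsilon>>0. \<exists>g\<in>test_functions N x0. (\<integral>\<^sup>+x. ennreal ((u x - g x)\<^sup>2) \<partial>\<mu>) < ennreal \<epsilon>)"

lemma space_\<mu>: "space \<mu> = space (Omega N)"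
  by (rule sets_eq_imp_space_eq[OF sets_\<mu>])

lemma measurable_test_function: "g \<in> test_functions N x0 \<Longrightarrow> g \<in> borel_measurable \<mu>"
  by (simp add: test_functions_def measurable_cong_sets[OF sets_\<mu> refl])

lemma sq_sum_le: "ennreal ((a + b)\<^sup>2) \<le> 2 * ennreal (a\<^sup>2) + 2 * ennreal (b\<^sup>2)" for a b :: real
proof -
  have "(a + b)\<^sup>2 \<le> 2 * a\<^sup>2 + 2 * b\<^sup>2" using zero_le_power2[of "a - b"] by (simp add: power2_sum power2_diff)
  then have "ennreal ((a + b)\<^sup>2) \<le> ennreal (2 * a\<^sup>2 + 2 * b\<^sup>2)" by (rule ennreal_leI)
  then show ?thesis by (simp add: ennreal_mult)
qed

text \<open>A substitute for the triangle inequality; \<open>\<epsilon> / 4\<close> appears because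
  the square of a sum is at most twice the sum of the squares.\<close>

lemma nn_integral_sq_sum_le:
  fixes a b :: "(nat \<Rightarrow> 'l) \<Rightarrow> real"
  assumes [measurable]: "a \<in> borel_measurable \<mu>" "b \<in> borel_measurable \<mu>"
    and a: "(\<integral>\<^sup>+x. ennreal ((a x)\<^sup>2) \<partial>\<mu>) < ennreal (\<epsilon> / 4)" and b: "(\<integral>\<^sup>+x. ennreal ((b x)\<^sup>2) \<partial>\<mu>) < ennreal (\<epsilon> / 4)"
    and \<epsilon>: "0 < \<epsilon>"
  shows "(\<integral>\<^sup>+x. ennreal ((a x + b x)\<^sup>2) \<partial>\<mu>) < ennreal \<epsilon>"
proof -
  have "(\<integral>\<^sup>+x. ennreal ((a x + b x)\<^sup>2) \<partial>\<mu>) \<le> (\<integral>\<^sup>+x. 2 * ennreal ((a x)\<^sup>2) + 2 * ennreal ((b x)\<^sup>2) \<partial>\<mu>)"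
    by (intro nn_integral_mono sq_sum_le)
  also have "\<dots> = 2 * (\<integral>\<^sup>+x. ennreal ((a x)\<^sup>2) \<partial>\<mu>) + 2 * (\<integral>\<^sup>+x. ennreal ((b x)\<^sup>2) \<partial>\<mu>)"
    by (simp add: nn_integral_add nn_integral_cmult)
  finally have le: "(\<integral>\<^sup>+x. ennreal ((a x + b x)\<^sup>2) \<partial>\<mu>) \<le> \<dots>" .
  obtain r where r: "(\<integral>\<^sup>+x. ennreal ((a x)\<^sup>2) \<partial>\<mu>) = ennreal r" "0 \<le> r"
    using a by (cases "\<integral>\<^sup>+x. ennreal ((a x)\<^sup>2) \<partial>\<mu>") auto
  obtain s where s: "(\<integral>\<^sup>+x. ennreal ((b x)\<^sup>2) \<partial>\<mu>) = ennreal s" "0 \<le> s"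
    using b by (cases "\<integral>\<^sup>+x. ennreal ((b x)\<^sup>2) \<partial>\<mu>") auto
  have "r < \<epsilon> / 4" "s < \<epsilon> / 4" using a b r s \<epsilon> by (auto simp: ennreal_less_iff)
  then have "ennreal (2 * r + 2 * s) < ennreal \<epsilon>" using r s by (intro ennreal_lessI) auto
  moreover have "2 * (\<integral>\<^sup>+x. ennreal ((a x)\<^sup>2) \<partial>\<mu>) + 2 * (\<integral>\<^sup>+x. ennreal ((b x)\<^sup>2) \<partial>\<mu>) = ennreal (2 * r + 2 * s)"
    using r s by (simp add: ennreal_mult)
  ultimately show ?thesis using le by simp
qed

lemma approximable_add:
  assumes u: "approximable u" and v: "approximable v"
    and [measurable]: "u \<in> borel_measurable \<mu>" "v \<in> borel_measurable \<mu>"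
  shows "approximable (\<lambda>x. u x + v x)"
  unfolding approximable_def
proof (intro allI impI)
  fix \<epsilon> :: real assume e: "0 < \<epsilon>"
  then have e4: "0 < \<epsilon> / 4" by simp
  obtain g where g: "g \<in> test_functions N x0" "(\<integral>\<^sup>+x. ennreal ((u x - g x)\<^sup>2) \<partial>\<mu>) < ennreal (\<epsilon> / 4)"
    using u e4 unfolding approximable_def by blast
  obtain h where h: "h \<in> test_functions N x0" "(\<integral>\<^sup>+x. ennreal ((v x - h x)\<^sup>2) \<partial>\<mu>) < ennreal (\<epsilon> / 4)"
    using v e4 unfolding approximable_def by blast
  note [measurable] = measurable_test_function[OF g(1)] measurable_test_function[OF h(1)]
  have "(\<integral>\<^sup>+x. ennreal (((u x - g x) + (v x - h x))\<^sup>2) \<partial>\<mu>) < ennreal \<epsilon>"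
    by (intro nn_integral_sq_sum_le g h e) measurable
  then show "\<exists>g\<in>test_functions N x0. (\<integral>\<^sup>+x. ennreal ((u x + v x - g x)\<^sup>2) \<partial>\<mu>) < ennreal \<epsilon>"
    by (intro bexI[OF _ test_functions_add[OF g(1) h(1)]]) (simp add: algebra_simps)
qed

lemma approximable_limit:
  assumes "u \<in> borel_measurable \<mu>"
    and "\<And>\<epsilon>. 0 < \<epsilon> \<Longrightarrow> \<exists>v. approximable v \<and> v \<in> borel_measurable \<mu> \<and> (\<integral>\<^sup>+x. ennreal ((u x - v x)\<^sup>2) \<partial>\<mu>) < ennreal \<epsilon>"
  shows "approximable u"
  unfolding approximable_def
proof (intro allI impI)
  fix \<epsilon> :: real assume e: "0 < \<epsilon>"
  note [measurable] = assms(1)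
  obtain v where v: "approximable v" and [measurable]: "v \<in> borel_measurable \<mu>"
    and uv: "(\<integral>\<^sup>+x. ennreal ((u x - v x)\<^sup>2) \<partial>\<mu>) < ennreal (\<epsilon> / 4)"
    using assms(2)[of "\<epsilon> / 4"] e by auto
  obtain g where g: "g \<in> test_functions N x0" "(\<integral>\<^sup>+x. ennreal ((v x - g x)\<^sup>2) \<partial>\<mu>) < ennreal (\<epsilon> / 4)"
    using v e unfolding approximable_def by (metis divide_pos_pos zero_less_numeral)
  note [measurable] = measurable_test_function[OF g(1)]
  have "(\<integral>\<^sup>+x. ennreal (((u x - v x) + (v x - g x))\<^sup>2) \<partial>\<mu>) < ennreal \<epsilon>"
    by (intro nn_integral_sq_sum_le g uv e) measurable
  then show "\<exists>g\<in>test_functions N x0. (\<integral>\<^sup>+x. ennreal ((u x - g x)\<^sup>2) \<partial>\<mu>) < ennreal \<epsilon>"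
    by (intro bexI[OF _ g(1)]) simp
qed

lemma approximable_cmult:
  assumes u: "approximable u" and [measurable]: "u \<in> borel_measurable \<mu>"
  shows "approximable (\<lambda>x. c * u x)"
  unfolding approximable_def
proof (intro allI impI)
  fix \<epsilon> :: real assume e: "0 < \<epsilon>"
  \<comment> \<open>Adding 1 to \<open>c\<^sup>2\<close> avoids a division by zero for
    \<open>c = 0\<close>.\<close>
  have "0 < \<epsilon> / (c\<^sup>2 + 1)" using e by (intro divide_pos_pos) (auto simp: add_nonneg_pos)
  then obtain g where g: "g \<in> test_functions N x0" "(\<integral>\<^sup>+x. ennreal ((u x - g x)\<^sup>2) \<partial>\<mu>) < ennreal (\<epsilon> / (c\<^sup>2 + 1))"
    using u unfolding approximable_def by blast
  note [measurable] = measurable_test_function[OF g(1)]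
  obtain r where r: "(\<integral>\<^sup>+x. ennreal ((u x - g x)\<^sup>2) \<partial>\<mu>) = ennreal r" "0 \<le> r"
    using g(2) by (cases "\<integral>\<^sup>+x. ennreal ((u x - g x)\<^sup>2) \<partial>\<mu>") auto
  have "r < \<epsilon> / (c\<^sup>2 + 1)" using g(2) r by (simp add: ennreal_less_iff)
  then have "(c\<^sup>2 + 1) * r < \<epsilon>" 
    using pos_less_divide_eq[of "c\<^sup>2 + 1" r \<epsilon>] by (simp add: add_nonneg_pos mult.commute)
  then have *: "c\<^sup>2 * r < \<epsilon>" using r by (simp add: algebra_simps)
  have "(\<integral>\<^sup>+x. ennreal ((c * u x - c * g x)\<^sup>2) \<partial>\<mu>) = (\<integral>\<^sup>+x. ennreal (c\<^sup>2) * ennreal ((u x - g x)\<^sup>2) \<partial>\<mu>)"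
    by (intro nn_integral_cong) (simp add: ennreal_mult[symmetric] right_diff_distrib[symmetric] power_mult_distrib)
  also have "\<dots> = ennreal (c\<^sup>2 * r)" using r by (simp add: nn_integral_cmult ennreal_mult)
  also have "\<dots> < ennreal \<epsilon>" using * r by (intro ennreal_lessI) (auto intro: e)
  finally show "\<exists>g\<in>test_functions N x0. (\<integral>\<^sup>+x. ennreal ((c * u x - g x)\<^sup>2) \<partial>\<mu>) < ennreal \<epsilon>"
    by (intro bexI[OF _ test_functions_scale[OF g(1)]])
qed

lemma approximable_sequence:
  assumes [measurable]: "\<And>n. v n \<in> borel_measurable \<mu>" "u \<in> borel_measurable \<mu>" "w \<in> borel_measurable \<mu>"
    and appr: "\<And>n. approximable (v n)"
    and lim: "\<And>x. x \<in> space \<mu> \<Longrightarrow> (\<lambda>n. v n x) \<longlonglongrightarrow> u x"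
    and dom: "\<And>n x. x \<in> space \<mu> \<Longrightarrow> (u x - v n x)\<^sup>2 \<le> w x" "(\<integral>\<^sup>+x. ennreal (w x) \<partial>\<mu>) < \<infinity>"
  shows "approximable u"
proof (rule approximable_limit)
  fix \<epsilon> :: real assume e: "0 < \<epsilon>"
  have "(\<lambda>n. \<integral>\<^sup>+x. ennreal ((u x - v n x)\<^sup>2) \<partial>\<mu>) \<longlonglongrightarrow> (\<integral>\<^sup>+x. 0 \<partial>\<mu>)"
  proof (rule nn_integral_dominated_convergence)
    show "(\<integral>\<^sup>+x. ennreal (w x) \<partial>\<mu>) < \<infinity>" by fact
    show "AE x in \<mu>. ennreal ((u x - v n x)\<^sup>2) \<le> ennreal (w x)" for n
      using dom(1) by (intro AE_I2 ennreal_leI)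
    show "AE x in \<mu>. (\<lambda>n. ennreal ((u x - v n x)\<^sup>2)) \<longlonglongrightarrow> 0"
    proof (rule AE_I2)
      fix x assume "x \<in> space \<mu>"
      then have "(\<lambda>n. ennreal ((u x - v n x)\<^sup>2)) \<longlonglongrightarrow> ennreal ((u x - u x)\<^sup>2)"
        by (intro tendsto_ennrealI tendsto_intros lim)
      then show "(\<lambda>n. ennreal ((u x - v n x)\<^sup>2)) \<longlonglongrightarrow> 0" by simp
    qed
  qed measurable
  then have "\<forall>\<^sub>F n in sequentially. (\<integral>\<^sup>+x. ennreal ((u x - v n x)\<^sup>2) \<partial>\<mu>) < ennreal \<epsilon>"
    using e by (intro order_tendstoD) auto
  then obtain n where "(\<integral>\<^sup>+x. ennreal ((u x - v n x)\<^sup>2) \<partial>\<mu>) < ennreal \<epsilon>"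
    by (auto simp: eventually_sequentially)
  then show "\<exists>v. approximable v \<and> v \<in> borel_measurable \<mu> \<and> (\<integral>\<^sup>+x. ennreal ((u x - v x)\<^sup>2) \<partial>\<mu>) < ennreal \<epsilon>"
    using appr[of n] by (intro exI[of _ "v n"]) auto
qed fact

lemma approximable_test_function: "g \<in> test_functions N x0 \<Longrightarrow> approximable g"
  unfolding approximable_def by (auto intro!: bexI[of _ g])

text \<open>Dynkin's argument: the sets with approximable indicator contain the closed rectangles
  and are stable under complements and countable disjoint unions. Disjointness turns a union into a
  sum of indicators, to which additivity and dominated convergence apply.\<close>

lemma approximable_indicator:
  assumes "S \<in> sets \<mu>" shows "approximable (indicator S)"
proof -
  let ?G = "{Pi\<^sub>E {..<N} C | C :: nat \<Rightarrow> 'l set. \<forall>i<N. closed (C i)}"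
  have gen: "sets \<mu> = sigma_sets (space (Omega N)) ?G"
    by (simp add: sets_\<mu> sets_Omega_closed_rectangles)
  have rect: "approximable (indicator S)" if S: "S \<in> ?G" for S
  proof -
    obtain C :: "nat \<Rightarrow> 'l set" where C: "S = Pi\<^sub>E {..<N} C" "\<And>i. i < N \<Longrightarrow> closed (C i)" using S by auto
    show ?thesis
    \<comment> \<open>An empty side is treated apart, because \<open>infdist\<close> does not detect
      the empty set.\<close>
    proof (cases "\<exists>i<N. C i = {}")
      case True
      then have "S = {}" using C(1) by (auto simp: PiE_eq_empty_iff)
      then show ?thesis using approximable_test_function[OF test_functions_0] by (simp add: indicator_def[abs_def])
    next
      case False
      let ?v = "\<lambda>n x. \<Prod>i<N. max 0 (1 - (real n * infdist (x i) (C i) + dist (x0 i) (x i) / (real n + 1)))"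
      have t: "?v n \<in> test_functions N x0" for n by (rule clipped_product_test_function)
      show ?thesis
      proof (rule approximable_sequence[where v="?v" and w="\<lambda>_. 1"])
        show "?v n \<in> borel_measurable \<mu>" for n using t by (rule measurable_test_function)
        show "approximable (?v n)" for n using t by (rule approximable_test_function)
        have "S \<in> sets \<mu>" unfolding gen using S by blast
        then show "indicator S \<in> borel_measurable \<mu>" by simp
        fix x assume "x \<in> space \<mu>"
        then have x: "x \<in> space (Omega N)" by (simp add: space_\<mu>)
        show "(\<lambda>n. ?v n x) \<longlonglongrightarrow> indicator S x"
          unfolding C(1) using False by (intro closed_rectangle_limit C x) auto
        show "(indicator S x - ?v n x)\<^sup>2 \<le> 1" for n
        proof -
          have "0 \<le> ?v n x" by (intro prod_nonneg) auto
          moreover have "?v n x \<le> 1"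
          proof (intro prod_le_1 conjI)
            fix i
            have "0 \<le> real n * infdist (x i) (C i) + dist (x0 i) (x i) / (real n + 1)"
              by (intro add_nonneg_nonneg mult_nonneg_nonneg infdist_nonneg divide_nonneg_nonneg) auto
            then show "max 0 (1 - (real n * infdist (x i) (C i) + dist (x0 i) (x i) / (real n + 1))) \<le> 1"
              by linarith
          qed simp
          ultimately have "\<bar>indicator S x - ?v n x\<bar> \<le> 1" by (auto simp: indicator_def)
          then show ?thesis by (simp add: abs_square_le_1)
        qed
      qed (auto simp: emeasure_space_1)
    qed
  qed
  have int: "Int_stable ?G"
  proof (rule Int_stableI)
    fix a b assume "a \<in> ?G" "b \<in> ?G"
    then obtain C D :: "nat \<Rightarrow> 'l set" where "a = Pi\<^sub>E {..<N} C" "b = Pi\<^sub>E {..<N} D"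
      "\<forall>i<N. closed (C i)" "\<forall>i<N. closed (D i)" by blast
    then show "a \<inter> b \<in> ?G"
      by (auto simp: PiE_Int intro!: exI[of _ "\<lambda>i. C i \<inter> D i"])
  qed
  have sub: "?G \<subseteq> Pow (space (Omega N))" by (auto simp: space_PiM)
  from assms[unfolded gen] show ?thesis
  proof (induction rule: sigma_sets_induct_disjoint[OF int sub, consumes 1, case_names basic empty compl union])
    case (basic S)
    then show ?case by (rule rect)
  next
    case empty
    then show ?case using approximable_test_function[OF test_functions_0] by (simp add: indicator_def[abs_def])
  next
    case (compl S)
    have S: "S \<in> sets \<mu>" using compl(1) by (simp add: gen)
    have univ: "space (Omega N :: (nat \<Rightarrow> 'l) measure) \<in> ?G"
      by (auto simp: space_PiM intro!: exI[of _ "\<lambda>_. UNIV"])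
    have Om: "space (Omega N) \<in> sets \<mu>" using sets.top[of \<mu>] by (simp add: space_\<mu>)
    have "approximable (\<lambda>x. indicator (space (Omega N)) x + (-1) * indicator S x)"
      using S Om by (intro approximable_add approximable_cmult rect[OF univ] compl) auto
    also have "(\<lambda>x. indicator (space (Omega N)) x + (-1) * indicator S x) = (indicator (space (Omega N) - S) :: _ \<Rightarrow> real)"
      using sets.sets_into_space[OF S] by (auto simp: fun_eq_iff indicator_def space_\<mu>)
    finally show ?case .
  next
    case (union S)
    have S: "S i \<in> sets \<mu>" for i using union(2) by (auto simp: gen)
    have part: "approximable (\<lambda>x. \<Sum>i<n. indicator (S i) x)" for n :: nat
    proof (induction n)
      case 0
      show ?case using approximable_test_function[OF test_functions_0] by simp
    next
      case (Suc n)
      have "approximable (\<lambda>x. (\<Sum>i<n. indicator (S i) x) + indicator (S n) x)"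
        using S by (intro approximable_add Suc union) auto
      then show ?case by simp
    qed
    have sum_eq: "(\<Sum>i<n. indicator (S i) x) = (indicator (\<Union>i<n. S i) x :: real)" for n x
      using union(1) by (intro indicator_UN_disjoint[symmetric]) (auto simp: disjoint_family_on_def)
    show ?case
    proof (rule approximable_sequence[where v="\<lambda>n x. \<Sum>i<n. indicator (S i) x" and w="\<lambda>_. 1"])
      show "(\<lambda>n. \<Sum>i<n. indicator (S i) x) \<longlonglongrightarrow> (indicator (\<Union> (range S)) x :: real)" for x
        unfolding sum_eq by (rule LIMSEQ_indicator_UN)
      show "(indicator (\<Union> (range S)) x - (\<Sum>i<n. indicator (S i) x))\<^sup>2 \<le> (1::real)" for n x
        unfolding sum_eq by (auto simp: indicator_def)
    qed (use S part in \<open>auto simp: emeasure_space_1\<close>)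
  qed
qed

text \<open>Square integrability is a premise of every inductive hypothesis and must be handed down
  to the parts. Nonnegativity allows this for sums and monotone limits, and for multiples the case
  \<open>c = 0\<close> is split off.\<close>

lemma approximable_nonneg:
  assumes "u \<in> borel_measurable \<mu>" "\<And>x. 0 \<le> u x" "(\<integral>\<^sup>+x. ennreal ((u x)\<^sup>2) \<partial>\<mu>) < \<infinity>"
  shows "approximable u"
  using assms
proof (induction rule: borel_measurable_induct_real)
  case (set S)
  then show ?case by (intro approximable_indicator)
next
  case (mult u c)
  show ?case
  proof (cases "c = 0")
    case True
    then show ?thesis using approximable_test_function[OF test_functions_0] by simp
  next
    case False
    then have "ennreal ((u x)\<^sup>2) = ennreal (1 / c\<^sup>2) * ennreal ((c * u x)\<^sup>2)" for x
      by (simp add: ennreal_mult[symmetric] power_mult_distrib)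
    then have "(\<integral>\<^sup>+x. ennreal ((u x)\<^sup>2) \<partial>\<mu>) = ennreal (1 / c\<^sup>2) * (\<integral>\<^sup>+x. ennreal ((c * u x)\<^sup>2) \<partial>\<mu>)"
      using mult(2) by (simp add: nn_integral_cmult)
    also have "\<dots> < \<infinity>" using mult.prems by (simp add: ennreal_mult_less_top)
    finally show ?thesis using mult by (intro approximable_cmult) auto
  qed
next
  case (add u v)
  have "(\<integral>\<^sup>+x. ennreal ((u x)\<^sup>2) \<partial>\<mu>) \<le> (\<integral>\<^sup>+x. ennreal ((v x + u x)\<^sup>2) \<partial>\<mu>)"
    using add by (intro nn_integral_mono ennreal_leI power_mono) auto
  moreover have "(\<integral>\<^sup>+x. ennreal ((v x)\<^sup>2) \<partial>\<mu>) \<le> (\<integral>\<^sup>+x. ennreal ((v x + u x)\<^sup>2) \<partial>\<mu>)"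
    using add by (intro nn_integral_mono ennreal_leI power_mono) auto
  ultimately show ?case using add by (intro approximable_add) (auto intro: le_less_trans)
next
  case (seq U)
  have le: "U n x \<le> u x" if "x \<in> space \<mu>" for n x
    using seq.hyps(3) seq.hyps(4)[OF that] by (intro incseq_le) (auto simp: incseq_def le_fun_def)
  show ?case
  proof (rule approximable_sequence[where v=U and w="\<lambda>x. (u x)\<^sup>2"])
    show "approximable (U n)" for n
    proof -
      have "(\<integral>\<^sup>+x. ennreal ((U n x)\<^sup>2) \<partial>\<mu>) \<le> (\<integral>\<^sup>+x. ennreal ((u x)\<^sup>2) \<partial>\<mu>)"
        using le seq.hyps(2) by (intro nn_integral_mono ennreal_leI power_mono) auto
      then show ?thesis using seq.prems by (intro seq.IH) (auto intro: le_less_trans)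
    qed
    show "(u x - U n x)\<^sup>2 \<le> (u x)\<^sup>2" if "x \<in> space \<mu>" for n x
      using le[OF that, of n] seq.hyps(2)[of n x] by (intro power_mono) auto
  qed (use seq assms(1) in auto)
qed

theorem test_functions_dense:
  assumes u[measurable]: "u \<in> borel_measurable \<mu>" and int: "integrable \<mu> (\<lambda>x. (u x)\<^sup>2)" and e: "0 < \<epsilon>"
  shows "\<exists>g\<in>test_functions N x0. (\<integral>\<^sup>+x. ennreal ((u x - g x)\<^sup>2) \<partial>\<mu>) < ennreal \<epsilon>"
proof -
  have fin: "(\<integral>\<^sup>+x. ennreal ((u x)\<^sup>2) \<partial>\<mu>) < \<infinity>"
    using int by (simp add: integrable_iff_bounded)
  have part: "(\<integral>\<^sup>+x. ennreal ((max 0 (c * u x))\<^sup>2) \<partial>\<mu>) < \<infinity>" if "c\<^sup>2 = 1" for c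
  proof (rule le_less_trans[OF nn_integral_mono fin])
    fix x
    have "(max 0 (c * u x))\<^sup>2 \<le> \<bar>c * u x\<bar>\<^sup>2" by (intro power_mono) auto
    then have "(max 0 (c * u x))\<^sup>2 \<le> (c * u x)\<^sup>2" by simp
    then show "ennreal ((max 0 (c * u x))\<^sup>2) \<le> ennreal ((u x)\<^sup>2)"
      using that by (simp add: power_mult_distrib ennreal_leI)
  qed
  have "approximable (\<lambda>x. max 0 (1 * u x) + (-1) * max 0 ((-1) * u x))"
    by (intro approximable_add approximable_cmult approximable_nonneg part) auto
  also have "(\<lambda>x. max 0 (1 * u x) + (-1) * max 0 ((-1) * u x)) = u" by (auto simp: fun_eq_iff max_def)
  finally show ?thesis using e by (auto simp: approximable_def)
qed

end

section \<open>Glauber dynamics\<close>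

lemma space_Omega: "x \<in> space (Omega N) \<longleftrightarrow> x \<in> extensional {..<N}"
  by (simp add: space_PiM PiE_def)

lemma upd_in_space_Omega: "x \<in> space (Omega N) \<Longrightarrow> i < N \<Longrightarrow> x(i := z) \<in> space (Omega N)"
  by (auto simp: space_Omega extensional_def)

lemma drop_coord_upd: "drop_coord N i (x(i := z)) = drop_coord N i x"
  by (auto simp: drop_coord_def)

lemma measurable_drop_coord[measurable]: "drop_coord N i \<in> Omega N \<rightarrow>\<^sub>M Omega_minus N i"
  unfolding drop_coord_def by (rule measurable_restrict_subset) auto

lemma measurable_upd:
  assumes "i < N"
  shows "(\<lambda>(x, z). x(i := z)) \<in> Omega N \<Otimes>\<^sub>M borel \<rightarrow>\<^sub>M (Omega N :: (nat \<Rightarrow> 'l::polish_space) measure)"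
  using measurable_add_dim[of i "{..<N}" "\<lambda>_. borel :: 'l measure"] assms by (simp add: insert_absorb)

lemma measurable_uniform:
  "(\<And>i. i < N \<Longrightarrow> f i \<in> space R) \<Longrightarrow> f \<in> uniform_count_measure {..<N::nat} \<rightarrow>\<^sub>M R"
  by (subst measurable_cong_sets[of _ "count_space {..<N}" R R]) (auto simp: sets_uniform_count_measure)

lemma prob_space_uniform: "N \<ge> 1 \<Longrightarrow> prob_space (uniform_count_measure {..<N::nat})"
  by (intro prob_space_uniform_count_measure) (auto simp: lessThan_empty_iff)

lemma nn_integral_uniform_mixture:
  fixes N :: nat
  assumes N: "N \<ge> 1" and V: "\<And>i. i < N \<Longrightarrow> V i \<in> space (prob_algebra Y)" and f: "f \<in> borel_measurable Y"
  shows "(\<integral>\<^sup>+y. f y \<partial>(uniform_count_measure {..<N} \<bind> V)) = (\<Sum>i<N. \<integral>\<^sup>+y. f y \<partial>V i) / ennreal (real N)"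
proof -
  have V': "V \<in> uniform_count_measure {..<N} \<rightarrow>\<^sub>M subprob_algebra Y"
    by (intro measurable_prob_algebraD measurable_uniform V)
  have "(\<integral>\<^sup>+y. f y \<partial>(uniform_count_measure {..<N} \<bind> V)) = (\<integral>\<^sup>+i. \<integral>\<^sup>+y. f y \<partial>V i \<partial>uniform_count_measure {..<N})"
    by (rule nn_integral_bind[OF f V'])
  also have "\<dots> = (\<Sum>i<N. ennreal (1 / real N) * (\<integral>\<^sup>+y. f y \<partial>V i))"
    unfolding uniform_count_measure_def
    by (subst nn_integral_point_measure_finite) (auto simp: mult.commute)
  also have "\<dots> = (\<Sum>i<N. (\<integral>\<^sup>+y. f y \<partial>V i) / ennreal (real N))"
    using N by (intro sum.cong) (auto simp: divide_ennreal_def inverse_ennreal mult.commute inverse_eq_divide)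
  finally show ?thesis by (simp add: divide_ennreal_def sum_distrib_right)
qed

lemma measurable_uniform_mixture:
  fixes N :: nat
  assumes N: "N \<ge> 1" and V: "\<And>i. i < N \<Longrightarrow> V i \<in> X \<rightarrow>\<^sub>M prob_algebra Y"
  shows "(\<lambda>x. uniform_count_measure {..<N} \<bind> (\<lambda>i. V i x)) \<in> X \<rightarrow>\<^sub>M prob_algebra Y"
proof (rule measurable_bind_prob_space2)
  show "(\<lambda>x. uniform_count_measure {..<N}) \<in> X \<rightarrow>\<^sub>M prob_algebra (uniform_count_measure {..<N})"
    using prob_space_uniform[OF N] by (intro measurable_const) (simp add: space_prob_algebra)
  have "(\<lambda>z. V (snd z) (fst z)) \<in> X \<Otimes>\<^sub>M uniform_count_measure {..<N} \<rightarrow>\<^sub>M prob_algebra Y"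
  proof (rule measurable_compose_countable'[where I="{..<N}" and f="\<lambda>i z. V i (fst z)"])
    show "(\<lambda>z. V i (fst z)) \<in> X \<Otimes>\<^sub>M uniform_count_measure {..<N} \<rightarrow>\<^sub>M prob_algebra Y" if "i \<in> {..<N}" for i
      using that by (intro measurable_compose[OF measurable_fst V]) auto
    show "snd \<in> X \<Otimes>\<^sub>M uniform_count_measure {..<N} \<rightarrow>\<^sub>M count_space {..<N}"
      by (rule measurable_compose[OF measurable_snd measurable_uniform]) auto
  qed auto
  then show "(\<lambda>(x, i). V i x) \<in> X \<Otimes>\<^sub>M uniform_count_measure {..<N} \<rightarrow>\<^sub>M prob_algebra Y"
    by (simp add: split_beta')
qed

section \<open>Single-site updates, stationarity and reversibility\<close>

locale glauber_chain =
  fixes N :: nat and \<mu> :: "(nat \<Rightarrow> 'l::polish_space) measure"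
    and K :: "nat \<Rightarrow> (nat \<Rightarrow> 'l) \<Rightarrow> 'l measure" and A :: "real mat"
  assumes N_pos: "N \<ge> 1"
    and prob_\<mu>: "prob_space \<mu>"
    and sets_\<mu>[measurable_cong]: "sets \<mu> = sets (Omega N)"
    and cond: "conditional_distributions N \<mu> K"
    and dobrushin: "dobrushin_matrix N K A"
    and W1_step: "\<forall>x\<in>space (Omega N). W1 (sum_dist N) (return (Omega N) x) (glauber N K x) < \<infinity>"
begin

abbreviation \<Omega> :: "(nat \<Rightarrow> 'l) measure" where "\<Omega> \<equiv> Omega N"
abbreviation Kx where "Kx i x \<equiv> K i (drop_coord N i x)"
abbreviation P where "P \<equiv> glauber N K"

lemma space_\<mu>: "space \<mu> = space \<Omega>"
  by (rule sets_eq_imp_space_eq[OF sets_\<mu>])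

lemma measurable_Kx: "i < N \<Longrightarrow> Kx i \<in> \<Omega> \<rightarrow>\<^sub>M prob_algebra borel"
  using cond by (intro measurable_compose[OF measurable_drop_coord]) (auto simp: conditional_distributions_def)

lemma Kx_prob:
  assumes "i < N" "x \<in> space \<Omega>"
  shows "prob_space (Kx i x)" "sets (Kx i x) = sets borel" "space (Kx i x) = UNIV"
  using measurable_space[OF measurable_Kx[OF assms(1)] assms(2)]
  by (auto simp: space_prob_algebra dest: sets_eq_imp_space_eq)

lemma measurable_upd_x:
  assumes "i < N" "x \<in> space \<Omega>"
  shows "(\<lambda>z. x(i := z)) \<in> Kx i x \<rightarrow>\<^sub>M \<Omega>"
  using measurable_compose[OF measurable_Pair1'[OF assms(2)] measurable_upd[OF assms(1)]]
  by (simp add: measurable_cong_sets[OF Kx_prob(2)[OF assms] refl])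

text \<open>The update at a fixed site. Stationarity and self-adjointness are proved site by site
  and pass to \<open>P\<close> by averaging.\<close>

definition U where "U i x = distr (Kx i x) \<Omega> (\<lambda>z. x(i := z))"

lemma measurable_U: "i < N \<Longrightarrow> U i \<in> \<Omega> \<rightarrow>\<^sub>M prob_algebra \<Omega>"
  unfolding U_def[abs_def] by (rule measurable_distr_prob_space2[OF measurable_Kx measurable_upd])

lemma nn_integral_U:
  "i < N \<Longrightarrow> x \<in> space \<Omega> \<Longrightarrow> f \<in> borel_measurable \<Omega> \<Longrightarrow>
    (\<integral>\<^sup>+y. f y \<partial>U i x) = (\<integral>\<^sup>+z. f (x(i := z)) \<partial>Kx i x)"
  unfolding U_def by (rule nn_integral_distr[OF measurable_upd_x]) simp_all

lemma integral_U:
  fixes f :: "_ \<Rightarrow> real"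
  shows "i < N \<Longrightarrow> x \<in> space \<Omega> \<Longrightarrow> f \<in> borel_measurable \<Omega> \<Longrightarrow>
    (\<integral>y. f y \<partial>U i x) = (\<integral>z. f (x(i := z)) \<partial>Kx i x)"
  unfolding U_def by (rule integral_distr[OF measurable_upd_x])

lemma P_eq: "P x = uniform_count_measure {..<N} \<bind> (\<lambda>i. U i x)"
  by (simp add: glauber_def U_def)

lemma U_kernel:
  assumes "x \<in> space \<Omega>"
  shows "(\<lambda>i. U i x) \<in> uniform_count_measure {..<N} \<rightarrow>\<^sub>M subprob_algebra \<Omega>"
  using measurable_space[OF measurable_prob_algebraD[OF measurable_U] assms]
  by (intro measurable_uniform) auto

lemma nn_integral_P:
  assumes x: "x \<in> space \<Omega>" and f: "f \<in> borel_measurable \<Omega>"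
  shows "(\<integral>\<^sup>+y. f y \<partial>P x) = (\<Sum>i<N. \<integral>\<^sup>+z. f (x(i := z)) \<partial>Kx i x) / ennreal (real N)"
proof -
  have "(\<integral>\<^sup>+y. f y \<partial>P x) = (\<Sum>i<N. \<integral>\<^sup>+y. f y \<partial>U i x) / ennreal (real N)"
    unfolding P_eq by (rule nn_integral_uniform_mixture[OF N_pos measurable_space[OF measurable_U x] f])
  then show ?thesis using x f by (simp add: nn_integral_U)
qed

lemma integral_P:
  fixes f :: "_ \<Rightarrow> real"
  assumes x: "x \<in> space \<Omega>" and f: "f \<in> borel_measurable \<Omega>" and B: "\<And>y. y \<in> space \<Omega> \<Longrightarrow> \<bar>f y\<bar> \<le> B"
  shows "(\<integral>y. f y \<partial>P x) = (\<Sum>i<N. \<integral>z. f (x(i := z)) \<partial>Kx i x) / real N"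
proof -
  interpret u: prob_space "uniform_count_measure {..<N}" by (rule prob_space_uniform[OF N_pos])
  have "(\<integral>y. f y \<partial>P x) = (\<integral>i. \<integral>y. f y \<partial>U i x \<partial>uniform_count_measure {..<N})"
    unfolding P_eq
  proof (rule integral_bind[OF f B U_kernel[OF x], where B'=1])
    show "AE i in uniform_count_measure {..<N}. emeasure (U i x) (space (U i x)) \<le> ennreal 1"
      using measurable_space[OF measurable_U x]
      by (auto intro!: AE_I2 simp: space_prob_algebra prob_space.emeasure_space_1 space_uniform_count_measure)
  qed (auto intro: u.finite_measure)
  also have "\<dots> = (\<Sum>i<N. (\<integral>y. f y \<partial>U i x) / real N)"
    unfolding uniform_count_measure_def
    by (subst lebesgue_integral_point_measure_finite) auto
  also have "\<dots> = (\<Sum>i<N. (\<integral>z. f (x(i := z)) \<partial>Kx i x) / real N)"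
    using x f by (intro sum.cong) (auto simp: integral_U)
  finally show ?thesis by (simp add: sum_divide_distrib)
qed

lemma measurable_P: "P \<in> \<Omega> \<rightarrow>\<^sub>M prob_algebra \<Omega>"
  unfolding P_eq[abs_def] by (rule measurable_uniform_mixture[OF N_pos measurable_U])

text \<open>Equality is checked on rectangles. The updated state lies in one exactly when the new
  value lies in side \<open>i\<close> and the other coordinates, which the update leaves alone, lie
  in the remaining sides; the defining identity of the conditional distributions then gives the
  claim.\<close>

lemma U_stationary:
  assumes i: "i < N"
  shows "\<mu> \<bind> U i = \<mu>"
proof -
  interpret \<mu>: prob_space \<mu> by (rule prob_\<mu>)
  have U\<mu>: "U i \<in> \<mu> \<rightarrow>\<^sub>M subprob_algebra \<Omega>"
    using measurable_prob_algebraD[OF measurable_U[OF i]] by (simp add: measurable_cong_sets[OF sets_\<mu> refl])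
  have ne: "space \<mu> \<noteq> {}" by (rule \<mu>.not_empty)
  show ?thesis
  proof (rule measure_eqI_PiM_finite)
    show "sets (\<mu> \<bind> U i) = sets \<Omega>"
      using sets_kernel[OF U\<mu>] ne by (rule sets_bind)
    show "finite {..<N}" by simp
    show "sets \<mu> = sets \<Omega>" by (rule sets_\<mu>)
    have univ: "space \<Omega> \<in> prod_algebra {..<N} (\<lambda>_. borel)"
      unfolding space_PiM by (rule prod_algebraI_finite) auto
    show "range (\<lambda>_::nat. space \<Omega>) \<subseteq> prod_algebra {..<N} (\<lambda>_. borel)" using univ by auto
    show "(\<Union>n::nat. space \<Omega>) = space \<Omega>" by simp
    interpret b: prob_space "\<mu> \<bind> U i"
    proof (rule \<mu>.prob_space_bind[OF _ U\<mu>])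
      show "AE x in \<mu>. prob_space (U i x)"
        using measurable_space[OF measurable_U[OF i]] by (intro AE_I2) (simp add: space_\<mu> space_prob_algebra)
    qed
    show "emeasure (\<mu> \<bind> U i) (space \<Omega>) \<noteq> \<infinity>" for n :: nat by simp
    fix X :: "nat \<Rightarrow> 'l set" assume X: "\<And>j. j \<in> {..<N} \<Longrightarrow> X j \<in> sets borel"
    define C where "C = Pi\<^sub>E ({..<N} - {i}) X"
    have C: "C \<in> sets (Omega_minus N i)" unfolding C_def using X by (intro sets_PiM_I_finite) auto
    have rect: "Pi\<^sub>E {..<N} X \<in> sets \<Omega>" using X by (intro sets_PiM_I_finite) auto
    have iff: "x \<in> Pi\<^sub>E {..<N} X \<longleftrightarrow> x i \<in> X i \<and> drop_coord N i x \<in> C" if "x \<in> space \<Omega>" for x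
      using that i by (auto simp: C_def drop_coord_def PiE_iff space_Omega)
    have "emeasure (\<mu> \<bind> U i) (Pi\<^sub>E {..<N} X) = (\<integral>\<^sup>+x. emeasure (U i x) (Pi\<^sub>E {..<N} X) \<partial>\<mu>)"
      by (rule emeasure_bind[OF ne U\<mu> rect])
    also have "\<dots> = (\<integral>\<^sup>+x. emeasure (Kx i x) (X i) * indicator C (drop_coord N i x) \<partial>\<mu>)"
    proof (intro nn_integral_cong)
      fix x assume "x \<in> space \<mu>"
      then have x: "x \<in> space \<Omega>" by (simp add: space_\<mu>)
      have "emeasure (U i x) (Pi\<^sub>E {..<N} X) = emeasure (Kx i x) ((\<lambda>z. x(i := z)) -` (Pi\<^sub>E {..<N} X) \<inter> space (Kx i x))"
        unfolding U_def by (rule emeasure_distr[OF measurable_upd_x[OF i x] rect])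
      also have "(\<lambda>z. x(i := z)) -` (Pi\<^sub>E {..<N} X) \<inter> space (Kx i x) = (if drop_coord N i x \<in> C then X i else {})"
        using iff[OF upd_in_space_Omega[OF x i]] by (auto simp: drop_coord_upd Kx_prob[OF i x])
      finally show "emeasure (U i x) (Pi\<^sub>E {..<N} X) = emeasure (Kx i x) (X i) * indicator C (drop_coord N i x)"
        by (simp split: if_splits)
    qed
    also have "\<dots> = emeasure \<mu> {x \<in> space \<mu>. x i \<in> X i \<and> drop_coord N i x \<in> C}"
      using cond i X[of i] C unfolding conditional_distributions_def by auto
    also have "{x \<in> space \<mu>. x i \<in> X i \<and> drop_coord N i x \<in> C} = Pi\<^sub>E {..<N} X"
      using iff sets.sets_into_space[OF rect] by (auto simp: space_\<mu>)
    finally show "emeasure (\<mu> \<bind> U i) (Pi\<^sub>E {..<N} X) = emeasure \<mu> (Pi\<^sub>E {..<N} X)" .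
  qed
qed

lemma measurable_\<mu>_iff: "f \<in> \<mu> \<rightarrow>\<^sub>M R \<longleftrightarrow> f \<in> \<Omega> \<rightarrow>\<^sub>M R"
  by (simp add: measurable_cong_sets[OF sets_\<mu> refl])

sublocale stationary_kernel \<mu> P
proof -
  interpret \<mu>: prob_space \<mu> by (rule prob_\<mu>)
  have k: "P \<in> \<mu> \<rightarrow>\<^sub>M prob_algebra \<mu>"
    using measurable_P by (simp add: measurable_\<mu>_iff prob_algebra_def subprob_algebra_cong[OF sets_\<mu>])
  have "\<mu> \<bind> P = \<mu>"
  proof (rule measure_eqI)
    have P\<mu>: "P \<in> \<mu> \<rightarrow>\<^sub>M subprob_algebra \<Omega>"
      using measurable_prob_algebraD[OF measurable_P] by (simp add: measurable_\<mu>_iff)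
    show *: "sets (\<mu> \<bind> P) = sets \<mu>"
      using sets_bind[OF sets_kernel[OF P\<mu>] \<mu>.not_empty] by (simp add: sets_\<mu>)
    fix S assume "S \<in> sets (\<mu> \<bind> P)"
    then have S: "S \<in> sets \<Omega>" using * by (simp add: sets_\<mu>)
    have U\<mu>: "U i \<in> \<mu> \<rightarrow>\<^sub>M subprob_algebra \<Omega>" if "i < N" for i
      using measurable_prob_algebraD[OF measurable_U[OF that]] by (simp add: measurable_\<mu>_iff)
    have "emeasure (\<mu> \<bind> P) S = (\<integral>\<^sup>+x. emeasure (P x) S \<partial>\<mu>)"
      by (rule emeasure_bind[OF \<mu>.not_empty P\<mu> S])
    also have "\<dots> = (\<integral>\<^sup>+x. (\<Sum>i<N. emeasure (U i x) S) / ennreal (real N) \<partial>\<mu>)"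
    proof (intro nn_integral_cong)
      fix x assume "x \<in> space \<mu>"
      then have x: "x \<in> space \<Omega>" by (simp add: space_\<mu>)
      have P_sets: "sets (P x) = sets \<Omega>" and U_sets: "i < N \<Longrightarrow> sets (U i x) = sets \<Omega>" for i
        using measurable_space[OF measurable_P x] measurable_space[OF measurable_U x]
        by (auto simp: space_prob_algebra)
      have "emeasure (P x) S = (\<integral>\<^sup>+y. indicator S y \<partial>P x)" using S by (simp add: P_sets)
      also have "\<dots> = (\<Sum>i<N. \<integral>\<^sup>+z. indicator S (x(i := z)) \<partial>Kx i x) / ennreal (real N)"
        using S by (intro nn_integral_P x) auto
      also have "\<dots> = (\<Sum>i<N. emeasure (U i x) S) / ennreal (real N)"
        using S x by (intro arg_cong2[where f="(/)"] sum.cong refl) (simp add: nn_integral_U[symmetric] U_sets)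
      finally show "emeasure (P x) S = (\<Sum>i<N. emeasure (U i x) S) / ennreal (real N)" .
    qed
    also have "\<dots> = (\<Sum>i<N. \<integral>\<^sup>+x. emeasure (U i x) S \<partial>\<mu>) / ennreal (real N)"
      using U\<mu> S by (subst nn_integral_divide) (auto intro!: borel_measurable_sum nn_integral_sum emeasure_measurable_subprob_algebra2 arg_cong2[where f="(/)"] simp: measurable_emeasure_kernel)
    also have "\<dots> = (\<Sum>i<N. emeasure \<mu> S) / ennreal (real N)"
      using emeasure_bind[OF \<mu>.not_empty U\<mu> S] U_stationary by simp
    also have "\<dots> = emeasure \<mu> S"
      using N_pos by (simp add: ennreal_of_nat_eq_real_of_nat mult.commute[of "ennreal (real N)"] mult_divide_eq_ennreal)
    finally show "emeasure (\<mu> \<bind> P) S = emeasure \<mu> S" .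
  qed
  with k show "stationary_kernel \<mu> P" by unfold_locales
qed

lemma bounded_functions_iff:
  "f \<in> bounded_functions \<longleftrightarrow> f \<in> borel_measurable \<Omega> \<and> (\<exists>B. \<forall>x\<in>space \<Omega>. \<bar>f x\<bar> \<le> B)"
  by (simp add: bounded_functions_def measurable_\<mu>_iff space_\<mu>)

text \<open>\<open>E i\<close> is conditional expectation given the other coordinates, so
  \<open>E i h\<close> can be pulled out of a further \<open>E i\<close>. With stationarity of
  \<open>U i\<close>, the integral of \<open>E i h * k\<close> equals that of
  \<open>E i h * E i k\<close>, which is symmetric in \<open>h\<close> and \<open>k\<close>;
  averaging over sites keeps the symmetry.\<close>

lemma P_reversible: "reversible"
  unfolding reversible_def
proof (intro ballI)
  fix f g assume fb: "f \<in> bounded_functions" and gb: "g \<in> bounded_functions"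
  define E where "E i h x = (\<integral>y. h y \<partial>U i x)" for i x and h :: "(nat \<Rightarrow> 'l) \<Rightarrow> real"
  have E_eq: "E i h x = (\<integral>z. h (x(i := z)) \<partial>Kx i x)" if "i < N" "h \<in> bounded_functions" "x \<in> space \<Omega>" for i h x
    unfolding E_def using that by (intro integral_U) (auto simp: bounded_functions_iff)
  have E_bounded: "E i h \<in> bounded_functions" if i: "i < N" and h: "h \<in> bounded_functions" for i h
  proof -
    from h obtain B where B: "\<And>x. x \<in> space \<Omega> \<Longrightarrow> \<bar>h x\<bar> \<le> B" and m: "h \<in> borel_measurable \<Omega>"
      by (auto simp: bounded_functions_iff)
    have "E i h \<in> borel_measurable \<Omega>"
      unfolding E_def[abs_def]
      by (rule measurable_compose[OF measurable_prob_algebraD[OF measurable_U[OF i]] integral_measurable_subprob_algebra[OF m]])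
    moreover have "\<bar>E i h x\<bar> \<le> B" if x: "x \<in> space \<Omega>" for x
    proof -
      interpret Kp: prob_space "Kx i x" by (rule Kx_prob(1)[OF i x])
      have hm: "(\<lambda>z. h (x(i := z))) \<in> borel_measurable (Kx i x)"
        by (rule measurable_compose[OF measurable_upd_x[OF i x] m])
      have B': "\<bar>h (x(i := z))\<bar> \<le> B" for z by (rule B[OF upd_in_space_Omega[OF x i]])
      have int: "integrable (Kx i x) (\<lambda>z. h (x(i := z)))"
        using hm B' by (intro Kp.integrable_const_bound[of _ B]) auto
      have "\<bar>E i h x\<bar> \<le> (\<integral>z. \<bar>h (x(i := z))\<bar> \<partial>Kx i x)"
        unfolding E_eq[OF i h x] by (rule integral_abs_bound)
      also have "\<dots> \<le> (\<integral>z. B \<partial>Kx i x)" using int B' by (intro integral_mono) auto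
      finally show ?thesis by (simp add: Kp.prob_space)
    qed
    ultimately show ?thesis by (auto simp: bounded_functions_iff)
  qed
  have E_int: "(\<integral>x. E i h x \<partial>\<mu>) = (\<integral>x. h x \<partial>\<mu>)" if i: "i < N" and h: "h \<in> bounded_functions" for i h
  proof -
    from h obtain B where B: "\<And>x. x \<in> space \<Omega> \<Longrightarrow> \<bar>h x\<bar> \<le> B" and m: "h \<in> borel_measurable \<Omega>"
      by (auto simp: bounded_functions_iff)
    have "(\<integral>x. h x \<partial>(\<mu> \<bind> U i)) = (\<integral>x. E i h x \<partial>\<mu>)"
      unfolding E_def
    proof (rule integral_bind[OF m B, where B'=1])
      show "U i \<in> \<mu> \<rightarrow>\<^sub>M subprob_algebra \<Omega>"
        using measurable_prob_algebraD[OF measurable_U[OF i]] by (simp add: measurable_\<mu>_iff)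
      show "AE x in \<mu>. emeasure (U i x) (space (U i x)) \<le> ennreal 1"
        using measurable_space[OF measurable_U[OF i]]
        by (auto intro!: AE_I2 simp: space_prob_algebra prob_space.emeasure_space_1 space_\<mu>)
    qed (auto intro: finite_measure)
    then show ?thesis by (simp add: U_stationary[OF i])
  qed
  have E_pull: "E i (\<lambda>x. E i h x * k x) x = E i h x * E i k x"
    if i: "i < N" and h: "h \<in> bounded_functions" and k: "k \<in> bounded_functions" and x: "x \<in> space \<Omega>" for i h k x
  proof -
    \<comment> \<open>The conditional law ignores coordinate \<open>i\<close> and the update
      overwrites it, so \<open>E i h\<close> is constant along that coordinate.\<close>
    have "E i h (x(i := z)) = E i h x" for z
      using i h x upd_in_space_Omega[OF x i] by (simp add: E_eq drop_coord_upd)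
    then show ?thesis
      using E_eq[OF i bounded_functions_mult[OF E_bounded[OF i h] k] x] E_eq[OF i k x] by simp
  qed
  have E_sym: "(\<integral>x. E i h x * k x \<partial>\<mu>) = (\<integral>x. E i h x * E i k x \<partial>\<mu>)"
    if i: "i < N" and h: "h \<in> bounded_functions" and k: "k \<in> bounded_functions" for i h k
  proof -
    have "(\<integral>x. E i h x * k x \<partial>\<mu>) = (\<integral>x. E i (\<lambda>x. E i h x * k x) x \<partial>\<mu>)"
      by (rule E_int[symmetric, OF i bounded_functions_mult[OF E_bounded[OF i h] k]])
    also have "\<dots> = (\<integral>x. E i h x * E i k x \<partial>\<mu>)"
      by (intro Bochner_Integration.integral_cong refl E_pull i h k) (simp add: space_\<mu>)
    finally show ?thesis .
  qed
  have TR_eq: "(\<integral>y. h y \<partial>P x) = (\<Sum>i<N. E i h x) / real N" if h: "h \<in> bounded_functions" and x: "x \<in> space \<Omega>" for h x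
  proof -
    from h obtain B where "\<And>x. x \<in> space \<Omega> \<Longrightarrow> \<bar>h x\<bar> \<le> B" and "h \<in> borel_measurable \<Omega>"
      by (auto simp: bounded_functions_iff)
    then show ?thesis using integral_P[OF x, of h B] h x by (simp add: E_eq)
  qed
  have half: "(\<integral>x. (\<integral>y. h y \<partial>P x) * k x \<partial>\<mu>) = (\<Sum>i<N. \<integral>x. E i h x * E i k x \<partial>\<mu>) / real N"
    if h: "h \<in> bounded_functions" and k: "k \<in> bounded_functions" for h k
  proof -
    have "(\<integral>x. (\<integral>y. h y \<partial>P x) * k x \<partial>\<mu>) = (\<integral>x. (\<Sum>i<N. E i h x * k x) / real N \<partial>\<mu>)"
      by (intro Bochner_Integration.integral_cong refl) (simp add: space_\<mu> TR_eq[OF h] sum_distrib_right)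
    also have "\<dots> = (\<Sum>i<N. \<integral>x. E i h x * k x \<partial>\<mu>) / real N"
      using h k by (simp, subst Bochner_Integration.integral_sum)
        (auto intro!: bounded_functions_integrable bounded_functions_mult E_bounded)
    also have "\<dots> = (\<Sum>i<N. \<integral>x. E i h x * E i k x \<partial>\<mu>) / real N"
      using h k E_sym by simp
    finally show ?thesis .
  qed
  show "(\<integral>x. (\<integral>y. f y \<partial>P x) * g x \<partial>\<mu>) = (\<integral>x. f x * (\<integral>y. g y \<partial>P x) \<partial>\<mu>)"
    using half[OF fb gb] half[OF gb fb] by (simp add: mult.commute)
qed

end

section \<open>Contraction of Lipschitz constants and decay of covariances\<close>

lemma W1_lipschitz_bound:
  fixes p q :: "'l::polish_space measure"
  assumes p: "prob_space p" "sets p = sets borel" and q: "prob_space q" "sets q = sets borel"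
    and \<phi>: "\<phi> \<in> borel_measurable borel" "\<And>z. \<bar>\<phi> z\<bar> \<le> B" and \<psi>: "\<psi> \<in> borel_measurable borel" "\<And>z. \<bar>\<psi> z\<bar> \<le> B"
    and lip: "\<And>z w. \<bar>\<phi> z - \<psi> w\<bar> \<le> a + b * dist z w" and a: "0 \<le> a" and b: "0 \<le> b"
    and W: "W1 dist p q \<le> ennreal c" and c: "0 \<le> c"
  shows "\<bar>(\<integral>z. \<phi> z \<partial>p) - (\<integral>w. \<psi> w \<partial>q)\<bar> \<le> a + b * c"
proof (rule field_le_epsilon)
  fix e :: real assume e: "0 < e"
  \<comment> \<open>The denominator \<open>b + 1\<close> makes \<open>b * \<epsilon> \<le> e\<close>
    hold also for \<open>b = 0\<close>.\<close>
  define \<epsilon> where "\<epsilon> = e / (b + 1)"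
  have \<epsilon>: "0 < \<epsilon>" using e b by (simp add: \<epsilon>_def)
  have b\<epsilon>: "b * \<epsilon> \<le> e" using e b by (simp add: \<epsilon>_def field_simps)
  have "W1 dist p q < ennreal (c + \<epsilon>)"
    using W c \<epsilon> by (auto intro: le_less_trans ennreal_lessI)
  then obtain \<pi> where \<pi>: "\<pi> \<in> couplings p q" and cost: "(\<integral>\<^sup>+(x, y). ennreal (dist x y) \<partial>\<pi>) < ennreal (c + \<epsilon>)"
    unfolding W1_def by (auto simp: INF_less_iff)
  interpret \<pi>: prob_space \<pi> using \<pi> p(1) by (rule couplings_prob_space)
  have sets_\<pi>[measurable_cong]: "sets \<pi> = sets (borel \<Otimes>\<^sub>M borel)"
    using \<pi> by (simp add: couplings_def p(2) q(2) cong: sets_pair_measure_cong)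
  note [measurable] = \<phi>(1) \<psi>(1)
  have int: "integrable \<pi> (\<lambda>z. \<phi> (fst z))" "integrable \<pi> (\<lambda>z. \<psi> (snd z))"
    using \<phi> \<psi> by (auto intro!: \<pi>.integrable_const_bound[of _ B])
  have eq: "(\<integral>z. \<phi> z \<partial>p) - (\<integral>w. \<psi> w \<partial>q) = (\<integral>z. \<phi> (fst z) - \<psi> (snd z) \<partial>\<pi>)"
  proof -
    have "\<phi> \<in> borel_measurable p" "\<psi> \<in> borel_measurable q"
      using \<phi>(1) \<psi>(1) by (simp_all add: measurable_cong_sets[OF p(2) refl] measurable_cong_sets[OF q(2) refl])
    then show ?thesis using int integral_coupling[OF \<pi>] by simp
  qed
  have "ennreal \<bar>(\<integral>z. \<phi> z \<partial>p) - (\<integral>w. \<psi> w \<partial>q)\<bar> \<le> (\<integral>\<^sup>+z. ennreal \<bar>\<phi> (fst z) - \<psi> (snd z)\<bar> \<partial>\<pi>)"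
    unfolding eq using integral_norm_bound_ennreal[of \<pi> "\<lambda>z. \<phi> (fst z) - \<psi> (snd z)"] int by simp
  also have "\<dots> \<le> (\<integral>\<^sup>+z. ennreal a + ennreal b * ennreal (dist (fst z) (snd z)) \<partial>\<pi>)"
  proof (intro nn_integral_mono)
    fix z
    show "ennreal \<bar>\<phi> (fst z) - \<psi> (snd z)\<bar> \<le> ennreal a + ennreal b * ennreal (dist (fst z) (snd z))"
      using ennreal_leI[OF lip[of "fst z" "snd z"]] a b by (simp add: ennreal_mult)
  qed
  also have "\<dots> = ennreal a + ennreal b * (\<integral>\<^sup>+(x, y). ennreal (dist x y) \<partial>\<pi>)"
    by (simp add: nn_integral_add nn_integral_cmult \<pi>.emeasure_space_1 split_beta')
  also have "\<dots> \<le> ennreal a + ennreal b * ennreal (c + \<epsilon>)"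
    using cost by (intro add_mono mult_left_mono) auto
  also have "\<dots> = ennreal (a + b * (c + \<epsilon>))"
    using a b c \<epsilon> by (simp add: ennreal_mult[symmetric] ennreal_plus[symmetric] del: ennreal_plus)
  finally have "\<bar>(\<integral>z. \<phi> z \<partial>p) - (\<integral>w. \<psi> w \<partial>q)\<bar> \<le> a + b * (c + \<epsilon>)"
    using a b c \<epsilon> by (subst (asm) ennreal_le_iff) auto
  then show "\<bar>(\<integral>z. \<phi> z \<partial>p) - (\<integral>w. \<psi> w \<partial>q)\<bar> \<le> a + b * c + e"
    using b\<epsilon> by (simp add: distrib_left)
qed

lemma measurable_sum_dist: "(\<lambda>z. sum_dist N (fst z) (snd z)) \<in> borel_measurable (Omega N \<Otimes>\<^sub>M Omega N)"
  unfolding sum_dist_def by measurable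

lemma measurable_sum_dist_right:
  "x \<in> space (Omega N) \<Longrightarrow> sum_dist N x \<in> borel_measurable (Omega N)"
  unfolding sum_dist_def[abs_def] by measurable

context glauber_chain
begin

abbreviation B where "B \<equiv> glauber_matrix N A"

lemma A_carrier: "A \<in> carrier_mat N N"
  and A_nonneg: "i < N \<Longrightarrow> j < N \<Longrightarrow> 0 \<le> A $$ (i, j)"
  and W1_Kx: "i < N \<Longrightarrow> x \<in> space \<Omega> \<Longrightarrow> y \<in> space \<Omega> \<Longrightarrow>
    W1 dist (Kx i x) (Kx i y) \<le> ennreal (\<Sum>j<N. A $$ (i, j) * dist (x j) (y j))"
  using dobrushin by (auto simp: dobrushin_matrix_def)

lemma B_carrier: "B \<in> carrier_mat N N"
  using A_carrier by simp

lemma B_nonneg: "i < N \<Longrightarrow> j < N \<Longrightarrow> 0 \<le> B $$ (i, j)"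
  using A_nonneg N_pos by (simp add: glauber_matrix_index[OF A_carrier])

lemma B_pow_nonneg: "i < N \<Longrightarrow> j < N \<Longrightarrow> 0 \<le> (B ^\<^sub>m k) $$ (i, j)"
proof (induction k arbitrary: i j)
  case (Suc k)
  then show ?case
    using B_nonneg by (auto simp: mat_mult_index_sum[OF pow_carrier_mat[OF B_carrier] B_carrier] intro!: sum_nonneg)
qed (use B_carrier in auto)

lemma measurable_upd_point: "i < N \<Longrightarrow> x \<in> space \<Omega> \<Longrightarrow> (\<lambda>z. x(i := z)) \<in> borel \<rightarrow>\<^sub>M \<Omega>"
  using measurable_compose[OF measurable_Pair1' measurable_upd] by simp

text \<open>One constant per coordinate: a single Lipschitz constant for \<open>sum_dist\<close>,
  updated step by step, would see a norm of \<open>B\<close> and not its spectral radius.\<close>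

definition coord_lipschitz :: "(nat \<Rightarrow> real) \<Rightarrow> ((nat \<Rightarrow> 'l) \<Rightarrow> real) \<Rightarrow> bool" where
  "coord_lipschitz l f \<longleftrightarrow> (\<forall>x\<in>space \<Omega>. \<forall>y\<in>space \<Omega>. \<bar>f x - f y\<bar> \<le> (\<Sum>j<N. l j * dist (x j) (y j)))"

text \<open>An update at site \<open>i\<close> leaves the terms with \<open>j \<noteq> i\<close>
  alone and replaces \<open>l i * dist (x i) (y i)\<close> by \<open>l i\<close> times the Dobrushin
  bound for the two conditional laws. Averaging over \<open>i\<close> keeps \<open>l j\<close> with
  weight \<open>(N - 1) / N\<close> and adds \<open>1 / N\<close> times column \<open>j\<close> of
  \<open>A\<close> weighted with \<open>l\<close>: the transpose of \<open>B\<close> applied to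
  \<open>l\<close>.\<close>

lemma coord_lipschitz_step:
  assumes f: "f \<in> bounded_functions" and lip: "coord_lipschitz l f" and l: "\<And>j. j < N \<Longrightarrow> 0 \<le> l j"
  shows "coord_lipschitz (\<lambda>j. \<Sum>i<N. l i * B $$ (i, j)) (TR f)"
  unfolding coord_lipschitz_def
proof (intro ballI)
  fix x y assume x: "x \<in> space \<Omega>" and y: "y \<in> space \<Omega>"
  from f obtain C where C: "\<And>x. x \<in> space \<Omega> \<Longrightarrow> \<bar>f x\<bar> \<le> C" and fm: "f \<in> borel_measurable \<Omega>"
    by (auto simp: bounded_functions_iff)
  let ?d = "\<lambda>j. dist (x j) (y j)"
  let ?F = "\<lambda>i x. \<integral>z. f (x(i := z)) \<partial>Kx i x"
  have step: "\<bar>?F i x - ?F i y\<bar> \<le> (\<Sum>j<N. l j * ?d j) - l i * ?d i + l i * (\<Sum>j<N. A $$ (i, j) * ?d j)" if i: "i < N" for i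
  proof -
    have rem: "(\<Sum>j<N. h j) = h i + (\<Sum>j\<in>{..<N} - {i}. h j)" for h :: "nat \<Rightarrow> real"
      using i by (intro sum.remove) auto
    have "\<bar>?F i x - ?F i y\<bar> \<le> (\<Sum>j\<in>{..<N} - {i}. l j * ?d j) + l i * (\<Sum>j<N. A $$ (i, j) * ?d j)"
    proof (rule W1_lipschitz_bound[OF Kx_prob(1,2)[OF i x] Kx_prob(1,2)[OF i y], where B=C])
      show "(\<lambda>z. f (x(i := z))) \<in> borel_measurable borel" "(\<lambda>z. f (y(i := z))) \<in> borel_measurable borel"
        by (rule measurable_compose[OF measurable_upd_point[OF i x] fm])
          (rule measurable_compose[OF measurable_upd_point[OF i y] fm])
      show "\<bar>f (x(i := z))\<bar> \<le> C" "\<bar>f (y(i := z))\<bar> \<le> C" for z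
        by (intro C upd_in_space_Omega x y i)+
      show "\<bar>f (x(i := z)) - f (y(i := w))\<bar> \<le> (\<Sum>j\<in>{..<N} - {i}. l j * ?d j) + l i * dist z w" for z w
      proof -
        have "\<bar>f (x(i := z)) - f (y(i := w))\<bar> \<le> (\<Sum>j<N. l j * dist ((x(i := z)) j) ((y(i := w)) j))"
          by (rule lip[unfolded coord_lipschitz_def, rule_format, OF upd_in_space_Omega[OF x i] upd_in_space_Omega[OF y i]])
        then show ?thesis by (simp add: rem)
      qed
      show "0 \<le> (\<Sum>j\<in>{..<N} - {i}. l j * ?d j)" using l by (auto intro!: sum_nonneg)
      show "0 \<le> l i" using l i by simp
      show "W1 dist (Kx i x) (Kx i y) \<le> ennreal (\<Sum>j<N. A $$ (i, j) * ?d j)" by (rule W1_Kx[OF i x y])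
      show "0 \<le> (\<Sum>j<N. A $$ (i, j) * ?d j)" using A_nonneg i by (auto intro!: sum_nonneg)
    qed
    then show ?thesis using rem[of "\<lambda>j. l j * ?d j"] by simp
  qed
  have "\<bar>TR f x - TR f y\<bar> = \<bar>\<Sum>i<N. ?F i x - ?F i y\<bar> / real N"
    by (simp add: integral_P[OF x fm C] integral_P[OF y fm C] sum_subtractf diff_divide_distrib[symmetric])
  also have "\<dots> \<le> (\<Sum>i<N. (\<Sum>j<N. l j * ?d j) - l i * ?d i + l i * (\<Sum>j<N. A $$ (i, j) * ?d j)) / real N"
    by (intro divide_right_mono order_trans[OF sum_abs] sum_mono step) auto
  also have "(\<Sum>i<N. (\<Sum>j<N. l j * ?d j) - l i * ?d i + l i * (\<Sum>j<N. A $$ (i, j) * ?d j))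
     = (real N - 1) * (\<Sum>j<N. l j * ?d j) + (\<Sum>j<N. \<Sum>i<N. l i * A $$ (i, j) * ?d j)"
    unfolding sum.swap[of "\<lambda>j i. l i * A $$ (i, j) * ?d j"]
    by (simp add: sum.distrib sum_subtractf sum_distrib_left algebra_simps)
  also have "\<dots> / real N = (\<Sum>j<N. (\<Sum>i<N. l i * B $$ (i, j)) * ?d j)"
  proof -
    have "(\<Sum>i<N. l i * B $$ (i, j)) * ?d j = (real N - 1) / real N * (l j * ?d j) + (\<Sum>i<N. l i * A $$ (i, j) * ?d j) / real N"
      if j: "j < N" for j
    proof -
      define c where "c = (real N - 1) / real N"
      have "(\<Sum>i<N. l i * B $$ (i, j)) = (\<Sum>i<N. c * (if i = j then l i else 0) + l i * A $$ (i, j) / real N)"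
        using j by (intro sum.cong refl) (auto simp: glauber_matrix_index[OF A_carrier] c_def algebra_simps)
      also have "\<dots> = c * l j + (\<Sum>i<N. l i * A $$ (i, j)) / real N"
        using j by (simp add: sum.distrib sum_distrib_left[symmetric] sum_divide_distrib)
      also note c_def
      finally show ?thesis by (simp add: distrib_right sum_distrib_right)
    qed
    then show ?thesis
      by (simp add: sum.distrib sum_distrib_left[symmetric] sum_divide_distrib[symmetric] add_divide_distrib)
  qed
  finally show "\<bar>TR f x - TR f y\<bar> \<le> (\<Sum>j<N. (\<Sum>i<N. l i * B $$ (i, j)) * ?d j)" .
qed

text \<open>Starting from the constant vector \<open>L\<close>, repeated application of the
  transpose produces \<open>L\<close> times the column sums of the powers of
  \<open>B\<close>.\<close>

lemma coord_lipschitz_iterate: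
  assumes f: "f \<in> bounded_functions" and L: "0 \<le> L"
    and lip: "\<And>x y. x \<in> space \<Omega> \<Longrightarrow> y \<in> space \<Omega> \<Longrightarrow> \<bar>f x - f y\<bar> \<le> L * sum_dist N x y"
  shows "coord_lipschitz (\<lambda>j. L * (\<Sum>i<N. (B ^\<^sub>m k) $$ (i, j))) ((TR ^^ k) f)"
proof (induction k)
  case 0
  have one: "(\<Sum>i<N. (B ^\<^sub>m 0) $$ (i, j)) = 1" if "j < N" for j
    using that B_carrier carrier_matD[OF B_carrier] by simp
  have "(\<Sum>j<N. L * (\<Sum>i<N. (B ^\<^sub>m 0) $$ (i, j)) * dist (x j) (y j)) = L * sum_dist N x y" for x y :: "nat \<Rightarrow> 'l"
  proof -
    have "(\<Sum>j<N. L * (\<Sum>i<N. (B ^\<^sub>m 0) $$ (i, j)) * dist (x j) (y j)) = (\<Sum>j<N. L * dist (x j) (y j))"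
      by (intro sum.cong refl) (simp only: one lessThan_iff mult_1_right)
    then show ?thesis by (simp only: sum_dist_def sum_distrib_left)
  qed
  then show ?case using lip unfolding coord_lipschitz_def by (simp only: funpow_0) blast
next
  case (Suc k)
  have "coord_lipschitz (\<lambda>j. \<Sum>l<N. L * (\<Sum>i<N. (B ^\<^sub>m k) $$ (i, l)) * B $$ (l, j)) (TR ((TR ^^ k) f))"
    using L B_pow_nonneg by (intro coord_lipschitz_step bounded_functions_iterate f Suc) (auto intro!: mult_nonneg_nonneg sum_nonneg)
  moreover have "(\<Sum>l<N. L * (\<Sum>i<N. (B ^\<^sub>m k) $$ (i, l)) * B $$ (l, j)) = L * (\<Sum>i<N. (B ^\<^sub>m Suc k) $$ (i, j))"
    if j: "j < N" for j
  proof -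
    have "(\<Sum>i<N. (B ^\<^sub>m Suc k) $$ (i, j)) = (\<Sum>i<N. \<Sum>l<N. (B ^\<^sub>m k) $$ (i, l) * B $$ (l, j))"
      using j by (intro sum.cong refl) (simp add: mat_mult_index_sum[OF pow_carrier_mat[OF B_carrier] B_carrier])
    also have "\<dots> = (\<Sum>l<N. \<Sum>i<N. (B ^\<^sub>m k) $$ (i, l) * B $$ (l, j))" by (rule sum.swap)
    finally show ?thesis by (simp add: sum_distrib_left sum_distrib_right mult.assoc)
  qed
  ultimately show ?case by (simp add: coord_lipschitz_def)
qed

lemma P_prob: "x \<in> space \<Omega> \<Longrightarrow> prob_space (P x)" "x \<in> space \<Omega> \<Longrightarrow> sets (P x) = sets \<Omega>"
  using measurable_space[OF measurable_P] by (auto simp: space_prob_algebra)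

text \<open>The first marginal of a coupling with \<open>return \<Omega> x\<close> sits at
  \<open>x\<close>, so the cost of any such coupling is the mean displacement from
  \<open>x\<close>.\<close>

lemma P_first_moment:
  assumes x: "x \<in> space \<Omega>"
  shows "(\<integral>\<^sup>+y. ennreal (sum_dist N x y) \<partial>P x) < \<infinity>"
proof -
  have "W1 (sum_dist N) (return \<Omega> x) (P x) < \<infinity>" using W1_step x by blast
  then obtain \<pi> where \<pi>: "\<pi> \<in> couplings (return \<Omega> x) (P x)" and cost: "(\<integral>\<^sup>+(u, v). ennreal (sum_dist N u v) \<partial>\<pi>) < \<infinity>"
    unfolding W1_def by (auto simp: INF_less_iff)
  have [measurable_cong]: "sets \<pi> = sets (\<Omega> \<Otimes>\<^sub>M \<Omega>)"
    using \<pi> by (simp add: couplings_def P_prob[OF x] cong: sets_pair_measure_cong)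
  note [measurable] = measurable_sum_dist measurable_sum_dist_right[OF x]
  have m: "(\<lambda>y. ennreal (sum_dist N x y)) \<in> borel_measurable (P x)" "(\<lambda>y. ennreal (sum_dist N x y)) \<in> borel_measurable (return \<Omega> x)"
    by (simp_all add: measurable_cong_sets[OF P_prob(2)[OF x] refl])
  have "(\<integral>\<^sup>+y. ennreal (sum_dist N x y) \<partial>P x) = (\<integral>\<^sup>+z. ennreal (sum_dist N x (snd z)) \<partial>\<pi>)"
    using nn_integral_coupling(2)[OF \<pi> m(1)] by simp
  \<comment> \<open>The detour through \<open>fst z\<close> replaces an almost sure identification
    with \<open>x\<close>: the extra term integrates to \<open>sum_dist N x x = 0\<close>.\<close>
  also have "\<dots> \<le> (\<integral>\<^sup>+z. ennreal (sum_dist N x (fst z)) + ennreal (sum_dist N (fst z) (snd z)) \<partial>\<pi>)"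
  proof (intro nn_integral_mono)
    fix z
    show "ennreal (sum_dist N x (snd z)) \<le> ennreal (sum_dist N x (fst z)) + ennreal (sum_dist N (fst z) (snd z))"
      using ennreal_leI[OF sum_dist_triangle[of N x "snd z" "fst z"]] by (simp add: sum_dist_nonneg)
  qed
  also have "\<dots> = (\<integral>\<^sup>+z. ennreal (sum_dist N x (fst z)) \<partial>\<pi>) + (\<integral>\<^sup>+z. ennreal (sum_dist N (fst z) (snd z)) \<partial>\<pi>)"
    by (rule nn_integral_add) measurable
  also have "(\<integral>\<^sup>+z. ennreal (sum_dist N x (fst z)) \<partial>\<pi>) = 0"
    using nn_integral_coupling(1)[OF \<pi> m(2)] x by (simp add: nn_integral_return)
  finally show ?thesis using cost by (simp add: split_beta')
qed

text \<open>An update at site \<open>j\<close> moves the state by exactly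
  \<open>dist (x j) z\<close>, so the mean displacement of the chain is the average of the moments
  at the sites, and its finiteness bounds each of them.\<close>

lemma Kx_first_moment:
  assumes i: "i < N" and x: "x \<in> space \<Omega>"
  shows "(\<integral>\<^sup>+z. ennreal (dist (x i) z) \<partial>Kx i x) < \<infinity>"
proof -
  have sd: "sum_dist N x (x(j := z)) = dist (x j) z" if "j < N" for j z
  proof -
    have "sum_dist N x (x(j := z)) = (\<Sum>i<N. if i = j then dist (x j) z else 0)"
      unfolding sum_dist_def by (intro sum.cong) auto
    then show ?thesis using that by simp
  qed
  have fin: "(\<Sum>j<N. \<integral>\<^sup>+z. ennreal (dist (x j) z) \<partial>Kx j x) / ennreal (real N) < \<infinity>"
    using P_first_moment[OF x] nn_integral_P[OF x, of "\<lambda>y. ennreal (sum_dist N x y)"] measurable_sum_dist_right[OF x]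
    by (simp add: sd)
  have "(\<Sum>j<N. \<integral>\<^sup>+z. ennreal (dist (x j) z) \<partial>Kx j x) \<noteq> \<top>"
  proof
    assume "(\<Sum>j<N. \<integral>\<^sup>+z. ennreal (dist (x j) z) \<partial>Kx j x) = \<top>"
    with fin have "\<top> / ennreal (real N) < \<infinity>" by (simp only:)
    then show False by (simp add: ennreal_top_divide)
  qed
  then have "(\<Sum>j<N. \<integral>\<^sup>+z. ennreal (dist (x j) z) \<partial>Kx j x) < \<infinity>"
    unfolding infinity_ennreal_def by (rule top.not_eq_extremum[THEN iffD1])
  moreover have "(\<integral>\<^sup>+z. ennreal (dist (x i) z) \<partial>Kx i x) \<le> (\<Sum>j<N. \<integral>\<^sup>+z. ennreal (dist (x j) z) \<partial>Kx j x)"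
    using i by (intro member_le_sum) auto
  ultimately show ?thesis by (rule le_less_trans[rotated])
qed

text \<open>The iterates of \<open>f\<close> flatten, with Lipschitz constant
  \<open>D * \<rho> ^ n\<close>. This alone does not bound their distance to the mean, as
  \<open>sum_dist N x0\<close> may fail to be integrable under \<open>\<mu>\<close>. So convergence
  is first quantified at \<open>x0\<close> from successive differences, and the support of
  \<open>f\<close> confines the covariance to points within \<open>R\<close> of
  \<open>x0\<close>.\<close>

lemma decay_of_correlations:
  assumes \<rho>: "real_spectral_radius B < \<rho>" "\<rho> < 1" and x0: "x0 \<in> space \<Omega>"
    and f: "f \<in> test_functions N x0"
  shows "\<exists>C. \<forall>n. (\<integral>x. f x * (TR ^^ n) f x \<partial>\<mu>) - (\<integral>x. f x \<partial>\<mu>)\<^sup>2 \<le> C * \<rho> ^ n"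
proof -
  have N0: "N > 0" using N_pos by simp
  have \<rho>0: "0 < \<rho>" using real_spectral_radius_nonneg[OF B_carrier N0] \<rho>(1) by simp
  from f obtain b L R where fm: "f \<in> borel_measurable \<Omega>"
    and b: "\<And>x. x \<in> space \<Omega> \<Longrightarrow> \<bar>f x\<bar> \<le> b"
    and L: "0 \<le> L" "\<And>x y. x \<in> space \<Omega> \<Longrightarrow> y \<in> space \<Omega> \<Longrightarrow> \<bar>f x - f y\<bar> \<le> L * sum_dist N x y"
    and R: "\<And>x. x \<in> space \<Omega> \<Longrightarrow> R < sum_dist N x0 x \<Longrightarrow> f x = 0"
    unfolding test_functions_def by blast
  have fb: "f \<in> bounded_functions" using fm b by (auto simp: bounded_functions_iff)
  note itb = bounded_functions_iterate[OF fb]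
  obtain c where c: "0 \<le> c" "\<And>k i j. i < N \<Longrightarrow> j < N \<Longrightarrow> \<bar>(B ^\<^sub>m k) $$ (i, j)\<bar> \<le> c * \<rho> ^ k"
    using pow_mat_entries_bound[OF B_carrier N0 \<rho>(1)] by blast
  \<comment> \<open>Column sums of the \<open>n\<close>-th power of \<open>B\<close> are at most
    \<open>N * c * \<rho> ^ n\<close>; multiplication by \<open>L\<close> leaves \<open>D\<close> in
    front of the power.\<close>
  define D where "D = L * real N * c"
  have D: "0 \<le> D" using L c by (simp add: D_def)
  have lip: "\<bar>(TR ^^ n) f x - (TR ^^ n) f y\<bar> \<le> D * \<rho> ^ n * sum_dist N x y" if x: "x \<in> space \<Omega>" and y: "y \<in> space \<Omega>" for n x y
  proof -
    have "\<bar>(TR ^^ n) f x - (TR ^^ n) f y\<bar> \<le> (\<Sum>j<N. L * (\<Sum>i<N. (B ^\<^sub>m n) $$ (i, j)) * dist (x j) (y j))"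
      using coord_lipschitz_iterate[OF fb L] x y by (simp add: coord_lipschitz_def)
    also have "\<dots> \<le> (\<Sum>j<N. L * (\<Sum>i<N. c * \<rho> ^ n) * dist (x j) (y j))"
      using c(2) L(1) by (intro sum_mono mult_right_mono mult_left_mono) (auto intro: order_trans[OF abs_ge_self])
    finally show ?thesis by (simp add: D_def sum_dist_def sum_distrib_left mult_ac)
  qed
  define m where "m = (\<integral>x. f x \<partial>\<mu>)"
  obtain M0 where M0: "(\<integral>\<^sup>+y. ennreal (sum_dist N x0 y) \<partial>P x0) = ennreal M0" "0 \<le> M0"
    using P_first_moment[OF x0] by (cases "\<integral>\<^sup>+y. ennreal (sum_dist N x0 y) \<partial>P x0") auto
  \<comment> \<open>The difference is the mean increment of the \<open>n\<close>-th iterate over one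
    step from \<open>x0\<close>, so the Lipschitz bound meets the mean displacement
    \<open>M0\<close>.\<close>
  have step: "\<bar>(TR ^^ Suc n) f x0 - (TR ^^ n) f x0\<bar> \<le> D * M0 * \<rho> ^ n" for n
  proof -
    interpret P0: prob_space "P x0" by (rule P_prob(1)[OF x0])
    have sp: "space (P x0) = space \<Omega>" by (rule sets_eq_imp_space_eq[OF P_prob(2)[OF x0]])
    let ?g = "(TR ^^ n) f"
    obtain b' where b': "\<And>x. x \<in> space \<Omega> \<Longrightarrow> \<bar>?g x\<bar> \<le> b'" and gm: "?g \<in> borel_measurable \<Omega>"
      using itb[of n] by (auto simp: bounded_functions_iff)
    have gm': "?g \<in> borel_measurable (P x0)" using gm by (simp add: measurable_cong_sets[OF P_prob(2)[OF x0] refl])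
    have gi: "integrable (P x0) ?g"
      using b' sp gm' by (intro P0.integrable_const_bound[of _ b']) auto
    have "ennreal \<bar>(TR ^^ Suc n) f x0 - ?g x0\<bar> = ennreal (norm (\<integral>y. ?g y - ?g x0 \<partial>P x0))"
      using gi by (simp add: P0.prob_space)
    also have "\<dots> \<le> (\<integral>\<^sup>+y. ennreal (norm (?g y - ?g x0)) \<partial>P x0)"
      using gi by (intro integral_norm_bound_ennreal) auto
    also have "\<dots> \<le> (\<integral>\<^sup>+y. ennreal (D * \<rho> ^ n) * ennreal (sum_dist N x0 y) \<partial>P x0)"
    proof (intro nn_integral_mono)
      fix y assume "y \<in> space (P x0)"
      then have "\<bar>?g y - ?g x0\<bar> \<le> D * \<rho> ^ n * sum_dist N x0 y"
        using lip[of x0 y n] x0 by (simp add: sp abs_minus_commute)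
      then show "ennreal (norm (?g y - ?g x0)) \<le> ennreal (D * \<rho> ^ n) * ennreal (sum_dist N x0 y)"
        using D \<rho>0 by (subst ennreal_mult[symmetric]) (simp_all add: sum_dist_nonneg ennreal_leI)
    qed
    also have "\<dots> = ennreal (D * \<rho> ^ n * M0)"
      using D \<rho>0 M0 measurable_sum_dist_right[OF x0]
      by (subst nn_integral_cmult) (simp_all add: measurable_cong_sets[OF P_prob(2)[OF x0] refl] ennreal_mult)
    finally show ?thesis using D \<rho>0 M0 by (subst (asm) ennreal_le_iff) (auto simp: mult_ac)
  qed
  \<comment> \<open>Only the limit is identified here, without a rate. The differences between
    \<open>x\<close> and \<open>x0\<close> vanish pointwise and are bounded by \<open>2 * b\<close>,
    so dominated convergence requires no moment, and every iterate has mean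
    \<open>m\<close>.\<close>
  have lim: "(\<lambda>n. (TR ^^ n) f x0) \<longlonglongrightarrow> m"
  proof -
    have "(\<lambda>n. \<integral>x. (TR ^^ n) f x - (TR ^^ n) f x0 \<partial>\<mu>) \<longlonglongrightarrow> (\<integral>x. 0 \<partial>\<mu>)"
    proof (rule integral_dominated_convergence[where w="\<lambda>_. 2 * b"])
      show "(\<lambda>x. (TR ^^ n) f x - (TR ^^ n) f x0) \<in> borel_measurable \<mu>" for n
        using bounded_functions_integrable[OF itb[of n]] by auto
      show "AE x in \<mu>. (\<lambda>n. (TR ^^ n) f x - (TR ^^ n) f x0) \<longlonglongrightarrow> 0"
      proof (rule AE_I2)
        fix x assume "x \<in> space \<mu>"
        then have x: "x \<in> space \<Omega>" by (simp add: space_\<mu>)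
        have lim0: "(\<lambda>n. D * \<rho> ^ n * sum_dist N x x0) \<longlonglongrightarrow> D * 0 * sum_dist N x x0"
          using \<rho>0 \<rho>(2) by (intro tendsto_mult tendsto_const LIMSEQ_realpow_zero) auto
        show "(\<lambda>n. (TR ^^ n) f x - (TR ^^ n) f x0) \<longlonglongrightarrow> 0"
        proof (rule Lim_null_comparison)
          show "\<forall>\<^sub>F n in sequentially. norm ((TR ^^ n) f x - (TR ^^ n) f x0) \<le> D * \<rho> ^ n * sum_dist N x x0"
            unfolding real_norm_def by (intro always_eventually allI lip x x0)
        qed (use lim0 in simp)
      qed
      have it_bound: "\<bar>(TR ^^ n) f x\<bar> \<le> b" if "x \<in> space \<Omega>" for n x
        using that
      proof (induction n arbitrary: x)
        case (Suc n)
        interpret Px: prob_space "P x" by (rule P_prob(1)[OF Suc.prems])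
        have sp: "space (P x) = space \<Omega>" by (rule sets_eq_imp_space_eq[OF P_prob(2)[OF Suc.prems]])
        have gm': "(TR ^^ n) f \<in> borel_measurable (P x)"
          using itb[of n] by (simp add: bounded_functions_iff measurable_cong_sets[OF P_prob(2)[OF Suc.prems] refl])
        have gi: "integrable (P x) ((TR ^^ n) f)"
          using Suc.IH sp gm' by (intro Px.integrable_const_bound[of _ b]) auto
        have "\<bar>(TR ^^ Suc n) f x\<bar> \<le> (\<integral>y. \<bar>(TR ^^ n) f y\<bar> \<partial>P x)" by simp
        also have "\<dots> \<le> (\<integral>y. b \<partial>P x)" using gi Suc.IH sp by (intro integral_mono) auto
        finally show ?case by (simp add: Px.prob_space)
      qed (use b in simp)
      show "AE x in \<mu>. norm ((TR ^^ n) f x - (TR ^^ n) f x0) \<le> 2 * b" for n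
      proof (rule AE_I2)
        fix x assume "x \<in> space \<mu>"
        then show "norm ((TR ^^ n) f x - (TR ^^ n) f x0) \<le> 2 * b"
          using it_bound[of x n] it_bound[OF x0, of n] by (simp add: space_\<mu>)
      qed
    qed auto
    then have "(\<lambda>n. m - (TR ^^ n) f x0) \<longlonglongrightarrow> 0"
      using bounded_functions_integrable[OF itb] integral_TR_iterate[OF fb] by (simp add: prob_space m_def)
    then have "(\<lambda>n. m - (m - (TR ^^ n) f x0)) \<longlonglongrightarrow> m - 0" by (intro tendsto_intros)
    then show ?thesis by simp
  qed
  \<comment> \<open>A geometric sum of the successive differences; letting \<open>k\<close> grow
    turns it into a rate of convergence to \<open>m\<close>.\<close>
  have tail: "\<bar>(TR ^^ (n + k)) f x0 - (TR ^^ n) f x0\<bar> \<le> D * M0 * \<rho> ^ n / (1 - \<rho>)" for n k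
  proof -
    have "\<bar>(TR ^^ (n + k)) f x0 - (TR ^^ n) f x0\<bar> \<le> (\<Sum>j<k. D * M0 * \<rho> ^ (n + j))"
    proof (induction k)
      case (Suc k)
      then show ?case using step[of "n + k"] by simp
    qed simp
    also have "\<dots> = D * M0 * \<rho> ^ n * (\<Sum>j<k. \<rho> ^ j)" by (simp add: sum_distrib_left power_add mult_ac)
    also have "\<dots> \<le> D * M0 * \<rho> ^ n * (\<Sum>j. \<rho> ^ j)"
      using D M0 \<rho>0 \<rho>(2) by (intro mult_left_mono sum_le_suminf summable_geometric) auto
    also have "(\<Sum>j. \<rho> ^ j) = 1 / (1 - \<rho>)" using \<rho>0 \<rho>(2) by (intro suminf_geometric) auto
    finally show ?thesis by simp
  qed
  have conv: "\<bar>m - (TR ^^ n) f x0\<bar> \<le> D * M0 * \<rho> ^ n / (1 - \<rho>)" for n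
  proof (rule LIMSEQ_le_const2)
    have "(\<lambda>k. (TR ^^ (k + n)) f x0) \<longlonglongrightarrow> m" using lim by (rule LIMSEQ_ignore_initial_segment)
    then show "(\<lambda>k. \<bar>(TR ^^ (k + n)) f x0 - (TR ^^ n) f x0\<bar>) \<longlonglongrightarrow> \<bar>m - (TR ^^ n) f x0\<bar>"
      by (intro tendsto_intros)
    show "\<exists>K. \<forall>k\<ge>K. \<bar>(TR ^^ (k + n)) f x0 - (TR ^^ n) f x0\<bar> \<le> D * M0 * \<rho> ^ n / (1 - \<rho>)"
      using tail[of n] by (auto simp: add.commute)
  qed
  \<comment> \<open>The first term bounds the passage from a point of the support to
    \<open>x0\<close>, the second the passage from \<open>x0\<close> to the mean;
    \<open>max 0 R\<close> guards against a negative radius.\<close>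
  define E where "E = D * max 0 R + D * M0 / (1 - \<rho>)"
  have near: "\<bar>f x * ((TR ^^ n) f x - m)\<bar> \<le> max 0 b * (E * \<rho> ^ n)" if x: "x \<in> space \<Omega>" for n x
  proof (cases "R < sum_dist N x0 x")
    case True
    have "0 \<le> E" using D M0 \<rho>(2) by (simp add: E_def)
    then show ?thesis using R[OF x True] \<rho>0 by simp
  next
    case False
    have "\<bar>(TR ^^ n) f x - m\<bar> \<le> \<bar>(TR ^^ n) f x - (TR ^^ n) f x0\<bar> + \<bar>m - (TR ^^ n) f x0\<bar>" by linarith
    also have "\<dots> \<le> D * \<rho> ^ n * sum_dist N x x0 + D * M0 * \<rho> ^ n / (1 - \<rho>)"
      by (intro add_mono lip x x0 conv)
    also have "\<dots> \<le> D * \<rho> ^ n * max 0 R + D * M0 * \<rho> ^ n / (1 - \<rho>)"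
      using False D \<rho>0 by (intro add_right_mono mult_left_mono) (auto simp: sum_dist_commute[of N x])
    also have "\<dots> = E * \<rho> ^ n" by (simp add: E_def algebra_simps)
    finally have "\<bar>(TR ^^ n) f x - m\<bar> \<le> E * \<rho> ^ n" .
    moreover have "\<bar>f x\<bar> \<le> max 0 b" using b[OF x] by simp
    ultimately show ?thesis unfolding abs_mult by (intro mult_mono) auto
  qed
  have "(\<integral>x. f x * (TR ^^ n) f x \<partial>\<mu>) - m\<^sup>2 \<le> max 0 b * E * \<rho> ^ n" for n
  proof -
    have i1: "integrable \<mu> (\<lambda>x. f x * (TR ^^ n) f x)" and i2: "integrable \<mu> f"
      by (intro bounded_functions_integrable bounded_functions_mult fb itb)+
    have "(\<integral>x. f x * (TR ^^ n) f x \<partial>\<mu>) - m\<^sup>2 = (\<integral>x. f x * (TR ^^ n) f x - f x * m \<partial>\<mu>)"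
      using i1 i2 by (simp add: m_def power2_eq_square)
    also have "\<dots> \<le> (\<integral>x. max 0 b * (E * \<rho> ^ n) \<partial>\<mu>)"
    proof (rule integral_mono)
      show "f x * (TR ^^ n) f x - f x * m \<le> max 0 b * (E * \<rho> ^ n)" if "x \<in> space \<mu>" for x
        using near[of x n] that by (simp add: space_\<mu> right_diff_distrib[symmetric])
    qed (use i1 i2 in auto)
    finally show ?thesis by (simp add: prob_space mult.assoc)
  qed
  then show ?thesis unfolding m_def by blast
qed

text \<open>Contraction holds for every \<open>\<rho>\<close> strictly between the spectral radius
  of \<open>B\<close> and 1, and \<open>\<rho>\<close> can be taken arbitrarily close to the former.
  For a spectral radius of at least 1 the claim follows from nonnegativity of the gap, which is the
  case \<open>contracts 1\<close>.\<close>

theorem absolute_spectral_gap_glauber: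
  "1 - real_spectral_radius B \<le> absolute_spectral_gap \<mu> P"
proof -
  have N0: "N > 0" using N_pos by simp
  define x0 :: "nat \<Rightarrow> 'l" where "x0 = restrict undefined {..<N}"
  have x0: "x0 \<in> space \<Omega>" by (simp add: x0_def space_Omega)
  interpret dense_test_functions \<mu> N x0
    by unfold_locales (rule sets_\<mu>)
  have r0: "0 \<le> real_spectral_radius B" by (rule real_spectral_radius_nonneg[OF B_carrier N0])
  have contr: "contracts \<rho>" if \<rho>: "real_spectral_radius B < \<rho>" "\<rho> < 1" for \<rho>
  proof (rule contracts_of_dense[where D="test_functions N x0"])
    have \<rho>0: "0 < \<rho>" using r0 \<rho>(1) by simp
    then show "0 \<le> \<rho>" by simp
    show sub: "test_functions N x0 \<subseteq> bounded_functions"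
    proof
      fix g :: "(nat \<Rightarrow> 'l) \<Rightarrow> real" assume "g \<in> test_functions N x0"
      then show "g \<in> bounded_functions" by (simp add: test_functions_def bounded_functions_iff)
    qed
    fix g assume g: "g \<in> test_functions N x0"
    obtain C where "\<And>n. (\<integral>x. g x * (TR ^^ n) g x \<partial>\<mu>) - (\<integral>x. g x \<partial>\<mu>)\<^sup>2 \<le> C * \<rho> ^ n"
      using decay_of_correlations[OF \<rho> x0 g] by blast
    then show "(\<integral>x. (TR (\<lambda>x. g x - (\<integral>y. g y \<partial>\<mu>)) x)\<^sup>2 \<partial>\<mu>) \<le> \<rho>\<^sup>2 * (\<integral>x. (g x - (\<integral>y. g y \<partial>\<mu>))\<^sup>2 \<partial>\<mu>)"
      using g sub by (intro contraction_of_decay[OF P_reversible _ \<rho>0]) auto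
  next
    fix u :: "(nat \<Rightarrow> 'l) \<Rightarrow> real" and \<epsilon> :: real
    assume "u \<in> borel_measurable \<mu>" "integrable \<mu> (\<lambda>x. (u x)\<^sup>2)" "0 < \<epsilon>"
    then show "\<exists>g\<in>test_functions N x0. (\<integral>\<^sup>+x. ennreal ((u x - g x)\<^sup>2) \<partial>\<mu>) < ennreal \<epsilon>"
      by (rule test_functions_dense)
  qed
  show ?thesis
  proof (rule ccontr)
    assume less: "\<not> ?thesis"
    have "0 \<le> absolute_spectral_gap \<mu> P" using absolute_spectral_gap_ge[OF _ _ contracts_1] by simp
    then have "real_spectral_radius B < 1" using less by simp
    moreover have "real_spectral_radius B < 1 - absolute_spectral_gap \<mu> P" using less by simp
    ultimately obtain \<rho> where \<rho>: "real_spectral_radius B < \<rho>" "\<rho> < min 1 (1 - absolute_spectral_gap \<mu> P)"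
      using dense[of "real_spectral_radius B" "min 1 (1 - absolute_spectral_gap \<mu> P)"] by auto
    then have "1 - \<rho> \<le> absolute_spectral_gap \<mu> P"
      using r0 by (intro absolute_spectral_gap_ge contr) auto
    with \<rho>(2) show False by simp
  qed
qed

end

section \<open>Iterated couplings and the curvature bound\<close>

lemma measurable_kernel_power:
  assumes "P \<in> M \<rightarrow>\<^sub>M prob_algebra M"
  shows "kernel_power M P k \<in> M \<rightarrow>\<^sub>M prob_algebra M"
proof (induction k)
  case 0
  show ?case using measurable_return_prob_space[of M] by (simp cong: measurable_cong)
next
  case (Suc k)
  then show ?case using assms by (simp add: measurable_bind_prob_space)
qed

lemma nn_integral_kernel_power_Suc:
  assumes P: "P \<in> M \<rightarrow>\<^sub>M prob_algebra M" and x: "x \<in> space M" and f: "f \<in> borel_measurable M"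
  shows "(\<integral>\<^sup>+y. f y \<partial>kernel_power M P (Suc k) x) = (\<integral>\<^sup>+u. \<integral>\<^sup>+y. f y \<partial>P u \<partial>kernel_power M P k x)"
proof -
  have "sets (kernel_power M P k x) = sets M"
    using measurable_space[OF measurable_kernel_power[OF P] x] by (simp add: space_prob_algebra)
  then have "P \<in> kernel_power M P k x \<rightarrow>\<^sub>M subprob_algebra M"
    using measurable_prob_algebraD[OF P] by (simp cong: measurable_cong_sets)
  with f show ?thesis by (simp add: nn_integral_bind)
qed

text \<open>Integrating out the last step of the paired kernel leaves
  \<open>emeasure (P (fst w)) S\<close>, a function of the first component alone, to which the
  induction hypothesis on the first marginal applies; likewise for the second.\<close>

lemma kernel_power_coupling:
  assumes P: "P \<in> M \<rightarrow>\<^sub>M prob_algebra M" and Q: "Q \<in> M \<Otimes>\<^sub>M M \<rightarrow>\<^sub>M prob_algebra (M \<Otimes>\<^sub>M M)"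
    and coupling: "\<And>u v. u \<in> space M \<Longrightarrow> v \<in> space M \<Longrightarrow> Q (u, v) \<in> couplings (P u) (P v)"
    and x: "x \<in> space M" and y: "y \<in> space M"
  shows "kernel_power (M \<Otimes>\<^sub>M M) Q k (x, y) \<in> couplings (kernel_power M P k x) (kernel_power M P k y)"
proof (induction k)
  let ?M2 = "M \<Otimes>\<^sub>M M"
  have xy: "(x, y) \<in> space ?M2" using x y by (simp add: space_pair_measure)
  have sets_P: "sets (kernel_power M P k u) = sets M" if "u \<in> space M" for k u
    using measurable_space[OF measurable_kernel_power[OF P] that] by (simp add: space_prob_algebra)
  have sets_Q: "sets (kernel_power ?M2 Q k (x, y)) = sets ?M2" for k
    using measurable_space[OF measurable_kernel_power[OF Q] xy] by (simp add: space_prob_algebra)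
  have sets_eq: "sets (kernel_power ?M2 Q k (x, y)) = sets (kernel_power M P k x \<Otimes>\<^sub>M kernel_power M P k y)" for k
    using sets_pair_measure_cong[OF sets_P[OF x] sets_P[OF y]] by (simp only: sets_Q)
  {
    case 0
    show ?case
    proof (rule couplingsI[OF sets_eq])
      show "(\<integral>\<^sup>+z. indicator S (fst z) \<partial>kernel_power ?M2 Q 0 (x, y)) = emeasure (kernel_power M P 0 x) S"
        if "S \<in> sets (kernel_power M P 0 x)" for S
        using that x xy by (subst kernel_power.simps(1), subst nn_integral_return) auto
      show "(\<integral>\<^sup>+z. indicator S (snd z) \<partial>kernel_power ?M2 Q 0 (x, y)) = emeasure (kernel_power M P 0 y) S"
        if "S \<in> sets (kernel_power M P 0 y)" for S
        using that y xy by (subst kernel_power.simps(1), subst nn_integral_return) auto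
    qed
  next
    case (Suc k)
    have space_Q: "space (kernel_power ?M2 Q k (x, y)) = space M \<times> space M"
      using sets_eq_imp_space_eq[OF sets_Q] by (simp add: space_pair_measure)
    have PS: "P \<in> M \<rightarrow>\<^sub>M subprob_algebra M" by (rule measurable_prob_algebraD[OF P])
    have emeas: "(\<lambda>u. emeasure (P u) S) \<in> borel_measurable (kernel_power M P k v)" if "S \<in> sets M" "v \<in> space M" for S v
      using measurable_emeasure_kernel[OF PS that(1)] by (simp add: measurable_cong_sets[OF sets_P[OF that(2)] refl])
    have marg: "(\<integral>\<^sup>+u. emeasure (P u) S \<partial>kernel_power M P k v) = emeasure (kernel_power M P (Suc k) v) S"
      if S: "S \<in> sets M" and v: "v \<in> space M" for S v
    proof -
      have "emeasure (kernel_power M P (Suc k) v) S = (\<integral>\<^sup>+y. indicator S y \<partial>kernel_power M P (Suc k) v)"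
        using S by (subst nn_integral_indicator) (simp_all only: sets_P[OF v])
      also have "\<dots> = (\<integral>\<^sup>+u. \<integral>\<^sup>+y. indicator S y \<partial>P u \<partial>kernel_power M P k v)"
        by (rule nn_integral_kernel_power_Suc[OF P v]) (use S in simp)
      also have "\<dots> = (\<integral>\<^sup>+u. emeasure (P u) S \<partial>kernel_power M P k v)"
      proof (intro nn_integral_cong)
        fix u assume "u \<in> space (kernel_power M P k v)"
        then have "u \<in> space M" using sets_eq_imp_space_eq[OF sets_P[OF v]] by simp
        then have "sets (P u) = sets M" using measurable_space[OF P] by (simp add: space_prob_algebra)
        then show "(\<integral>\<^sup>+y. indicator S y \<partial>P u) = emeasure (P u) S" using S by simp
      qed
      finally show ?thesis by simp
    qed
    show ?case
    proof (rule couplingsI[OF sets_eq])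
      fix S assume "S \<in> sets (kernel_power M P (Suc k) x)"
      then have S: "S \<in> sets M" by (simp only: sets_P[OF x])
      have "(\<integral>\<^sup>+z. indicator S (fst z) \<partial>kernel_power ?M2 Q (Suc k) (x, y))
          = (\<integral>\<^sup>+w. \<integral>\<^sup>+z. indicator S (fst z) \<partial>Q w \<partial>kernel_power ?M2 Q k (x, y))"
        by (rule nn_integral_kernel_power_Suc[OF Q xy]) (use S in measurable)
      also have "\<dots> = (\<integral>\<^sup>+w. emeasure (P (fst w)) S \<partial>kernel_power ?M2 Q k (x, y))"
      proof (intro nn_integral_cong)
        fix w assume "w \<in> space (kernel_power ?M2 Q k (x, y))"
        then have w: "fst w \<in> space M" "snd w \<in> space M" by (auto simp: space_Q)
        have "S \<in> sets (P (fst w))" using measurable_space[OF P w(1)] S by (simp add: space_prob_algebra)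
        then show "(\<integral>\<^sup>+z. indicator S (fst z) \<partial>Q w) = emeasure (P (fst w)) S"
          using nn_integral_coupling(1)[OF coupling[OF w], of "indicator S"] by simp
      qed
      also have "\<dots> = (\<integral>\<^sup>+u. emeasure (P u) S \<partial>kernel_power M P k x)"
        by (rule nn_integral_coupling(1)[OF Suc emeas[OF S x]])
      finally show "(\<integral>\<^sup>+z. indicator S (fst z) \<partial>kernel_power ?M2 Q (Suc k) (x, y)) = emeasure (kernel_power M P (Suc k) x) S"
        by (simp only: marg[OF S x])
    next
      fix S assume "S \<in> sets (kernel_power M P (Suc k) y)"
      then have S: "S \<in> sets M" by (simp only: sets_P[OF y])
      have "(\<integral>\<^sup>+z. indicator S (snd z) \<partial>kernel_power ?M2 Q (Suc k) (x, y))
          = (\<integral>\<^sup>+w. \<integral>\<^sup>+z. indicator S (snd z) \<partial>Q w \<partial>kernel_power ?M2 Q k (x, y))"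
        by (rule nn_integral_kernel_power_Suc[OF Q xy]) (use S in measurable)
      also have "\<dots> = (\<integral>\<^sup>+w. emeasure (P (snd w)) S \<partial>kernel_power ?M2 Q k (x, y))"
      proof (intro nn_integral_cong)
        fix w assume "w \<in> space (kernel_power ?M2 Q k (x, y))"
        then have w: "fst w \<in> space M" "snd w \<in> space M" by (auto simp: space_Q)
        have "S \<in> sets (P (snd w))" using measurable_space[OF P w(2)] S by (simp add: space_prob_algebra)
        then show "(\<integral>\<^sup>+z. indicator S (snd z) \<partial>Q w) = emeasure (P (snd w)) S"
          using nn_integral_coupling(2)[OF coupling[OF w], of "indicator S"] by simp
      qed
      also have "\<dots> = (\<integral>\<^sup>+u. emeasure (P u) S \<partial>kernel_power M P k y)"
        by (rule nn_integral_coupling(2)[OF Suc emeas[OF S y]])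
      finally show "(\<integral>\<^sup>+z. indicator S (snd z) \<partial>kernel_power ?M2 Q (Suc k) (x, y)) = emeasure (kernel_power M P (Suc k) y) S"
        by (simp only: marg[OF S y])
    qed
  }
qed

context glauber_chain
begin

abbreviation \<Omega>2 where "\<Omega>2 \<equiv> \<Omega> \<Otimes>\<^sub>M \<Omega>"

lemma measurable_coord_dist:
  assumes i: "i < N"
  shows "(\<lambda>t. ennreal (dist (fst t i) (snd t i))) \<in> borel_measurable \<Omega>2"
proof -
  have [measurable]: "(\<lambda>t. fst t i) \<in> borel_measurable \<Omega>2" "(\<lambda>t. snd t i) \<in> borel_measurable \<Omega>2"
    by (rule measurable_compose[OF measurable_fst measurable_component_singleton],
        use i in simp, rule measurable_compose[OF measurable_snd measurable_component_singleton], use i in simp)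
  show ?thesis by measurable
qed

lemma coordinate_coupling_exists:
  assumes i: "i < N" and \<epsilon>: "0 < \<epsilon>"
  shows "\<exists>T. T \<in> \<Omega>2 \<rightarrow>\<^sub>M prob_algebra (borel \<Otimes>\<^sub>M borel) \<and>
    (\<forall>x\<in>space \<Omega>. \<forall>y\<in>space \<Omega>. T (x, y) \<in> couplings (Kx i x) (Kx i y) \<and>
      (\<integral>\<^sup>+t. ennreal (dist (fst t) (snd t)) \<partial>T (x, y)) \<le> ennreal ((\<Sum>j<N. A $$ (i, j) * dist (x j) (y j)) + \<epsilon>))"
proof -
  let ?b = "\<lambda>w. \<Sum>j<N. A $$ (i, j) * dist (fst w j) (snd w j)"
  have b0: "0 \<le> ?b w" for w :: "(nat \<Rightarrow> 'l) \<times> (nat \<Rightarrow> 'l)"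
    using A_nonneg i by (auto intro!: sum_nonneg)
  \<comment> \<open>The moments are known about \<open>x i\<close>, which varies with the state,
    while the selection wants one base point for all pairs. The triangle inequality moves them to
    the fixed point \<open>undefined\<close>.\<close>
  have mom: "(\<integral>\<^sup>+z. ennreal (dist undefined z) \<partial>Kx i x) < \<top>" if x: "x \<in> space \<Omega>" for x
  proof -
    interpret Kp: prob_space "Kx i x" by (rule Kx_prob(1)[OF i x])
    note [measurable_cong] = Kx_prob(2)[OF i x]
    have "(\<integral>\<^sup>+z. ennreal (dist undefined z) \<partial>Kx i x) \<le> (\<integral>\<^sup>+z. ennreal (dist undefined (x i)) + ennreal (dist (x i) z) \<partial>Kx i x)"
    proof (intro nn_integral_mono)
      fix z
      show "ennreal (dist undefined z) \<le> ennreal (dist undefined (x i)) + ennreal (dist (x i) z)"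
        using ennreal_leI[OF dist_triangle[of undefined z "x i"]] by simp
    qed
    also have "\<dots> = ennreal (dist undefined (x i)) + (\<integral>\<^sup>+z. ennreal (dist (x i) z) \<partial>Kx i x)"
      by (subst nn_integral_add) (auto simp: Kp.emeasure_space_1)
    also have "\<dots> < \<top>" using Kx_first_moment[OF i x] by simp
    finally show ?thesis .
  qed
  have p: "(\<lambda>w. Kx i (fst w)) \<in> \<Omega>2 \<rightarrow>\<^sub>M prob_algebra borel" and q: "(\<lambda>w. Kx i (snd w)) \<in> \<Omega>2 \<rightarrow>\<^sub>M prob_algebra borel"
    by (rule measurable_compose[OF measurable_fst measurable_Kx[OF i]], rule measurable_compose[OF measurable_snd measurable_Kx[OF i]])
  have bm: "(\<lambda>w. ennreal (?b w)) \<in> borel_measurable \<Omega>2" by measurable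
  obtain T where T: "T \<in> \<Omega>2 \<rightarrow>\<^sub>M prob_algebra (borel \<Otimes>\<^sub>M borel)"
    "\<And>w. w \<in> space \<Omega>2 \<Longrightarrow> T w \<in> couplings (Kx i (fst w)) (Kx i (snd w))"
    "\<And>w. w \<in> space \<Omega>2 \<Longrightarrow> (\<integral>\<^sup>+(x, y). ennreal (dist x y) \<partial>T w) \<le> ennreal (?b w) + ennreal \<epsilon>"
  proof (rule measurable_near_optimal_couplings[OF p q bm])
    show "W1 dist (Kx i (fst w)) (Kx i (snd w)) \<le> ennreal (?b w)" if "w \<in> space \<Omega>2" for w
      using that by (intro W1_Kx i) (auto simp: space_pair_measure)
    show "(\<integral>\<^sup>+z. ennreal (dist undefined z) \<partial>Kx i (fst w)) < \<top>" "(\<integral>\<^sup>+z. ennreal (dist undefined z) \<partial>Kx i (snd w)) < \<top>"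
      if "w \<in> space \<Omega>2" for w
      using that by (auto simp: space_pair_measure intro!: mom)
  qed (use \<epsilon> in auto)
  show ?thesis
  proof (intro exI[of _ T] conjI ballI)
    fix x y assume "x \<in> space \<Omega>" "y \<in> space \<Omega>"
    then have w: "(x, y) \<in> space \<Omega>2" by (simp add: space_pair_measure)
    show "T (x, y) \<in> couplings (Kx i x) (Kx i y)" using T(2)[OF w] by simp
    show "(\<integral>\<^sup>+t. ennreal (dist (fst t) (snd t)) \<partial>T (x, y)) \<le> ennreal ((\<Sum>j<N. A $$ (i, j) * dist (x j) (y j)) + \<epsilon>)"
      using T(3)[OF w] b0[of "(x, y)"] \<epsilon> by (simp add: split_beta')
  qed (rule T(1))
qed

lemma B_row:
  assumes i: "i < N"
  shows "(\<Sum>j<N. B $$ (i, j) * d j) = ((real N - 1) * d i + (\<Sum>j<N. A $$ (i, j) * d j)) / real N"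
proof -
  define c where "c = (real N - 1) / real N"
  have "(\<Sum>j<N. B $$ (i, j) * d j) = (\<Sum>j<N. c * (if i = j then d j else 0) + A $$ (i, j) * d j / real N)"
    using i by (intro sum.cong refl) (auto simp: glauber_matrix_index[OF A_carrier] c_def algebra_simps)
  also have "\<dots> = c * d i + (\<Sum>j<N. A $$ (i, j) * d j) / real N"
    using i by (simp add: sum.distrib sum_distrib_left[symmetric] sum_divide_distrib)
  finally show ?thesis by (simp add: c_def add_divide_distrib)
qed

text \<open>Both chains resample the same site, with the selected coupling of the two conditional
  laws. Coordinate \<open>i\<close> keeps its distance with probability \<open>(N - 1) / N\<close>
  and otherwise receives the Dobrushin bound, which together is row \<open>i\<close> of
  \<open>B\<close>. The error \<open>\<epsilon> / N\<close> is enlarged to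
  \<open>\<epsilon>\<close>.\<close>

lemma step_coupling_exists:
  assumes \<epsilon>: "0 < \<epsilon>"
  shows "\<exists>Q. Q \<in> \<Omega>2 \<rightarrow>\<^sub>M prob_algebra \<Omega>2 \<and>
    (\<forall>x\<in>space \<Omega>. \<forall>y\<in>space \<Omega>. Q (x, y) \<in> couplings (P x) (P y) \<and>
      (\<forall>i<N. (\<integral>\<^sup>+t. ennreal (dist (fst t i) (snd t i)) \<partial>Q (x, y)) \<le> ennreal ((\<Sum>j<N. B $$ (i, j) * dist (x j) (y j)) + \<epsilon>)))"
proof -
  have "\<forall>i\<in>{..<N}. \<exists>T. T \<in> \<Omega>2 \<rightarrow>\<^sub>M prob_algebra (borel \<Otimes>\<^sub>M borel) \<and>
    (\<forall>x\<in>space \<Omega>. \<forall>y\<in>space \<Omega>. T (x, y) \<in> couplings (Kx i x) (Kx i y) \<and>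
      (\<integral>\<^sup>+t. ennreal (dist (fst t) (snd t)) \<partial>T (x, y)) \<le> ennreal ((\<Sum>j<N. A $$ (i, j) * dist (x j) (y j)) + \<epsilon>))"
    using coordinate_coupling_exists[OF _ \<epsilon>] by auto
  from bchoice[OF this] obtain T where "\<forall>i\<in>{..<N}. T i \<in> \<Omega>2 \<rightarrow>\<^sub>M prob_algebra (borel \<Otimes>\<^sub>M borel) \<and>
    (\<forall>x\<in>space \<Omega>. \<forall>y\<in>space \<Omega>. T i (x, y) \<in> couplings (Kx i x) (Kx i y) \<and>
      (\<integral>\<^sup>+t. ennreal (dist (fst t) (snd t)) \<partial>T i (x, y)) \<le> ennreal ((\<Sum>j<N. A $$ (i, j) * dist (x j) (y j)) + \<epsilon>))" ..
  then have T_meas: "\<And>i. i < N \<Longrightarrow> T i \<in> \<Omega>2 \<rightarrow>\<^sub>M prob_algebra (borel \<Otimes>\<^sub>M borel)"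
    and T_coupling: "\<And>i x y. i < N \<Longrightarrow> x \<in> space \<Omega> \<Longrightarrow> y \<in> space \<Omega> \<Longrightarrow> T i (x, y) \<in> couplings (Kx i x) (Kx i y)"
    and T_cost: "\<And>i x y. i < N \<Longrightarrow> x \<in> space \<Omega> \<Longrightarrow> y \<in> space \<Omega> \<Longrightarrow>
      (\<integral>\<^sup>+t. ennreal (dist (fst t) (snd t)) \<partial>T i (x, y)) \<le> ennreal ((\<Sum>j<N. A $$ (i, j) * dist (x j) (y j)) + \<epsilon>)"
    by blast+
  define up where "up i w t = ((fst w)(i := fst t), (snd w)(i := snd t))" for i :: nat and w :: "(nat \<Rightarrow> 'l) \<times> (nat \<Rightarrow> 'l)" and t :: "'l \<times> 'l"
  have up_meas: "(\<lambda>(w, t). up i w t) \<in> \<Omega>2 \<Otimes>\<^sub>M (borel \<Otimes>\<^sub>M borel) \<rightarrow>\<^sub>M \<Omega>2" if i: "i < N" for i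
  proof -
    have "(\<lambda>z. (fst (fst z))(i := fst (snd z))) \<in> \<Omega>2 \<Otimes>\<^sub>M (borel \<Otimes>\<^sub>M borel) \<rightarrow>\<^sub>M \<Omega>"
      by (rule measurable_fun_upd[where J="{..<N}"]) (use i in \<open>auto intro: measurable_compose[OF measurable_fst] measurable_compose[OF measurable_snd]\<close>)
    moreover have "(\<lambda>z. (snd (fst z))(i := snd (snd z))) \<in> \<Omega>2 \<Otimes>\<^sub>M (borel \<Otimes>\<^sub>M borel) \<rightarrow>\<^sub>M \<Omega>"
      by (rule measurable_fun_upd[where J="{..<N}"]) (use i in \<open>auto intro: measurable_compose[OF measurable_fst] measurable_compose[OF measurable_snd]\<close>)
    ultimately show ?thesis unfolding up_def split_beta' by (rule measurable_Pair)
  qed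
  define V where "V i w = distr (T i w) \<Omega>2 (up i w)" for i w
  have V_meas: "V i \<in> \<Omega>2 \<rightarrow>\<^sub>M prob_algebra \<Omega>2" if "i < N" for i
    unfolding V_def[abs_def] by (rule measurable_distr_prob_space2[OF T_meas[OF that] up_meas[OF that]])
  define Q where "Q w = uniform_count_measure {..<N} \<bind> (\<lambda>i. V i w)" for w
  have Q_meas: "Q \<in> \<Omega>2 \<rightarrow>\<^sub>M prob_algebra \<Omega>2"
    unfolding Q_def[abs_def] by (rule measurable_uniform_mixture[OF N_pos V_meas])
  have Q_int: "(\<integral>\<^sup>+z. f z \<partial>Q (x, y)) = (\<Sum>i<N. \<integral>\<^sup>+t. f (x(i := fst t), y(i := snd t)) \<partial>T i (x, y)) / ennreal (real N)"
    if x: "x \<in> space \<Omega>" and y: "y \<in> space \<Omega>" and f: "f \<in> borel_measurable \<Omega>2" for f x y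
  proof -
    have w: "(x, y) \<in> space \<Omega>2" using x y by (simp add: space_pair_measure)
    have "(\<integral>\<^sup>+z. f z \<partial>Q (x, y)) = (\<Sum>i<N. \<integral>\<^sup>+z. f z \<partial>V i (x, y)) / ennreal (real N)"
      unfolding Q_def by (rule nn_integral_uniform_mixture[OF N_pos measurable_space[OF V_meas w] f])
    also have "(\<Sum>i<N. \<integral>\<^sup>+z. f z \<partial>V i (x, y)) = (\<Sum>i<N. \<integral>\<^sup>+t. f (x(i := fst t), y(i := snd t)) \<partial>T i (x, y))"
    proof (rule sum.cong[OF refl])
      fix i assume "i \<in> {..<N}"
      then have i: "i < N" by simp
      have "sets (T i (x, y)) = sets (borel \<Otimes>\<^sub>M borel)"
        using measurable_space[OF T_meas[OF i] w] by (simp add: space_prob_algebra)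
      then have "up i (x, y) \<in> T i (x, y) \<rightarrow>\<^sub>M \<Omega>2"
        using measurable_compose[OF measurable_Pair1'[OF w] up_meas[OF i]] by (simp cong: measurable_cong_sets)
      then show "(\<integral>\<^sup>+z. f z \<partial>V i (x, y)) = (\<integral>\<^sup>+t. f (x(i := fst t), y(i := snd t)) \<partial>T i (x, y))"
        unfolding V_def using f by (subst nn_integral_distr) (auto simp: up_def)
    qed
    finally show ?thesis .
  qed
  show ?thesis
  proof (intro exI[of _ Q] conjI ballI allI impI)
    show "Q \<in> \<Omega>2 \<rightarrow>\<^sub>M prob_algebra \<Omega>2" by (rule Q_meas)
    fix x y assume x: "x \<in> space \<Omega>" and y: "y \<in> space \<Omega>"
    have w: "(x, y) \<in> space \<Omega>2" using x y by (simp add: space_pair_measure)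
    have sets_Q: "sets (Q (x, y)) = sets \<Omega>2"
      using measurable_space[OF Q_meas w] by (simp add: space_prob_algebra)
    have P_emeasure: "(\<Sum>i<N. \<integral>\<^sup>+z. indicator S (u(i := z)) \<partial>Kx i u) / ennreal (real N) = emeasure (P u) S"
      if "u \<in> space \<Omega>" "S \<in> sets \<Omega>" for u S
      using that nn_integral_P[OF that(1), of "indicator S"] P_prob(2)[OF that(1)] by simp
    have ind_meas: "(\<lambda>z. indicator S (u(i := z))) \<in> borel_measurable (Kx i u)"
      if "i < N" "u \<in> space \<Omega>" "S \<in> sets \<Omega>" for i u S
      by (rule measurable_compose[OF measurable_upd_x[OF that(1,2)]]) (use that in simp)
    show "Q (x, y) \<in> couplings (P x) (P y)"
    proof (rule couplingsI)
      show "sets (Q (x, y)) = sets (P x \<Otimes>\<^sub>M P y)"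
        using sets_pair_measure_cong[OF P_prob(2)[OF x] P_prob(2)[OF y]] by (simp only: sets_Q)
      fix S assume "S \<in> sets (P x)"
      then have S: "S \<in> sets \<Omega>" using P_prob(2)[OF x] by simp
      have "(\<integral>\<^sup>+z. indicator S (fst z) \<partial>Q (x, y)) = (\<Sum>i<N. \<integral>\<^sup>+t. indicator S (x(i := fst t)) \<partial>T i (x, y)) / ennreal (real N)"
        using S by (subst Q_int[OF x y]) auto
      also have "(\<Sum>i<N. \<integral>\<^sup>+t. indicator S (x(i := fst t)) \<partial>T i (x, y)) = (\<Sum>i<N. \<integral>\<^sup>+z. indicator S (x(i := z)) \<partial>Kx i x)"
        by (intro sum.cong refl nn_integral_coupling(1)[OF T_coupling] x y ind_meas S) auto
      finally show "(\<integral>\<^sup>+z. indicator S (fst z) \<partial>Q (x, y)) = emeasure (P x) S"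
        by (simp only: P_emeasure[OF x S])
    next
      fix S assume "S \<in> sets (P y)"
      then have S: "S \<in> sets \<Omega>" using P_prob(2)[OF y] by simp
      have "(\<integral>\<^sup>+z. indicator S (snd z) \<partial>Q (x, y)) = (\<Sum>i<N. \<integral>\<^sup>+t. indicator S (y(i := snd t)) \<partial>T i (x, y)) / ennreal (real N)"
        using S by (subst Q_int[OF x y]) auto
      also have "(\<Sum>i<N. \<integral>\<^sup>+t. indicator S (y(i := snd t)) \<partial>T i (x, y)) = (\<Sum>i<N. \<integral>\<^sup>+z. indicator S (y(i := z)) \<partial>Kx i y)"
        by (intro sum.cong refl nn_integral_coupling(2)[OF T_coupling] x y ind_meas S) auto
      finally show "(\<integral>\<^sup>+z. indicator S (snd z) \<partial>Q (x, y)) = emeasure (P y) S"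
        by (simp only: P_emeasure[OF y S])
    qed
    fix i assume i: "i < N"
    let ?d = "\<lambda>j. dist (x j) (y j)"
    let ?a = "(\<Sum>j<N. A $$ (i, j) * ?d j)"
    have a0: "0 \<le> ?a" using A_nonneg i by (auto intro!: sum_nonneg)
    have dm: "(\<lambda>t. ennreal (dist (fst t i) (snd t i))) \<in> borel_measurable \<Omega>2" by (rule measurable_coord_dist[OF i])
    have part: "(\<integral>\<^sup>+t. ennreal (dist ((x(l := fst t)) i) ((y(l := snd t)) i)) \<partial>T l (x, y))
        \<le> ennreal (if l = i then ?a + \<epsilon> else ?d i)" if l: "l < N" for l
    proof (cases "l = i")
      case True
      then show ?thesis using T_cost[OF i x y] by simp
    next
      case False
      have "prob_space (T l (x, y))" using measurable_space[OF T_meas[OF l] w] by (simp add: space_prob_algebra)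
      then show ?thesis using False by (simp add: prob_space.emeasure_space_1)
    qed
    have "(\<integral>\<^sup>+t. ennreal (dist (fst t i) (snd t i)) \<partial>Q (x, y))
        = (\<Sum>l<N. \<integral>\<^sup>+t. ennreal (dist ((x(l := fst t)) i) ((y(l := snd t)) i)) \<partial>T l (x, y)) / ennreal (real N)"
      using Q_int[OF x y dm] by simp
    also have "\<dots> \<le> (\<Sum>l<N. ennreal (if l = i then ?a + \<epsilon> else ?d i)) / ennreal (real N)"
      by (intro divide_right_mono_ennreal sum_mono part) auto
    also have "(\<Sum>l<N. ennreal (if l = i then ?a + \<epsilon> else ?d i)) = ennreal (\<Sum>l<N. if l = i then ?a + \<epsilon> else ?d i)"
      using a0 \<epsilon> by (intro sum_ennreal) auto
    also have "(\<Sum>l<N. if l = i then ?a + \<epsilon> else ?d i) = ?a + \<epsilon> + (real N - 1) * ?d i"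
    proof -
      have "(\<Sum>l<N. if l = i then ?a + \<epsilon> else ?d i) = (?a + \<epsilon>) + (\<Sum>l\<in>{..<N} - {i}. if l = i then ?a + \<epsilon> else ?d i)"
        using i by (subst sum.remove[of _ i]) auto
      also have "(\<Sum>l\<in>{..<N} - {i}. if l = i then ?a + \<epsilon> else ?d i) = (\<Sum>l\<in>{..<N} - {i}. ?d i)"
        by (intro sum.cong) auto
      finally show ?thesis using i by (simp add: of_nat_diff)
    qed
    also have "ennreal (?a + \<epsilon> + (real N - 1) * ?d i) / ennreal (real N) = ennreal ((?a + \<epsilon> + (real N - 1) * ?d i) / real N)"
      using a0 \<epsilon> N_pos by (intro divide_ennreal) auto
    also have "\<dots> \<le> ennreal ((\<Sum>j<N. B $$ (i, j) * ?d j) + \<epsilon>)"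
    proof (rule ennreal_leI)
      have "\<epsilon> / real N \<le> \<epsilon>" using \<epsilon> N_pos by (simp add: divide_le_eq)
      then show "(?a + \<epsilon> + (real N - 1) * ?d i) / real N \<le> (\<Sum>j<N. B $$ (i, j) * ?d j) + \<epsilon>"
        unfolding B_row[OF i] by (simp add: add_divide_distrib)
    qed
    finally show "(\<integral>\<^sup>+t. ennreal (dist (fst t i) (snd t i)) \<partial>Q (x, y)) \<le> ennreal ((\<Sum>j<N. B $$ (i, j) * ?d j) + \<epsilon>)" .
  qed
qed

text \<open>Up to a small error the vector of expected coordinate distances is dominated by
  \<open>B ^\<^sub>m k\<close> applied to the initial one. Adding its entries combines the initial
  distances with column sums of the power, whence its induced norm.\<close>

lemma W1_kernel_power:
  assumes x: "x \<in> space \<Omega>" and y: "y \<in> space \<Omega>"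
  shows "W1 (sum_dist N) (kernel_power \<Omega> P k x) (kernel_power \<Omega> P k y)
    \<le> ennreal (mat_l1_norm (B ^\<^sub>m k) * sum_dist N x y)"
proof -
  let ?d = "\<lambda>j. dist (x j) (y j)"
  \<comment> \<open>Each step applies \<open>B\<close> to the old errors and adds a fresh
    \<open>\<epsilon>\<close>, so \<open>\<epsilon> * c k i\<close> is the error accumulated at
    coordinate \<open>i\<close>. As \<open>c\<close> does not involve \<open>\<epsilon>\<close>, the
    error vanishes with \<open>\<epsilon>\<close> for fixed \<open>k\<close>.\<close>
  define c where "c = rec_nat (\<lambda>_. 0) (\<lambda>_ c i. (\<Sum>j<N. B $$ (i, j) * c j) + 1)"
  have c_0: "c 0 i = 0" and c_Suc: "c (Suc k) i = (\<Sum>j<N. B $$ (i, j) * c k j) + 1" for k i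
    by (simp_all add: c_def)
  have c_nonneg: "i < N \<Longrightarrow> 0 \<le> c k i" for k i
    by (induction k arbitrary: i) (auto simp: c_0 c_Suc intro!: add_nonneg_nonneg sum_nonneg mult_nonneg_nonneg B_nonneg)
  have Bk: "B ^\<^sub>m k \<in> carrier_mat N N" for k by (rule pow_carrier_mat[OF B_carrier])
  have xy: "(x, y) \<in> space \<Omega>2" using x y by (simp add: space_pair_measure)
  have dm: "(\<lambda>t. ennreal (dist (fst t i) (snd t i))) \<in> borel_measurable \<Omega>2" if "i < N" for i
    by (rule measurable_coord_dist[OF that])
  have bound: "W1 (sum_dist N) (kernel_power \<Omega> P k x) (kernel_power \<Omega> P k y)
      \<le> ennreal (mat_l1_norm (B ^\<^sub>m k) * sum_dist N x y + \<epsilon> * (\<Sum>i<N. c k i))" if \<epsilon>: "0 < \<epsilon>" for \<epsilon>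
  proof -
    obtain Q where Q: "Q \<in> \<Omega>2 \<rightarrow>\<^sub>M prob_algebra \<Omega>2"
      and Q_coupling: "\<And>x y. x \<in> space \<Omega> \<Longrightarrow> y \<in> space \<Omega> \<Longrightarrow> Q (x, y) \<in> couplings (P x) (P y)"
      and Q_cost: "\<And>x y i. x \<in> space \<Omega> \<Longrightarrow> y \<in> space \<Omega> \<Longrightarrow> i < N \<Longrightarrow>
        (\<integral>\<^sup>+t. ennreal (dist (fst t i) (snd t i)) \<partial>Q (x, y)) \<le> ennreal ((\<Sum>j<N. B $$ (i, j) * dist (x j) (y j)) + \<epsilon>)"
      using step_coupling_exists[OF \<epsilon>] by blast
    let ?\<pi> = "\<lambda>k. kernel_power \<Omega>2 Q k (x, y)"
    have \<pi>_prob: "prob_space (?\<pi> k)" and \<pi>_sets: "sets (?\<pi> k) = sets \<Omega>2" for k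
      using measurable_space[OF measurable_kernel_power[OF Q] xy] by (auto simp: space_prob_algebra)
    have cost: "(\<integral>\<^sup>+t. ennreal (dist (fst t i) (snd t i)) \<partial>?\<pi> k) \<le> ennreal ((\<Sum>j<N. (B ^\<^sub>m k) $$ (i, j) * ?d j) + \<epsilon> * c k i)"
      if "i < N" for i k
      using that
    proof (induction k arbitrary: i)
      case 0
      have "(\<Sum>j<N. (B ^\<^sub>m 0) $$ (i, j) * ?d j) = (\<Sum>j<N. if i = j then ?d j else 0)"
        using 0 carrier_matD[OF B_carrier] by (intro sum.cong) auto
      then show ?case
        using 0 nn_integral_return[OF xy dm[OF 0]] by (simp add: c_0)
    next
      case (Suc k)
      have space_\<pi>: "space (?\<pi> k) = space \<Omega> \<times> space \<Omega>"
        using sets_eq_imp_space_eq[OF \<pi>_sets] by (simp add: space_pair_measure)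
      have dm': "(\<lambda>t. ennreal (dist (fst t j) (snd t j))) \<in> borel_measurable (?\<pi> k)" if "j < N" for j
        using dm[OF that] by (simp only: measurable_cong_sets[OF \<pi>_sets refl])
      let ?e = "\<lambda>j. (\<Sum>l<N. (B ^\<^sub>m k) $$ (j, l) * ?d l) + \<epsilon> * c k j"
      have e0: "0 \<le> ?e j" if "j < N" for j
        using that \<epsilon> c_nonneg B_pow_nonneg by (auto intro!: add_nonneg_nonneg sum_nonneg mult_nonneg_nonneg)
      have "(\<integral>\<^sup>+t. ennreal (dist (fst t i) (snd t i)) \<partial>?\<pi> (Suc k))
          = (\<integral>\<^sup>+w. \<integral>\<^sup>+t. ennreal (dist (fst t i) (snd t i)) \<partial>Q w \<partial>?\<pi> k)"
        by (rule nn_integral_kernel_power_Suc[OF Q xy dm[OF Suc.prems]])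
      also have "\<dots> \<le> (\<integral>\<^sup>+w. (\<Sum>j<N. ennreal (B $$ (i, j)) * ennreal (dist (fst w j) (snd w j))) + ennreal \<epsilon> \<partial>?\<pi> k)"
      proof (intro nn_integral_mono)
        fix w assume "w \<in> space (?\<pi> k)"
        then have w: "fst w \<in> space \<Omega>" "snd w \<in> space \<Omega>" by (auto simp: space_\<pi>)
        have "(\<Sum>j<N. ennreal (B $$ (i, j)) * ennreal (dist (fst w j) (snd w j))) = ennreal (\<Sum>j<N. B $$ (i, j) * dist (fst w j) (snd w j))"
          using B_nonneg[OF Suc.prems] by (subst sum_ennreal[symmetric]) (auto simp: ennreal_mult)
        moreover have "0 \<le> (\<Sum>j<N. B $$ (i, j) * dist (fst w j) (snd w j))"
          using B_nonneg[OF Suc.prems] by (auto intro!: sum_nonneg)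
        ultimately show "(\<integral>\<^sup>+t. ennreal (dist (fst t i) (snd t i)) \<partial>Q w)
            \<le> (\<Sum>j<N. ennreal (B $$ (i, j)) * ennreal (dist (fst w j) (snd w j))) + ennreal \<epsilon>"
          using Q_cost[OF w Suc.prems] \<epsilon> by simp
      qed
      also have "\<dots> = (\<Sum>j<N. ennreal (B $$ (i, j)) * (\<integral>\<^sup>+w. ennreal (dist (fst w j) (snd w j)) \<partial>?\<pi> k)) + ennreal \<epsilon>"
      proof -
        have "(\<integral>\<^sup>+w. (\<Sum>j<N. ennreal (B $$ (i, j)) * ennreal (dist (fst w j) (snd w j))) + ennreal \<epsilon> \<partial>?\<pi> k)
            = (\<integral>\<^sup>+w. (\<Sum>j<N. ennreal (B $$ (i, j)) * ennreal (dist (fst w j) (snd w j))) \<partial>?\<pi> k) + ennreal \<epsilon>"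
          using dm' \<pi>_prob[of k] by (subst nn_integral_add) (auto simp: prob_space.emeasure_space_1)
        also have "(\<integral>\<^sup>+w. (\<Sum>j<N. ennreal (B $$ (i, j)) * ennreal (dist (fst w j) (snd w j))) \<partial>?\<pi> k)
            = (\<Sum>j<N. \<integral>\<^sup>+w. ennreal (B $$ (i, j)) * ennreal (dist (fst w j) (snd w j)) \<partial>?\<pi> k)"
          using dm' by (intro nn_integral_sum borel_measurable_times) auto
        also have "\<dots> = (\<Sum>j<N. ennreal (B $$ (i, j)) * (\<integral>\<^sup>+w. ennreal (dist (fst w j) (snd w j)) \<partial>?\<pi> k))"
          using dm' by (intro sum.cong nn_integral_cmult) auto
        finally show ?thesis .
      qed
      also have "\<dots> \<le> (\<Sum>j<N. ennreal (B $$ (i, j)) * ennreal (?e j)) + ennreal \<epsilon>"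
        by (intro add_right_mono sum_mono mult_left_mono Suc.IH) auto
      also have "(\<Sum>j<N. ennreal (B $$ (i, j)) * ennreal (?e j)) = ennreal (\<Sum>j<N. B $$ (i, j) * ?e j)"
        using B_nonneg[OF Suc.prems] e0 by (subst sum_ennreal[symmetric]) (auto simp: ennreal_mult)
      also have "ennreal (\<Sum>j<N. B $$ (i, j) * ?e j) + ennreal \<epsilon> = ennreal ((\<Sum>j<N. B $$ (i, j) * ?e j) + \<epsilon>)"
        using B_nonneg[OF Suc.prems] e0 \<epsilon> by (intro ennreal_plus[symmetric] sum_nonneg mult_nonneg_nonneg) auto
      also have "(\<Sum>j<N. B $$ (i, j) * ?e j) + \<epsilon> = (\<Sum>j<N. (B ^\<^sub>m Suc k) $$ (i, j) * ?d j) + \<epsilon> * c (Suc k) i"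
      proof -
        have "(\<Sum>l<N. (B ^\<^sub>m Suc k) $$ (i, l) * ?d l) = (\<Sum>l<N. \<Sum>j<N. B $$ (i, j) * (B ^\<^sub>m k) $$ (j, l) * ?d l)"
          using Suc.prems
          by (intro sum.cong refl)
            (simp only: pow_mat_Suc_left[OF B_carrier] mat_mult_index_sum[OF B_carrier Bk] lessThan_iff sum_distrib_right)
        also have "\<dots> = (\<Sum>j<N. \<Sum>l<N. B $$ (i, j) * (B ^\<^sub>m k) $$ (j, l) * ?d l)" by (rule sum.swap)
        finally show ?thesis
          by (simp only: c_Suc) (simp add: distrib_left sum.distrib sum_distrib_left mult_ac)
      qed
      finally show ?case .
    qed
    have "W1 (sum_dist N) (kernel_power \<Omega> P k x) (kernel_power \<Omega> P k y) \<le> (\<integral>\<^sup>+t. ennreal (sum_dist N (fst t) (snd t)) \<partial>?\<pi> k)"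
      unfolding W1_def split_beta'
      by (rule INF_lower[OF kernel_power_coupling[OF measurable_P Q Q_coupling x y]])
    also have "\<dots> = (\<integral>\<^sup>+t. (\<Sum>i<N. ennreal (dist (fst t i) (snd t i))) \<partial>?\<pi> k)"
      by (simp add: sum_dist_def)
    also have "\<dots> = (\<Sum>i<N. \<integral>\<^sup>+t. ennreal (dist (fst t i) (snd t i)) \<partial>?\<pi> k)"
      using dm by (intro nn_integral_sum) (simp add: measurable_cong_sets[OF \<pi>_sets refl])
    also have "\<dots> \<le> (\<Sum>i<N. ennreal ((\<Sum>j<N. (B ^\<^sub>m k) $$ (i, j) * ?d j) + \<epsilon> * c k i))"
      by (intro sum_mono cost) auto
    also have "\<dots> = ennreal (\<Sum>i<N. (\<Sum>j<N. (B ^\<^sub>m k) $$ (i, j) * ?d j) + \<epsilon> * c k i)"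
      using \<epsilon> c_nonneg B_pow_nonneg by (intro sum_ennreal) (auto intro!: add_nonneg_nonneg sum_nonneg mult_nonneg_nonneg)
    also have "\<dots> \<le> ennreal (mat_l1_norm (B ^\<^sub>m k) * sum_dist N x y + \<epsilon> * (\<Sum>i<N. c k i))"
    proof (rule ennreal_leI)
      have "(\<Sum>i<N. \<Sum>j<N. (B ^\<^sub>m k) $$ (i, j) * ?d j) = (\<Sum>j<N. (\<Sum>i<N. (B ^\<^sub>m k) $$ (i, j)) * ?d j)"
        by (subst sum.swap) (simp add: sum_distrib_right)
      also have "\<dots> \<le> (\<Sum>j<N. mat_l1_norm (B ^\<^sub>m k) * ?d j)"
      proof (intro sum_mono mult_right_mono)
        fix j assume "j \<in> {..<N}"
        then show "(\<Sum>i<N. (B ^\<^sub>m k) $$ (i, j)) \<le> mat_l1_norm (B ^\<^sub>m k)"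
          by (intro order_trans[OF sum_mono[OF abs_ge_self] col_sum_le_mat_l1_norm[OF Bk]]) simp
      qed simp
      finally show "(\<Sum>i<N. (\<Sum>j<N. (B ^\<^sub>m k) $$ (i, j) * ?d j) + \<epsilon> * c k i) \<le> mat_l1_norm (B ^\<^sub>m k) * sum_dist N x y + \<epsilon> * (\<Sum>i<N. c k i)"
        by (simp add: sum.distrib sum_distrib_left sum_dist_def)
    qed
    finally show ?thesis .
  qed
  show ?thesis
  proof (rule ennreal_le_epsilon)
    fix e :: real assume e: "0 < e"
    have C0: "0 \<le> (\<Sum>i<N. c k i)" using c_nonneg by (auto intro!: sum_nonneg)
    \<comment> \<open>The summand 1 keeps the denominator positive when no error has accumulated, as
      for \<open>k = 0\<close>.\<close>
    define \<epsilon> where "\<epsilon> = e / ((\<Sum>i<N. c k i) + 1)"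
    have \<epsilon>: "0 < \<epsilon>" "\<epsilon> * (\<Sum>i<N. c k i) \<le> e" using e C0 by (simp_all add: \<epsilon>_def field_simps)
    have "0 \<le> mat_l1_norm (B ^\<^sub>m k)"
      using order_trans[OF sum_nonneg col_sum_le_mat_l1_norm[OF Bk, of 0 k]] N_pos by auto
    then have n0: "0 \<le> mat_l1_norm (B ^\<^sub>m k) * sum_dist N x y" by (simp add: sum_dist_nonneg)
    have "W1 (sum_dist N) (kernel_power \<Omega> P k x) (kernel_power \<Omega> P k y)
      \<le> ennreal (mat_l1_norm (B ^\<^sub>m k) * sum_dist N x y + e)"
      using \<epsilon> by (intro order_trans[OF bound[OF \<epsilon>(1)]] ennreal_leI) simp
    then show "W1 (sum_dist N) (kernel_power \<Omega> P k x) (kernel_power \<Omega> P k y)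
      \<le> ennreal (mat_l1_norm (B ^\<^sub>m k) * sum_dist N x y) + ennreal e"
      using n0 e by simp
  qed
qed

text \<open>Distinct points of \<open>space \<Omega>\<close> are extensional, hence differ at some
  coordinate below \<open>N\<close> and have positive distance. The bound also makes
  \<open>W1\<close> finite, so the extended-real quotient becomes an ordinary one.\<close>

theorem kappa_glauber:
  "ereal (1 - mat_l1_norm (B ^\<^sub>m k)) \<le> kappa \<Omega> (sum_dist N) P k"
  unfolding kappa_def
proof (intro INF_greatest)
  fix x y assume x: "x \<in> space \<Omega>" and y: "y \<in> space \<Omega>"
  let ?n = "mat_l1_norm (B ^\<^sub>m k)"
  have n0: "0 \<le> ?n"
    using order_trans[OF sum_nonneg col_sum_le_mat_l1_norm[OF pow_carrier_mat[OF B_carrier], of 0 k]] N_pos by auto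
  show "ereal (1 - ?n) \<le> kappa_at \<Omega> (sum_dist N) P k x y"
  proof (cases "x = y")
    case True
    then show ?thesis using n0 by (simp add: kappa_at_def one_ereal_def)
  next
    case False
    have "\<exists>i<N. x i \<noteq> y i"
    proof (rule ccontr)
      assume "\<not> ?thesis"
      then have "x = y" using x y by (intro extensionalityI[of x "{..<N}" y]) (auto simp: space_Omega)
      with False show False by simp
    qed
    then obtain i where i: "i < N" "x i \<noteq> y i" by blast
    have "0 < dist (x i) (y i)" using i by simp
    also have "\<dots> \<le> sum_dist N x y" unfolding sum_dist_def using i by (intro member_le_sum) auto
    finally have d: "0 < sum_dist N x y" .
    define w where "w = enn2real (W1 (sum_dist N) (kernel_power \<Omega> P k x) (kernel_power \<Omega> P k y))"
    have le: "W1 (sum_dist N) (kernel_power \<Omega> P k x) (kernel_power \<Omega> P k y) \<le> ennreal (?n * sum_dist N x y)"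
      by (rule W1_kernel_power[OF x y])
    have W: "W1 (sum_dist N) (kernel_power \<Omega> P k x) (kernel_power \<Omega> P k y) = ennreal w" "0 \<le> w"
      using le_less_trans[OF le ennreal_less_top] by (auto simp: w_def)
    have "w \<le> ?n * sum_dist N x y" using le n0 d by (simp add: W)
    then have "w / sum_dist N x y \<le> ?n" using d by (simp add: divide_le_eq)
    then show ?thesis
      using False W(2) d by (simp add: kappa_at_def W(1) one_ereal_def)
  qed
qed

end

theorem proposition4p4:
  fixes N :: nat
    and \<mu> :: "(nat \<Rightarrow> 'l::polish_space) measure"
    and K :: "nat \<Rightarrow> (nat \<Rightarrow> 'l) \<Rightarrow> 'l measure"
    and A :: "real mat"
  assumes "N \<ge> 1"
    and "prob_space \<mu>"
    and "sets \<mu> = sets (Omega N)"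
    and "conditional_distributions N \<mu> K"
    and "dobrushin_matrix N K A"
    and "\<forall>x\<in>space (Omega N). W1 (sum_dist N) (return (Omega N) x) (glauber N K x) < \<infinity>"
  shows "(\<forall>k\<ge>1. kappa (Omega N) (sum_dist N) (glauber N K) k
                  \<ge> ereal (1 - mat_l1_norm (glauber_matrix N A ^\<^sub>m k)))
       \<and> absolute_spectral_gap \<mu> (glauber N K) \<ge> 1 - real_spectral_radius (glauber_matrix N A)
       \<and> 1 - real_spectral_radius (glauber_matrix N A) \<ge> (1 - real_spectral_radius A) / real N"
proof -
  interpret glauber_chain N \<mu> K A using assms by (rule glauber_chain.intro)
  show ?thesis
    using kappa_glauber absolute_spectral_gap_glauber glauber_matrix_spectral_radius[OF A_carrier N_pos] by blast
qed

end
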